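(* Let $[M,\mathcal S]$ be a compatible pair, let $b\in\mathcal S$ and $a=\exp(b)$. Then $$\det P_NM(a)P_N\sim G[a]^N\,\hat E[a]\qquad\text{as }N\to\infty,$$ where $$\hat E[a]=\exp\Big(\mathrm{trace}(M(b)-T(b))-\tfrac12\,\mathrm{trace}\,H(b)^2+\mathrm{trace}\,H(b)H(\tilde b)\Big).$$
   Context: Notation. $\mathbb T$ is the unit circle; for $a\in L^1(\mathbb T)$ the Fourier coefficients are $a_n=[a]_n=\frac1{2\pi}\int_{-\pi}^{\pi}a(e^{i\theta})e^{-in\theta}\,d\theta$, $n\in\mathbb Z$; $\tilde a(t)=a(t^{-1})$. $\ell^2$ is the space of complex square-summable sequences $\{x_n\}_{n=0}^\infty$, $\mathcal L(\ell^2)$ the bounded linear operators on it, $\mathcal C_1(\ell^2)$ the trace class operators. For $a\in L^\infty(\mathbb T)$, $T(a)=(a_{j-k})_{j,k\ge0}$ and $H(a)=(a_{j+k+1})_{j,k\ge0}$ are the Toeplitz and Hankel operators on $\ell^2$. Compatible pair. $\mathcal S$ is a unital Banach algebra of functions on $\mathbb T$, continuously embedded in $L^\infty(\mathbb T)$, such that (i) the Riesz projection $\sum_{k\in\mathbb Z}a_ke^{ik\theta}\mapsto\sum_{k\ge0}a_ke^{ik\theta}$ is well defined and bounded on $\mathcal S$, and (ii) $a\mapsto\tilde a$ is well defined and bounded on $\mathcal S$. Put $\mathcal S_\pm=\{a\in\mathcal S: a_n=0 \text{ for all } n \text{ with } \pm n<0\}$ and $\mathcal S_0=\{a\in\mathcal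 S:a=\tilde a\}$. $M:\mathcal S\to\mathcal L(\ell^2)$ is a linear continuous map such that: (a) for $a\in\mathcal S$, $M(a)-T(a)\in\mathcal C_1(\ell^2)$ and $\|M(a)-T(a)\|_{\mathcal C_1(\ell^2)}\le C\|a\|_{\mathcal S}$ with a constant $C$ independent of $a$; (b) $M(abc)=T(a)M(b)M(c)$ whenever $a\in\mathcal S_-$, $b\in\mathcal S$, $c\in\mathcal S_0$; (c) $M(1)=I$. Then $[M,\mathcal S]$ is called a compatible pair. $P_N$ is the projection on $\ell^2$ keeping the first $N$ entries $x_0,\dots,x_{N-1}$ and replacing the others by $0$; $\det P_NAP_N$ is the determinant of $P_NAP_N$ acting on the image of $P_N$, i.e. of the upper-left $N\times N$ section of $A$. For $a=\exp(b)$, $G[a]=\exp\big(\frac1{2\pi}\int_{-\pi}^\pi \log a(e^{i\theta})\,d\theta\big)$ with $\log a=b$. The relation $x_N\sim y_N$ means $x_N/y_N\to1$. *)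

theory Defs
  imports "HOL-Analysis.Analysis" "Jordan_Normal_Form.Determinant"
begin

section \<open>The sequence space and its bounded operators\<close>

typedef ell2 = "{x :: nat \<Rightarrow> complex. summable (\<lambda>n. (cmod (x n))\<^sup>2)}"
  morphisms ell2_nth Abs_ell2
  by (rule exI[of _ "\<lambda>_. 0"]) simp

setup_lifting type_definition_ell2

lemma ell2_summable_add:
  fixes x y :: "nat \<Rightarrow> complex"
  assumes "summable (\<lambda>n. (cmod (x n))\<^sup>2)" "summable (\<lambda>n. (cmod (y n))\<^sup>2)"
  shows "summable (\<lambda>n. (cmod (x n + y n))\<^sup>2)"
proof (rule summable_comparison_test')
  show "summable (\<lambda>n. 2 * (cmod (x n))\<^sup>2 + 2 * (cmod (y n))\<^sup>2)"
    by (intro summable_add summable_mult assms)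
next
  fix n :: nat
  have "(cmod (x n + y n))\<^sup>2 \<le> (cmod (x n) + cmod (y n))\<^sup>2"
    by (intro power_mono norm_triangle_ineq) auto
  also have "\<dots> \<le> 2 * (cmod (x n))\<^sup>2 + 2 * (cmod (y n))\<^sup>2"
    using sum_squares_bound[of "cmod (x n)" "cmod (y n)"] by (simp add: power2_sum)
  finally show "norm ((cmod (x n + y n))\<^sup>2) \<le> 2 * (cmod (x n))\<^sup>2 + 2 * (cmod (y n))\<^sup>2"
    by simp
qed

lemma ell2_summable_scale:
  fixes x :: "nat \<Rightarrow> complex"
  assumes "summable (\<lambda>n. (cmod (x n))\<^sup>2)"
  shows "summable (\<lambda>n. (cmod (c * x n))\<^sup>2)"
  using summable_mult[OF assms, of "(cmod c)\<^sup>2"] by (simp add: norm_mult power_mult_distrib)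

lemma ell2_summable_prod:
  fixes x y :: "nat \<Rightarrow> complex"
  assumes "summable (\<lambda>n. (cmod (x n))\<^sup>2)" "summable (\<lambda>n. (cmod (y n))\<^sup>2)"
  shows "summable (\<lambda>n. cmod (x n) * cmod (y n))"
proof (rule summable_comparison_test')
  show "summable (\<lambda>n. (cmod (x n))\<^sup>2 + (cmod (y n))\<^sup>2)"
    by (intro summable_add assms)
next
  fix n :: nat
  have "2 * (cmod (x n) * cmod (y n)) \<le> (cmod (x n))\<^sup>2 + (cmod (y n))\<^sup>2"
    using sum_squares_bound[of "cmod (x n)" "cmod (y n)"] by (simp add: mult.assoc)
  moreover have "0 \<le> cmod (x n) * cmod (y n)" by simp
  ultimately show "norm (cmod (x n) * cmod (y n)) \<le> (cmod (x n))\<^sup>2 + (cmod (y n))\<^sup>2"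
    unfolding real_norm_def by linarith
qed

lemma ell2_summable_inner:
  fixes x y :: "nat \<Rightarrow> complex"
  assumes "summable (\<lambda>n. (cmod (x n))\<^sup>2)" "summable (\<lambda>n. (cmod (y n))\<^sup>2)"
  shows "summable (\<lambda>n. inner (x n) (y n))"
  by (rule summable_comparison_test'[OF ell2_summable_prod[OF assms]])
     (simp add: Cauchy_Schwarz_ineq2)

instantiation ell2 :: real_inner
begin

lift_definition zero_ell2 :: ell2 is "\<lambda>_. 0" by simp
lift_definition plus_ell2 :: "ell2 \<Rightarrow> ell2 \<Rightarrow> ell2" is "\<lambda>x y n. x n + y n"
  by (rule ell2_summable_add)
lift_definition uminus_ell2 :: "ell2 \<Rightarrow> ell2" is "\<lambda>x n. - x n" by simp
lift_definition minus_ell2 :: "ell2 \<Rightarrow> ell2 \<Rightarrow> ell2" is "\<lambda>x y n. x n - y n"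
  subgoal for x y using ell2_summable_add[of x "\<lambda>n. - y n"] by simp
  done
lift_definition scaleR_ell2 :: "real \<Rightarrow> ell2 \<Rightarrow> ell2" is "\<lambda>r x n. of_real r * x n"
  by (rule ell2_summable_scale)
lift_definition inner_ell2 :: "ell2 \<Rightarrow> ell2 \<Rightarrow> real" is "\<lambda>x y. \<Sum>n. inner (x n) (y n)" .
definition norm_ell2 :: "ell2 \<Rightarrow> real" where "norm_ell2 x = sqrt (inner x x)"
definition sgn_ell2 :: "ell2 \<Rightarrow> ell2" where "sgn_ell2 x = scaleR (inverse (norm x)) x"
definition dist_ell2 :: "ell2 \<Rightarrow> ell2 \<Rightarrow> real" where "dist_ell2 x y = norm (x - y)"
definition uniformity_ell2 :: "(ell2 \<times> ell2) filter"
  where "uniformity_ell2 = (INF e\<in>{0<..}. principal {(x, y). dist x y < e})"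
definition open_ell2 :: "ell2 set \<Rightarrow> bool"
  where "open_ell2 U \<longleftrightarrow> (\<forall>x\<in>U. eventually (\<lambda>(x', y). x' = x \<longrightarrow> y \<in> U) uniformity)"

instance
proof
  fix x y z :: ell2 and r s :: real
  show "x + y + z = x + (y + z)" by transfer (simp add: add.assoc)
  show "x + y = y + x" by transfer (simp add: add.commute)
  show "0 + x = x" by transfer simp
  show "- x + x = 0" by transfer simp
  show "x - y = x + - y" by transfer simp
  show "r *\<^sub>R (x + y) = r *\<^sub>R x + r *\<^sub>R y" by transfer (simp add: ring_distribs)
  show "(r + s) *\<^sub>R x = r *\<^sub>R x + s *\<^sub>R x" by transfer (simp add: ring_distribs)
  show "r *\<^sub>R s *\<^sub>R x = (r * s) *\<^sub>R x" by transfer (simp add: mult.assoc)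
  show "1 *\<^sub>R x = x" by transfer simp
  show "inner x y = inner y x" by transfer (simp add: inner_commute)
  show "inner (x + y) z = inner x z + inner y z"
    by transfer (simp add: inner_add_left suminf_add ell2_summable_inner)
  show "inner (r *\<^sub>R x) y = r * inner x y"
  proof transfer
    fix r :: real and x y :: "nat \<Rightarrow> complex"
    assume a: "summable (\<lambda>n. (cmod (x n))\<^sup>2)" "summable (\<lambda>n. (cmod (y n))\<^sup>2)"
    have "inner (of_real r * x n) (y n) = r * inner (x n) (y n)" for n
      by (metis inner_scaleR_left scaleR_conv_of_real)
    then show "(\<Sum>n. inner (of_real r * x n) (y n)) = r * (\<Sum>n. inner (x n) (y n))"
      by (simp add: suminf_mult ell2_summable_inner[OF a])
  qed
  show "0 \<le> inner x x"
    by transfer (simp add: suminf_nonneg ell2_summable_inner)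
  show "inner x x = 0 \<longleftrightarrow> x = 0"
  proof transfer
    fix x :: "nat \<Rightarrow> complex"
    assume a: "summable (\<lambda>n. (cmod (x n))\<^sup>2)"
    have "(\<Sum>n. inner (x n) (x n)) = 0 \<longleftrightarrow> (\<forall>n. inner (x n) (x n) = 0)"
      by (rule suminf_eq_zero_iff[OF ell2_summable_inner[OF a a]]) simp
    then show "(\<Sum>n. inner (x n) (x n)) = 0 \<longleftrightarrow> x = (\<lambda>_. 0)"
      by (auto simp: fun_eq_iff)
  qed
qed (simp_all add: norm_ell2_def sgn_ell2_def dist_ell2_def uniformity_ell2_def open_ell2_def)

end

lift_definition ell2_scaleC :: "complex \<Rightarrow> ell2 \<Rightarrow> ell2" is "\<lambda>c x n. c * x n"
  by (rule ell2_summable_scale)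

lift_definition ell2_unit :: "nat \<Rightarrow> ell2" is "\<lambda>k n. if n = k then 1 else 0"
  subgoal for k by (rule summable_finite[of "{k}"]) auto
  done

text \<open>The complex inner product, linear in the first argument.\<close>

definition cinner :: "ell2 \<Rightarrow> ell2 \<Rightarrow> complex"
  where "cinner x y = (\<Sum>n. ell2_nth x n * cnj (ell2_nth y n))"

text \<open>\<^typ>\<open>ell2 \<Rightarrow>\<^sub>L ell2\<close> consists of the bounded \<^emph>\<open>real\<close>-linear operators; the algebra
  of bounded operators on the complex Hilbert space is cut out by \<open>clinear_op\<close>. The norms agree.\<close>

definition clinear_op :: "(ell2 \<Rightarrow>\<^sub>L ell2) \<Rightarrow> bool"
  where "clinear_op A \<longleftrightarrow> (\<forall>c x. A (ell2_scaleC c x) = ell2_scaleC c (A x))"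

definition op_entry :: "(ell2 \<Rightarrow>\<^sub>L ell2) \<Rightarrow> nat \<Rightarrow> nat \<Rightarrow> complex"
  where "op_entry A j k = cinner (A (ell2_unit k)) (ell2_unit j)"

text \<open>A bounded operator is determined by its matrix. The description below is only meaningful for
  matrices of bounded operators, which includes all Toeplitz and Hankel matrices with symbol in
  \<open>L\<^sup>\<infinity>\<close>.\<close>

definition op_of_matrix :: "(nat \<Rightarrow> nat \<Rightarrow> complex) \<Rightarrow> (ell2 \<Rightarrow>\<^sub>L ell2)"
  where "op_of_matrix m = (THE A. clinear_op A \<and> (\<forall>j k. op_entry A j k = m j k))"

definition section_det :: "nat \<Rightarrow> (ell2 \<Rightarrow>\<^sub>L ell2) \<Rightarrow> complex"
  where "section_det N A = Determinant.det (Matrix.mat N N (\<lambda>(j, k). op_entry A j k))"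


section \<open>Trace class operators\<close>

text \<open>\<open>P\<close> is the modulus of \<open>A\<close>, i.e. the (unique) positive operator with \<open>P\<^sup>2 = A\<^sup>* A\<close>. Since
  positive operators are self-adjoint, this equation says that \<open>(P x, P y) = (A x, A y)\<close> for all
  \<open>x\<close>, \<open>y\<close>.\<close>

definition is_modulus :: "(ell2 \<Rightarrow>\<^sub>L ell2) \<Rightarrow> (ell2 \<Rightarrow>\<^sub>L ell2) \<Rightarrow> bool"
  where "is_modulus A P \<longleftrightarrow> clinear_op P \<and> (\<forall>x. cinner (P x) x \<in> \<real>\<^sub>\<ge>\<^sub>0) \<and>
    (\<forall>x y. cinner (P x) (P y) = cinner (A x) (A y))"

definition modulus :: "(ell2 \<Rightarrow>\<^sub>L ell2) \<Rightarrow> (ell2 \<Rightarrow>\<^sub>L ell2)"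
  where "modulus A = (SOME P. is_modulus A P)"

definition trace_class :: "(ell2 \<Rightarrow>\<^sub>L ell2) \<Rightarrow> bool"
  where "trace_class A \<longleftrightarrow> clinear_op A \<and> is_modulus A (modulus A) \<and>
    summable (\<lambda>n. Re (op_entry (modulus A) n n))"

definition trace_norm :: "(ell2 \<Rightarrow>\<^sub>L ell2) \<Rightarrow> real"
  where "trace_norm A = (\<Sum>n. Re (op_entry (modulus A) n n))"

definition op_trace :: "(ell2 \<Rightarrow>\<^sub>L ell2) \<Rightarrow> complex"
  where "op_trace A = (\<Sum>n. op_entry A n n)"


section \<open>Essentially bounded functions on the unit circle\<close>

text \<open>Only the values on the unit circle matter; it is parametrised by \<open>t \<mapsto> cis t\<close>,
  \<open>-\<pi> \<le> t \<le> \<pi>\<close>.\<close>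

abbreviation arc :: "real measure"
  where "arc \<equiv> lebesgue_on {-pi..pi}"

definition ess_bounded :: "(complex \<Rightarrow> complex) \<Rightarrow> bool"
  where "ess_bounded f \<longleftrightarrow> (\<lambda>t. f (cis t)) \<in> borel_measurable arc \<and>
    (\<exists>B. AE t in arc. cmod (f (cis t)) \<le> B)"

definition linf_rel :: "(complex \<Rightarrow> complex) \<Rightarrow> (complex \<Rightarrow> complex) \<Rightarrow> bool"
  where "linf_rel f g \<longleftrightarrow> ess_bounded f \<and> ess_bounded g \<and> (AE t in arc. f (cis t) = g (cis t))"

lemma ess_bounded_const: "ess_bounded (\<lambda>_. c)"
  unfolding ess_bounded_def by auto

lemma ess_bounded_add:
  assumes "ess_bounded f" "ess_bounded g"
  shows "ess_bounded (\<lambda>z. f z + g z)"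
proof -
  obtain B C where "AE t in arc. cmod (f (cis t)) \<le> B" "AE t in arc. cmod (g (cis t)) \<le> C"
    using assms unfolding ess_bounded_def by blast
  then have "AE t in arc. cmod (f (cis t) + g (cis t)) \<le> B + C"
    by eventually_elim (rule order_trans[OF norm_triangle_ineq add_mono])
  then show ?thesis
    using assms unfolding ess_bounded_def by (auto intro!: borel_measurable_add)
qed

lemma ess_bounded_mult:
  assumes "ess_bounded f" "ess_bounded g"
  shows "ess_bounded (\<lambda>z. f z * g z)"
proof -
  obtain B C where "AE t in arc. cmod (f (cis t)) \<le> B" "AE t in arc. cmod (g (cis t)) \<le> C"
    using assms unfolding ess_bounded_def by blast
  then have "AE t in arc. cmod (f (cis t) * g (cis t)) \<le> B * C"
  proof eventually_elim
    case (elim t)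
    have "0 \<le> B" using elim(1) norm_ge_zero order_trans by blast
    then show ?case using elim by (auto simp: norm_mult intro!: mult_mono)
  qed
  then show ?thesis
    using assms unfolding ess_bounded_def by (auto intro!: borel_measurable_times)
qed

lemma ess_bounded_uminus: "ess_bounded f \<Longrightarrow> ess_bounded (\<lambda>z. - f z)"
  by (auto simp: ess_bounded_def)

lemma ess_bounded_diff: "ess_bounded f \<Longrightarrow> ess_bounded g \<Longrightarrow> ess_bounded (\<lambda>z. f z - g z)"
  using ess_bounded_add[of f "\<lambda>z. - g z"] ess_bounded_uminus[of g] by simp

lemma ess_bounded_exp:
  assumes "ess_bounded f"
  shows "ess_bounded (\<lambda>z. exp (f z))"
proof -
  obtain B where "AE t in arc. cmod (f (cis t)) \<le> B"
    using assms unfolding ess_bounded_def by blast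
  then have "AE t in arc. cmod (exp (f (cis t))) \<le> exp B"
    by eventually_elim (rule order_trans[OF norm_exp], simp)
  moreover have "(\<lambda>t. exp (f (cis t))) \<in> borel_measurable arc"
    using assms borel_measurable_continuous_onI[of "exp :: complex \<Rightarrow> complex"]
    unfolding ess_bounded_def by (auto intro: measurable_compose)
  ultimately show ?thesis unfolding ess_bounded_def by blast
qed

lemma lebesgue_reflect: "distr lebesgue lebesgue uminus = (lebesgue :: real measure)"
  using lebesgue_real_affine[of "-1" 0] by (simp add: density_1)

lemma measurable_arc_reflect: "uminus \<in> measurable arc arc"
proof -
  have "uminus \<in> measurable lebesgue (lebesgue :: real measure)"
    using lebesgue_affine_measurable[where c = "\<lambda>_::real. -1" and t = 0] by simp
  then show ?thesis
    by (intro measurable_restrict_space3) auto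
qed

lemma AE_arc_reflect:
  assumes "AE t in arc. P t"
  shows "AE t in arc. P (- t)"
proof -
  have "AE t in lebesgue. t \<in> {-pi..pi} \<longrightarrow> P t"
    using assms by (subst (asm) AE_restrict_space_iff) auto
  then have "AE t in distr lebesgue lebesgue uminus. t \<in> {-pi..pi} \<longrightarrow> P t"
    by (simp only: lebesgue_reflect)
  moreover have "uminus \<in> measurable lebesgue (lebesgue :: real measure)"
    using lebesgue_affine_measurable[where c = "\<lambda>_::real. -1" and t = 0] by simp
  ultimately have "AE t in lebesgue. - t \<in> {-pi..pi} \<longrightarrow> P (- t)"
    by (rule AE_distrD[rotated])
  then have "AE t in lebesgue. t \<in> {-pi..pi} \<longrightarrow> P (- t)"
    by eventually_elim auto
  then show ?thesis by (subst AE_restrict_space_iff) auto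
qed

lemma ess_bounded_reflect:
  assumes "ess_bounded f"
  shows "ess_bounded (\<lambda>z. f (inverse z))"
proof -
  obtain B where "AE t in arc. cmod (f (cis t)) \<le> B"
    using assms unfolding ess_bounded_def by blast
  then have "AE t in arc. cmod (f (cis (- t))) \<le> B" by (rule AE_arc_reflect)
  moreover have "(\<lambda>t. f (cis (- t))) \<in> borel_measurable arc"
    using assms measurable_compose[OF measurable_arc_reflect] unfolding ess_bounded_def by blast
  ultimately show ?thesis unfolding ess_bounded_def cis_inverse by blast
qed

lemma not_AE_arc_False: "\<not> (AE t in arc. False)"
proof
  assume "AE t in arc. False"
  then have "{-pi..pi} \<in> null_sets arc"
    by (simp add: AE_iff_null_sets eventually_mono)
  then have "emeasure arc {-pi..pi} = 0" by (rule null_setsD1)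
  moreover have "emeasure arc {-pi..pi} = ennreal (2 * pi)"
    by (simp add: emeasure_restrict_space)
  ultimately show False by simp
qed

quotient_type linf = "complex \<Rightarrow> complex" / partial: linf_rel
proof (rule part_equivpI)
  show "\<exists>f. linf_rel f f" using ess_bounded_const unfolding linf_rel_def by auto
  show "symp linf_rel" unfolding linf_rel_def by (rule sympI) (simp add: eq_commute)
  show "transp linf_rel"
  proof (rule transpI)
    fix f g h assume a: "linf_rel f g" "linf_rel g h"
    then have "AE t in arc. f (cis t) = g (cis t)" "AE t in arc. g (cis t) = h (cis t)"
      unfolding linf_rel_def by auto
    then have "AE t in arc. f (cis t) = h (cis t)" by eventually_elim simp
    then show "linf_rel f h" using a unfolding linf_rel_def by auto
  qed
qed

instantiation linf :: comm_ring_1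
begin

lift_definition zero_linf :: linf is "\<lambda>_. 0"
  by (simp add: linf_rel_def ess_bounded_const)
lift_definition one_linf :: linf is "\<lambda>_. 1"
  by (simp add: linf_rel_def ess_bounded_const)
lift_definition plus_linf :: "linf \<Rightarrow> linf \<Rightarrow> linf" is "\<lambda>f g z. f z + g z"
  unfolding linf_rel_def by (auto intro!: ess_bounded_add)
lift_definition times_linf :: "linf \<Rightarrow> linf \<Rightarrow> linf" is "\<lambda>f g z. f z * g z"
  unfolding linf_rel_def by (auto intro!: ess_bounded_mult)
lift_definition uminus_linf :: "linf \<Rightarrow> linf" is "\<lambda>f z. - f z"
  unfolding linf_rel_def by (auto intro!: ess_bounded_uminus)
lift_definition minus_linf :: "linf \<Rightarrow> linf \<Rightarrow> linf" is "\<lambda>f g z. f z - g z"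
  unfolding linf_rel_def by (auto intro!: ess_bounded_diff)

instance
proof
  fix a b c :: linf
  show "(0 :: linf) \<noteq> 1"
    by transfer (simp add: linf_rel_def not_AE_arc_False)
  show "a + b + c = a + (b + c)"
    by transfer (simp add: linf_rel_def ess_bounded_add add.assoc)
  show "a + b = b + a"
    by transfer (simp add: linf_rel_def ess_bounded_add add.commute)
  show "0 + a = a" by transfer (simp add: linf_rel_def)
  show "- a + a = 0"
    by transfer (simp add: linf_rel_def ess_bounded_const)
  show "a - b = a + - b"
    by transfer (simp add: linf_rel_def ess_bounded_diff)
  show "a * b * c = a * (b * c)"
    by transfer (simp add: linf_rel_def ess_bounded_mult mult.assoc)
  show "a * b = b * a"
    by transfer (simp add: linf_rel_def ess_bounded_mult mult.commute)
  show "1 * a = a" by transfer (simp add: linf_rel_def)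
  show "(a + b) * c = a * c + b * c"
    by transfer (simp add: linf_rel_def ess_bounded_add ess_bounded_mult distrib_right)
qed

end

text \<open>Scalar multiplication by \<open>c\<close> is multiplication by the constant function \<open>c\<close>.\<close>

lift_definition linf_const :: "complex \<Rightarrow> linf" is "\<lambda>c _. c"
  by (simp add: linf_rel_def ess_bounded_const)

lift_definition linf_exp :: "linf \<Rightarrow> linf" is "\<lambda>f z. exp (f z)"
proof -
  fix f g assume fg: "linf_rel f g"
  then have "AE t in arc. f (cis t) = g (cis t)" unfolding linf_rel_def by simp
  then have "AE t in arc. exp (f (cis t)) = exp (g (cis t))" by eventually_elim simp
  then show "linf_rel (\<lambda>z. exp (f z)) (\<lambda>z. exp (g z))"
    using fg unfolding linf_rel_def by (simp add: ess_bounded_exp)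
qed

lift_definition linf_tilde :: "linf \<Rightarrow> linf" is "\<lambda>f z. f (inverse z)"
proof -
  fix f g assume fg: "linf_rel f g"
  then have "AE t in arc. f (cis (- t)) = g (cis (- t))"
    unfolding linf_rel_def by (intro AE_arc_reflect) auto
  then show "linf_rel (\<lambda>z. f (inverse z)) (\<lambda>z. g (inverse z))"
    using fg unfolding linf_rel_def cis_inverse by (simp add: ess_bounded_reflect)
qed

lift_definition linf_norm :: "linf \<Rightarrow> real"
  is "\<lambda>f. Inf {B. AE t in arc. cmod (f (cis t)) \<le> B}"
proof -
  fix f g assume "linf_rel f g"
  then have "AE t in arc. f (cis t) = g (cis t)" unfolding linf_rel_def by simp
  then have "AE t in arc. cmod (f (cis t)) \<le> B \<longleftrightarrow> cmod (g (cis t)) \<le> B" for B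
    by eventually_elim simp
  then have "(AE t in arc. cmod (f (cis t)) \<le> B) \<longleftrightarrow> (AE t in arc. cmod (g (cis t)) \<le> B)" for B
    by (rule eventually_cong)
  then show "Inf {B. AE t in arc. cmod (f (cis t)) \<le> B} = Inf {B. AE t in arc. cmod (g (cis t)) \<le> B}"
    by simp
qed

lift_definition fourier :: "linf \<Rightarrow> int \<Rightarrow> complex"
  is "\<lambda>f (n::int). 1 / (2 * pi) * integral\<^sup>L arc (\<lambda>t. f (cis t) * cis (- (n * t)))"
proof -
  fix f g :: "complex \<Rightarrow> complex"
  assume fg: "linf_rel f g"
  have "integral\<^sup>L arc (\<lambda>t. f (cis t) * cis (- (n * t)))
      = integral\<^sup>L arc (\<lambda>t. g (cis t) * cis (- (n * t)))" for n :: int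
  proof -
    have "(\<lambda>t. cis (- (n * t))) \<in> borel_measurable arc"
      by (intro continuous_imp_measurable_on_sets_lebesgue continuous_intros) simp
    then show ?thesis
      using fg unfolding linf_rel_def ess_bounded_def
      by (intro integral_cong_AE borel_measurable_times) auto
  qed
  then show "(\<lambda>n::int. 1 / (2 * pi) * integral\<^sup>L arc (\<lambda>t. f (cis t) * cis (- (n * t))))
      = (\<lambda>n::int. 1 / (2 * pi) * integral\<^sup>L arc (\<lambda>t. g (cis t) * cis (- (n * t))))"
    by simp
qed

definition toeplitz :: "linf \<Rightarrow> (ell2 \<Rightarrow>\<^sub>L ell2)"
  where "toeplitz a = op_of_matrix (\<lambda>j k. fourier a (int j - int k))"

definition hankel :: "linf \<Rightarrow> (ell2 \<Rightarrow>\<^sub>L ell2)"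
  where "hankel a = op_of_matrix (\<lambda>j k. fourier a (int j + int k + 1))"


section \<open>Compatible pairs\<close>

text \<open>A unital Banach algebra \<open>S\<close> of functions on the circle with norm \<open>nrm\<close>, continuously embedded
  in \<open>L\<^sup>\<infinity>\<close>, on which the Riesz projection and the reflection are bounded.
  The unit is not required to have norm 1.\<close>

locale circle_algebra =
  fixes S :: "linf set" and nrm :: "linf \<Rightarrow> real"
  assumes one_mem: "1 \<in> S"
    and add_mem: "\<lbrakk>a \<in> S; b \<in> S\<rbrakk> \<Longrightarrow> a + b \<in> S"
    and mult_mem: "\<lbrakk>a \<in> S; b \<in> S\<rbrakk> \<Longrightarrow> a * b \<in> S"
    and scale_mem: "a \<in> S \<Longrightarrow> linf_const z * a \<in> S"
    and nrm_nonneg: "a \<in> S \<Longrightarrow> 0 \<le> nrm a"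
    and nrm_eq_0: "a \<in> S \<Longrightarrow> nrm a = 0 \<longleftrightarrow> a = 0"
    and nrm_add: "\<lbrakk>a \<in> S; b \<in> S\<rbrakk> \<Longrightarrow> nrm (a + b) \<le> nrm a + nrm b"
    and nrm_scale: "a \<in> S \<Longrightarrow> nrm (linf_const z * a) = cmod z * nrm a"
    and nrm_mult: "\<lbrakk>a \<in> S; b \<in> S\<rbrakk> \<Longrightarrow> nrm (a * b) \<le> nrm a * nrm b"
    and complete: "\<lbrakk>\<And>n. X n \<in> S;
        \<forall>e>0. \<exists>N. \<forall>m\<ge>N. \<forall>n\<ge>N. nrm (X m - X n) < e\<rbrakk>
      \<Longrightarrow> \<exists>a\<in>S. (\<lambda>n. nrm (X n - a)) \<longlonglongrightarrow> 0"
    and embedding: "\<exists>K. \<forall>a\<in>S. linf_norm a \<le> K * nrm a"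
    and riesz: "\<exists>K. \<forall>a\<in>S. \<exists>p\<in>S.
      (\<forall>n. fourier p n = (if n \<ge> 0 then fourier a n else 0)) \<and> nrm p \<le> K * nrm a"
    and reflection: "\<exists>K. \<forall>a\<in>S. linf_tilde a \<in> S \<and> nrm (linf_tilde a) \<le> K * nrm a"

locale compatible_pair = circle_algebra S nrm
  for S :: "linf set" and nrm :: "linf \<Rightarrow> real" +
  fixes M :: "linf \<Rightarrow> (ell2 \<Rightarrow>\<^sub>L ell2)"
  assumes M_clinear_op: "a \<in> S \<Longrightarrow> clinear_op (M a)"
    and M_add: "\<lbrakk>a \<in> S; b \<in> S\<rbrakk> \<Longrightarrow> M (a + b) = M a + M b"
    and M_scale: "a \<in> S \<Longrightarrow> M (linf_const z * a) x = ell2_scaleC z (M a x)"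
    and M_bounded: "\<exists>K. \<forall>a\<in>S. norm (M a) \<le> K * nrm a"
    and M_trace_class: "\<exists>C. \<forall>a\<in>S. trace_class (M a - toeplitz a) \<and>
      trace_norm (M a - toeplitz a) \<le> C * nrm a"
    and M_mult: "\<lbrakk>a \<in> S; \<forall>n>0. fourier a n = 0; b \<in> S; c \<in> S; linf_tilde c = c\<rbrakk>
      \<Longrightarrow> M (a * b * c) = toeplitz a o\<^sub>L M b o\<^sub>L M c"
    and M_one: "M 1 = id_blinfun"

text \<open>The geometric mean of \<open>exp b\<close>, formed with the logarithm \<open>b\<close>; the zeroth Fourier coefficient
  is the mean value of \<open>b\<close> over the circle.\<close>

definition G_const :: "linf \<Rightarrow> complex"
  where "G_const b = exp (fourier b 0)"

definition E_hat :: "(linf \<Rightarrow> (ell2 \<Rightarrow>\<^sub>L ell2)) \<Rightarrow> linf \<Rightarrow> complex"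
  where "E_hat M b = exp (op_trace (M b - toeplitz b) - 1 / 2 * op_trace (hankel b o\<^sub>L hankel b)
    + op_trace (hankel b o\<^sub>L hankel (linf_tilde b)))"

end

(*
  Let p be the part of b with positive Fourier indices, c = p + ~p its even extension, and d = b - c,
  f = b - p, which have no positive Fourier coefficients.  With A = T(p), D = T(d), F = T(f),
  E = M(c) and K = M(b) - T(b), multiplicativity of M gives M(exp b) = exp D exp E, where
  E = K + A + F - D.  Since exp A and exp F are triangular,
    det P_N M(exp b) P_N = G[exp b]^N det P_N B(1) P_N,
    B(t) = exp(-tA) exp(tD) exp(tE) exp(-tF).
  The operators K, [D,A] = H(b) H(~b) - H(b)^2 and [A,F] = - H(b) H(~b) are nuclear and [D,F] = 0, so
  B(t)^{-1} B'(t) is nuclear with trace  tr K + t (tr [D,A] - tr [A,F]).  For large N the logarithmic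
  derivative of det P_N B(t) P_N is uniformly close to this trace; integrating over [0,1] gives the
  constant.
*)
theory Submission
  imports Defs
begin

section \<open>Bounded complex-linear operators on the sequence space\<close>

text \<open>\<open>M\<close> is multiplicative only against a left factor from S_- and an even right
  factor. This dictates b = d + c with c even: exp d is peeled off from the left and exp c from the
  right. In det P_N (exp A) B (exp F) P_N the lower triangular factor stands on the left and the
  upper triangular one on the right; in that order finite sections multiply. A, D, E, F are merely
  bounded, so their commutators may have nonzero trace, whereas [F,K] has trace zero because K is
  nuclear. With P1 = H(b)^2 and P2 = H(b)H(~b) the slope of the trace in t is (tr P2 - tr P1) + tr
  P2. Integrating t over [0,1] halves it, which is the origin of the factors -1/2 and 1 in the
  constant. The estimates must be uniform in t. Trace class is therefore rephrased as nuclear, that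
  is, as an absolutely convergent sum of rank one operators: the projective norm gives a Banach
  space with continuous trace, in which paths can be integrated and the tails (1 - P_N) Z vanish
  uniformly along continuous paths.\<close>

lemma ell2_summable_sq: "summable (\<lambda>n. (cmod (ell2_nth x n))\<^sup>2)"
  using ell2_nth[of x] by simp

lemma ell2_eqI: "(\<And>n. ell2_nth x n = ell2_nth y n) \<Longrightarrow> x = y"
  using ell2_nth_inject[of x y] by (auto simp: fun_eq_iff)

lemmas ell2_nth_simps [simp] = zero_ell2.rep_eq plus_ell2.rep_eq minus_ell2.rep_eq
  uminus_ell2.rep_eq scaleR_ell2.rep_eq ell2_scaleC.rep_eq ell2_unit.rep_eq

lemma ell2_norm_sq: "(norm x)\<^sup>2 = (\<Sum>n. (cmod (ell2_nth x n))\<^sup>2)"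
proof -
  have "(norm x)\<^sup>2 = inner x x" by (simp add: power2_norm_eq_inner)
  also have "\<dots> = (\<Sum>n. inner (ell2_nth x n) (ell2_nth x n))" by (simp add: inner_ell2.rep_eq)
  finally show ?thesis by (simp add: power2_norm_eq_inner)
qed

lemma ell2_sum_le_norm_sq: "finite A \<Longrightarrow> (\<Sum>n\<in>A. (cmod (ell2_nth x n))\<^sup>2) \<le> (norm x)\<^sup>2"
  unfolding ell2_norm_sq by (rule sum_le_suminf[OF ell2_summable_sq]) auto

lemma ell2_nth_le_norm: "cmod (ell2_nth x n) \<le> norm x"
  using ell2_sum_le_norm_sq[of "{n}" x] by (simp add: power2_le_iff_abs_le)

lemma ell2_norm_le:
  assumes "0 \<le> C" "\<And>N. (\<Sum>n<N. (cmod (ell2_nth x n))\<^sup>2) \<le> C\<^sup>2"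
  shows "norm x \<le> C"
proof -
  have "(norm x)\<^sup>2 \<le> C\<^sup>2" unfolding ell2_norm_sq
    by (rule suminf_le_const[OF ell2_summable_sq]) (use assms in auto)
  then show ?thesis using assms(1) by (simp add: power2_le_iff_abs_le)
qed

text \<open>A bound on all partial sums gives membership and the norm estimate together; vectors
  that are defined coordinate by coordinate enter the space this way.\<close>

lemma ell2_exists:
  assumes "0 \<le> C" "\<And>N. (\<Sum>n<N. (cmod (f n))\<^sup>2) \<le> C\<^sup>2"
  obtains x where "ell2_nth x = f" "norm x \<le> C"
proof -
  have "summable (\<lambda>n. (cmod (f n))\<^sup>2)"
    by (rule summableI_nonneg_bounded[of _ "C\<^sup>2"]) (use assms in auto)
  then have *: "ell2_nth (Abs_ell2 f) = f" by (simp add: Abs_ell2_inverse)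
  then have "norm (Abs_ell2 f) \<le> C" by (intro ell2_norm_le) (use assms in auto)
  with * that show thesis by blast
qed

instance ell2 :: banach
proof
  fix X :: "nat \<Rightarrow> ell2"
  assume X: "Cauchy X"
  have "\<exists>l. (\<lambda>m. ell2_nth (X m) n) \<longlonglongrightarrow> l" for n
  proof -
    have "Cauchy (\<lambda>m. ell2_nth (X m) n)"
    proof (rule metric_CauchyI)
      fix e :: real assume "e > 0"
      then obtain M where M: "\<And>i j. i \<ge> M \<Longrightarrow> j \<ge> M \<Longrightarrow> dist (X i) (X j) < e"
        using X unfolding Cauchy_def by blast
      have "dist (ell2_nth (X i) n) (ell2_nth (X j) n) < e" if "i \<ge> M" "j \<ge> M" for i j
        using M[OF that] ell2_nth_le_norm[of "X i - X j" n] by (simp add: dist_norm)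
      then show "\<exists>M. \<forall>i\<ge>M. \<forall>j\<ge>M. dist (ell2_nth (X i) n) (ell2_nth (X j) n) < e" by blast
    qed
    then show ?thesis using Cauchy_convergent convergent_def by blast
  qed
  then obtain f where f: "\<And>n. (\<lambda>m. ell2_nth (X m) n) \<longlonglongrightarrow> f n" by metis
  have tail: "\<exists>M. \<forall>i\<ge>M. \<exists>y. ell2_nth y = (\<lambda>n. ell2_nth (X i) n - f n) \<and> norm y \<le> e"
    if "e > 0" for e
  proof -
    obtain M where M: "\<And>i j. i \<ge> M \<Longrightarrow> j \<ge> M \<Longrightarrow> dist (X i) (X j) < e"
      using X \<open>e > 0\<close> unfolding Cauchy_def by blast
    have "\<exists>y. ell2_nth y = (\<lambda>n. ell2_nth (X i) n - f n) \<and> norm y \<le> e" if i: "i \<ge> M" for i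
    proof -
      \<comment> \<open>Each finite partial sum obeys the Cauchy bound for all large
        \<open>j\<close>, and a finite sum passes to the limit in \<open>j\<close>; the bound
        obtained is uniform in \<open>N\<close>.\<close>
      have "(\<Sum>n<N. (cmod (ell2_nth (X i) n - f n))\<^sup>2) \<le> e\<^sup>2" for N
      proof (rule LIMSEQ_le_const2)
        show "(\<lambda>j. \<Sum>n<N. (cmod (ell2_nth (X i) n - ell2_nth (X j) n))\<^sup>2)
            \<longlonglongrightarrow> (\<Sum>n<N. (cmod (ell2_nth (X i) n - f n))\<^sup>2)"
          by (intro tendsto_intros f)
        have "(\<Sum>n<N. (cmod (ell2_nth (X i) n - ell2_nth (X j) n))\<^sup>2) \<le> e\<^sup>2" if "j \<ge> M" for j
        proof -
          have "(\<Sum>n<N. (cmod (ell2_nth (X i) n - ell2_nth (X j) n))\<^sup>2) \<le> (norm (X i - X j))\<^sup>2"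
            using ell2_sum_le_norm_sq[of "{..<N}" "X i - X j"] by simp
          also have "\<dots> \<le> e\<^sup>2"
            using M[OF i that] by (intro power_mono) (auto simp: dist_norm)
          finally show ?thesis .
        qed
        then show "\<exists>M. \<forall>j\<ge>M. (\<Sum>n<N. (cmod (ell2_nth (X i) n - ell2_nth (X j) n))\<^sup>2) \<le> e\<^sup>2"
          by blast
      qed
      then show ?thesis using ell2_exists[of e "\<lambda>n. ell2_nth (X i) n - f n"] \<open>e > 0\<close>
        by (metis less_imp_le)
    qed
    then show ?thesis by blast
  qed
  \<comment> \<open>One instance of \<open>tail\<close> already shows that \<open>f\<close> is
    square-summable, being \<open>X i\<close> minus a member of the space.\<close>
  obtain i y where y: "ell2_nth y = (\<lambda>n. ell2_nth (X i) n - f n)"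
    using tail[of 1] by auto
  define x where "x = X i - y"
  have x: "ell2_nth x = f" by (auto simp: x_def y)
  have "X \<longlonglongrightarrow> x"
  proof (rule LIMSEQ_I)
    fix e :: real assume "e > 0"
    then obtain M where M: "\<forall>i\<ge>M. \<exists>y. ell2_nth y = (\<lambda>n. ell2_nth (X i) n - f n) \<and> norm y \<le> e / 2"
      using tail[of "e/2"] by auto
    have "norm (X i - x) < e" if i: "i \<ge> M" for i
    proof -
      obtain y where "ell2_nth y = (\<lambda>n. ell2_nth (X i) n - f n)" "norm y \<le> e / 2"
        using M[rule_format, OF i] by auto
      moreover from this have "y = X i - x" by (intro ell2_eqI) (simp add: x)
      ultimately show ?thesis using \<open>e > 0\<close> by simp
    qed
    then show "\<exists>M. \<forall>i\<ge>M. norm (X i - x) < e" by blast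
  qed
  then show "convergent X" by (auto simp: convergent_def)
qed

lemma ell2_scaleC_add_right: "ell2_scaleC c (x + y) = ell2_scaleC c x + ell2_scaleC c y"
  by (rule ell2_eqI) (simp add: algebra_simps)

lemma ell2_scaleC_diff_right: "ell2_scaleC c (x - y) = ell2_scaleC c x - ell2_scaleC c y"
  by (rule ell2_eqI) (simp add: algebra_simps)

lemma ell2_scaleC_add_left: "ell2_scaleC (c + d) x = ell2_scaleC c x + ell2_scaleC d x"
  by (rule ell2_eqI) (simp add: algebra_simps)

lemma ell2_scaleC_assoc: "ell2_scaleC c (ell2_scaleC d x) = ell2_scaleC (c * d) x"
  by (rule ell2_eqI) (simp add: algebra_simps)

lemma ell2_scaleC_scaleR: "ell2_scaleC c (r *\<^sub>R x) = r *\<^sub>R ell2_scaleC c x"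
  by (rule ell2_eqI) (simp add: algebra_simps)

lemma ell2_scaleC_of_real: "ell2_scaleC (of_real r) x = r *\<^sub>R x"
  by (rule ell2_eqI) simp

lemma ell2_scaleC_zero [simp]: "ell2_scaleC 0 x = 0" "ell2_scaleC c 0 = 0"
  by (rule ell2_eqI, simp)+

lemma ell2_scaleC_one [simp]: "ell2_scaleC 1 x = x"
  by (rule ell2_eqI) simp

lemma ell2_norm_scaleC: "norm (ell2_scaleC c x) = cmod c * norm x"
proof -
  have "(norm (ell2_scaleC c x))\<^sup>2 = (cmod c * norm x)\<^sup>2"
    by (simp add: ell2_norm_sq norm_mult power_mult_distrib suminf_mult[OF ell2_summable_sq])
  then show ?thesis by (simp add: power2_eq_iff_nonneg)
qed

lemma bounded_bilinear_ell2_scaleC: "bounded_bilinear ell2_scaleC"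
proof
  show "ell2_scaleC (r *\<^sub>R a) b = r *\<^sub>R ell2_scaleC a b" for r a b
    by (rule ell2_eqI) (simp add: scaleR_conv_of_real)
  show "\<exists>K. \<forall>a b. norm (ell2_scaleC a b) \<le> norm a * norm b * K"
    by (intro exI[of _ 1]) (simp add: ell2_norm_scaleC)
qed (simp_all add: ell2_scaleC_add_left ell2_scaleC_add_right ell2_scaleC_scaleR)

lemma sum_unit_eq: "finite A \<Longrightarrow> (\<Sum>a\<in>A. f a * (if k = a then 1 else 0)) = (if k \<in> A then f k else (0::complex))"
proof -
  assume "finite A"
  then have "(\<Sum>a\<in>A. if a = k then f a else 0) = (if k \<in> A then f k else 0)"
    by (simp add: sum.delta)
  moreover have "(\<Sum>a\<in>A. f a * (if k = a then 1 else 0)) = (\<Sum>a\<in>A. if a = k then f a else 0)"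
    by (rule sum.cong) auto
  ultimately show ?thesis by simp
qed

lemma bounded_linear_ell2_nth: "bounded_linear (\<lambda>x. ell2_nth x n)"
  by (rule bounded_linear_intro[of _ 1])
     (auto simp: ell2_nth_le_norm scaleR_conv_of_real)

lemma cinner_summable: "summable (\<lambda>n. ell2_nth x n * cnj (ell2_nth y n))"
  by (rule summable_norm_cancel)
     (simp add: norm_mult ell2_summable_prod ell2_summable_sq)

lemma cinner_unit: "cinner x (ell2_unit n) = ell2_nth x n"
proof -
  have "(\<lambda>k. ell2_nth x k * cnj (ell2_nth (ell2_unit n) k)) = (\<lambda>k. if k = n then ell2_nth x k else 0)"
    by auto
  then show ?thesis unfolding cinner_def by (simp add: sums_single[THEN sums_unique, symmetric])
qed

lemma op_entry_nth: "op_entry A j k = ell2_nth (A (ell2_unit k)) j"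
  by (simp add: op_entry_def cinner_unit)

lemma ell2_norm_unit [simp]: "norm (ell2_unit k) = 1"
proof -
  have "(\<lambda>n. (cmod (ell2_nth (ell2_unit k) n))\<^sup>2) = (\<lambda>n. if n = k then 1 else 0)" by auto
  then have "(norm (ell2_unit k))\<^sup>2 = 1"
    by (simp add: ell2_norm_sq sums_single[THEN sums_unique, symmetric])
  then show ?thesis using norm_ge_zero[of "ell2_unit k"] by (auto simp: power2_eq_1_iff)
qed

text \<open>By Pythagoras the squared error of the \<open>N\<close>-th partial sum is the squared
  norm minus the first \<open>N\<close> squared moduli, i.e. the tail of a convergent
  series.\<close>

lemma ell2_unit_expansion:
  "(\<lambda>n. ell2_scaleC (ell2_nth x n) (ell2_unit n)) sums x"
proof -
  let ?s = "\<lambda>N. \<Sum>n<N. ell2_scaleC (ell2_nth x n) (ell2_unit n)"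
  have nth_sum: "ell2_nth (sum f A) k = (\<Sum>a\<in>A. ell2_nth (f a) k)"
    for f :: "nat \<Rightarrow> ell2" and A k
    by (rule linear_sum[OF bounded_linear.linear[OF bounded_linear_ell2_nth]])
  have s: "ell2_nth (?s N) k = (if k < N then ell2_nth x k else 0)" for N k
    by (simp add: nth_sum sum_unit_eq)
  have *: "(norm (x - ?s N))\<^sup>2 = (norm x)\<^sup>2 - (\<Sum>n<N. (cmod (ell2_nth x n))\<^sup>2)" for N
  proof -
    have "(norm (x - ?s N))\<^sup>2 = (\<Sum>n. (cmod (ell2_nth (x - ?s N) (n + N)))\<^sup>2)
        + (\<Sum>n<N. (cmod (ell2_nth (x - ?s N) n))\<^sup>2)"
      unfolding ell2_norm_sq by (rule suminf_split_initial_segment[OF ell2_summable_sq])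
    also have "(\<Sum>n<N. (cmod (ell2_nth (x - ?s N) n))\<^sup>2) = 0" by (simp add: s)
    also have "(\<lambda>n. (cmod (ell2_nth (x - ?s N) (n + N)))\<^sup>2) = (\<lambda>n. (cmod (ell2_nth x (n + N)))\<^sup>2)"
      by (simp add: s)
    finally show ?thesis
      unfolding ell2_norm_sq using suminf_split_initial_segment[OF ell2_summable_sq, of x N] by simp
  qed
  have "(\<lambda>N. (norm (x - ?s N))\<^sup>2) \<longlonglongrightarrow> 0"
  proof -
    have "(\<lambda>N. (norm x)\<^sup>2 - (\<Sum>n<N. (cmod (ell2_nth x n))\<^sup>2)) \<longlonglongrightarrow> (norm x)\<^sup>2 - (norm x)\<^sup>2"
      unfolding ell2_norm_sq by (intro tendsto_intros summable_LIMSEQ ell2_summable_sq)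
    then show ?thesis by (simp add: *)
  qed
  then have "(\<lambda>N. sqrt ((norm (x - ?s N))\<^sup>2)) \<longlonglongrightarrow> sqrt 0"
    by (rule tendsto_real_sqrt)
  then have "(\<lambda>N. x - ?s N) \<longlonglongrightarrow> 0"
    by - (rule tendsto_norm_zero_cancel, simp)
  then have "(\<lambda>N. x - (x - ?s N)) \<longlonglongrightarrow> x - 0"
    by (rule tendsto_diff[OF tendsto_const])
  then show ?thesis unfolding sums_def by simp
qed

text \<open>A type of its own turns the complex-linear operators into a unital Banach algebra under
  composition, so that \<open>exp\<close> of operators and the calculus of vector-valued functions
  apply to them.\<close>

typedef cop = "{A :: ell2 \<Rightarrow>\<^sub>L ell2. clinear_op A}"
  morphisms rop Abs_cop
  by (rule exI[of _ 0]) (simp add: clinear_op_def)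

setup_lifting type_definition_cop

lemma rop_scaleC: "rop A (ell2_scaleC c x) = ell2_scaleC c (rop A x)"
  using rop[of A] by (simp add: clinear_op_def)

instantiation cop :: real_normed_vector
begin
lift_definition zero_cop :: cop is 0 by (simp add: clinear_op_def)
lift_definition plus_cop :: "cop \<Rightarrow> cop \<Rightarrow> cop" is "(+)"
  by (simp add: clinear_op_def blinfun.add_left ell2_scaleC_add_right)
lift_definition minus_cop :: "cop \<Rightarrow> cop \<Rightarrow> cop" is "(-)"
  by (simp add: clinear_op_def blinfun.diff_left ell2_scaleC_diff_right)
lift_definition uminus_cop :: "cop \<Rightarrow> cop" is "uminus"
  by (simp add: clinear_op_def blinfun.minus_left) (auto intro!: ell2_eqI)
lift_definition scaleR_cop :: "real \<Rightarrow> cop \<Rightarrow> cop" is scaleR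
  by (simp add: clinear_op_def blinfun.scaleR_left ell2_scaleC_scaleR)
lift_definition norm_cop :: "cop \<Rightarrow> real" is norm .
definition sgn_cop :: "cop \<Rightarrow> cop" where "sgn_cop x = scaleR (inverse (norm x)) x"
definition dist_cop :: "cop \<Rightarrow> cop \<Rightarrow> real" where "dist_cop x y = norm (x - y)"
definition uniformity_cop :: "(cop \<times> cop) filter"
  where "uniformity_cop = (INF e\<in>{0<..}. principal {(x, y). dist x y < e})"
definition open_cop :: "cop set \<Rightarrow> bool"
  where "open_cop U \<longleftrightarrow> (\<forall>x\<in>U. eventually (\<lambda>(x', y). x' = x \<longrightarrow> y \<in> U) uniformity)"
instance
proof
  fix x y z :: cop and r s :: real
  show "x + y + z = x + (y + z)" by transfer (rule add.assoc)
  show "x + y = y + x" by transfer (rule add.commute)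
  show "0 + x = x" by transfer simp
  show "- x + x = 0" by transfer simp
  show "x - y = x + - y" by transfer simp
  show "r *\<^sub>R (x + y) = r *\<^sub>R x + r *\<^sub>R y" by transfer (rule scaleR_add_right)
  show "(r + s) *\<^sub>R x = r *\<^sub>R x + s *\<^sub>R x" by transfer (rule scaleR_add_left)
  show "r *\<^sub>R s *\<^sub>R x = (r * s) *\<^sub>R x" by transfer simp
  show "1 *\<^sub>R x = x" by transfer simp
  show "norm x = 0 \<longleftrightarrow> x = 0" by transfer simp
  show "norm (x + y) \<le> norm x + norm y" by transfer (rule norm_triangle_ineq)
  show "norm (r *\<^sub>R x) = \<bar>r\<bar> * norm x" by transfer simp
qed (simp_all add: sgn_cop_def dist_cop_def uniformity_cop_def open_cop_def)
end

lemma cop_eqI: "(\<And>x. rop A x = rop B x) \<Longrightarrow> A = B"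
  using rop_inject[of A B] by (auto intro: blinfun_eqI)

instantiation cop :: real_normed_algebra_1
begin
lift_definition one_cop :: cop is id_blinfun by (simp add: clinear_op_def)
lift_definition times_cop :: "cop \<Rightarrow> cop \<Rightarrow> cop" is "(o\<^sub>L)" by (simp add: clinear_op_def)
instance
proof
  fix A B C :: cop and r :: real
  show "A * B * C = A * (B * C)" by transfer (auto intro: blinfun_eqI)
  show "(A + B) * C = A * C + B * C" by transfer (auto intro: blinfun_eqI simp: blinfun.add_left)
  show "A * (B + C) = A * B + A * C" by transfer (auto intro: blinfun_eqI simp: blinfun.add_left blinfun.add_right)
  show "r *\<^sub>R A * B = r *\<^sub>R (A * B)" by transfer (auto intro: blinfun_eqI simp: blinfun.scaleR_left)
  show "A * r *\<^sub>R B = r *\<^sub>R (A * B)" by transfer (auto intro: blinfun_eqI simp: blinfun.scaleR_left blinfun.scaleR_right)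
  show "1 * A = A" "A * 1 = A" by (transfer; auto intro: blinfun_eqI)+
  show "norm (A * B) \<le> norm A * norm B" by transfer (rule norm_blinfun_compose)
  have nz: "ell2_unit 0 \<noteq> 0" using ell2_norm_unit[of 0] by (metis norm_zero zero_neq_one)
  show "norm (1 :: cop) = 1"
  proof (transfer, rule antisym)
    show "norm (id_blinfun :: ell2 \<Rightarrow>\<^sub>L ell2) \<le> 1" by (rule norm_blinfun_bound) auto
    show "1 \<le> norm (id_blinfun :: ell2 \<Rightarrow>\<^sub>L ell2)"
      using norm_blinfun[of "id_blinfun :: ell2 \<Rightarrow>\<^sub>L ell2" "ell2_unit 0"] by simp
  qed
  show "(0 :: cop) \<noteq> 1"
  proof
    assume "(0 :: cop) = 1"
    then have "rop 0 (ell2_unit 0) = rop 1 (ell2_unit 0)" by simp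
    then show False using nz by (simp add: zero_cop.rep_eq one_cop.rep_eq)
  qed
qed
end

instance cop :: banach
proof
  fix X :: "nat \<Rightarrow> cop"
  assume X: "Cauchy X"
  have "Cauchy (\<lambda>n. rop (X n))"
    using X unfolding Cauchy_def dist_norm by (simp add: norm_cop.rep_eq minus_cop.rep_eq)
  then obtain L where L: "(\<lambda>n. rop (X n)) \<longlonglongrightarrow> L" using Cauchy_convergent convergent_def by blast
  have "clinear_op L" unfolding clinear_op_def
  proof (intro allI)
    fix c x
    have *: "(\<lambda>n. rop (X n) y) \<longlonglongrightarrow> L y" for y
      by (rule bounded_linear.tendsto[OF blinfun.bounded_linear_left L])
    have "(\<lambda>n. ell2_scaleC c (rop (X n) x)) \<longlonglongrightarrow> ell2_scaleC c (L x)"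
      by (rule bounded_linear.tendsto[OF bounded_bilinear.bounded_linear_right[OF bounded_bilinear_ell2_scaleC] *])
    then show "L (ell2_scaleC c x) = ell2_scaleC c (L x)"
      using *[of "ell2_scaleC c x"] by (simp add: rop_scaleC LIMSEQ_unique)
  qed
  then have "rop (Abs_cop L) = L" by (simp add: Abs_cop_inverse)
  then have "X \<longlonglongrightarrow> Abs_cop L"
    using L unfolding LIMSEQ_iff by (simp add: norm_cop.rep_eq minus_cop.rep_eq)
  then show "convergent X" by (auto simp: convergent_def)
qed

lemmas rop_simps [simp] = zero_cop.rep_eq one_cop.rep_eq plus_cop.rep_eq minus_cop.rep_eq
  uminus_cop.rep_eq scaleR_cop.rep_eq times_cop.rep_eq
  blinfun.add_left blinfun.diff_left blinfun.minus_left blinfun.scaleR_left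

lemma rop_bound: "norm (rop A x) \<le> norm A * norm x"
  by (simp add: norm_cop.rep_eq norm_blinfun)

lemma bounded_linear_rop_apply: "bounded_linear (\<lambda>A. rop A x)"
  by (rule bounded_linear_intro[of _ "norm x"]) (simp_all add: rop_bound)

lemma bounded_linear_rop_right: "bounded_linear (\<lambda>x. rop A x)"
  by (rule blinfun.bounded_linear_right)

section \<open>Matrix entries of operators\<close>

definition ent :: "cop \<Rightarrow> nat \<Rightarrow> nat \<Rightarrow> complex"
  where "ent A j k = ell2_nth (rop A (ell2_unit k)) j"

lemma op_entry_rop: "op_entry (rop A) j k = ent A j k"
  by (simp add: op_entry_nth ent_def)

lemma bounded_linear_ent: "bounded_linear (\<lambda>A. ent A j k)"
  unfolding ent_def by (rule bounded_linear_compose[OF bounded_linear_ell2_nth bounded_linear_rop_apply])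

lemma ent_simps [simp]:
  "ent 0 j k = 0" "ent (A + B) j k = ent A j k + ent B j k" "ent (A - B) j k = ent A j k - ent B j k"
  "ent (- A) j k = - ent A j k" "ent (r *\<^sub>R A) j k = of_real r * ent A j k"
  "ent 1 j k = (if j = k then 1 else 0)"
  by (simp_all add: ent_def)

text \<open>The operator acts termwise on the expansion in unit vectors. Hence operator identities
  can be checked on entries, and entries of products are convergent series.\<close>

lemma rop_nth_sums: "(\<lambda>l. ent A j l * ell2_nth x l) sums ell2_nth (rop A x) j"
proof -
  have "(\<lambda>l. ell2_nth (rop A (ell2_scaleC (ell2_nth x l) (ell2_unit l))) j) sums ell2_nth (rop A x) j"
    by (rule bounded_linear.sums[OF bounded_linear_compose[OF bounded_linear_ell2_nth bounded_linear_rop_right]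
        ell2_unit_expansion])
  then show ?thesis by (simp add: rop_scaleC ent_def mult.commute)
qed

lemma ent_mult_sums: "(\<lambda>l. ent A j l * ent B l k) sums ent (A * B) j k"
  using rop_nth_sums[of A j "rop B (ell2_unit k)"] by (simp add: ent_def)

lemma ent_eqI: "(\<And>j k. ent A j k = ent B j k) \<Longrightarrow> A = B"
proof (rule cop_eqI, rule ell2_eqI)
  fix x j assume "\<And>j k. ent A j k = ent B j k"
  then show "ell2_nth (rop A x) j = ell2_nth (rop B x) j"
    using rop_nth_sums[of A j x] rop_nth_sums[of B j x] by (simp add: sums_unique2)
qed

section \<open>Coordinate projections\<close>

lift_definition ell2_pr :: "nat \<Rightarrow> ell2 \<Rightarrow> ell2" is "\<lambda>N x n. if n < N then x n else 0"
  subgoal for N x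
    by (rule summable_comparison_test'[of "\<lambda>n. (cmod (x n))\<^sup>2"]) auto
  done

lemma ell2_nth_pr [simp]: "ell2_nth (ell2_pr N x) n = (if n < N then ell2_nth x n else 0)"
  by (simp add: ell2_pr.rep_eq)

lemma ell2_norm_pr_le: "norm (ell2_pr N x) \<le> norm x" "norm (x - ell2_pr N x) \<le> norm x"
proof -
  show "norm (ell2_pr N x) \<le> norm x"
  proof (rule ell2_norm_le)
    fix K show "(\<Sum>n<K. (cmod (ell2_nth (ell2_pr N x) n))\<^sup>2) \<le> (norm x)\<^sup>2"
      by (rule order_trans[OF sum_mono ell2_sum_le_norm_sq[of "{..<K}"]]) auto
  qed simp
  show "norm (x - ell2_pr N x) \<le> norm x"
  proof (rule ell2_norm_le)
    fix K show "(\<Sum>n<K. (cmod (ell2_nth (x - ell2_pr N x) n))\<^sup>2) \<le> (norm x)\<^sup>2"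
      by (rule order_trans[OF sum_mono ell2_sum_le_norm_sq[of "{..<K}"]]) auto
  qed simp
qed

lift_definition pr :: "nat \<Rightarrow> cop" is "\<lambda>N. Blinfun (ell2_pr N)"
proof -
  fix N
  have "bounded_linear (ell2_pr N)"
    by (rule bounded_linear_intro[of _ 1]) (auto intro!: ell2_eqI simp: ell2_norm_pr_le)
  then show "clinear_op (Blinfun (ell2_pr N))"
    by (auto simp: clinear_op_def bounded_linear_Blinfun_apply intro!: ell2_eqI)
qed

lemma rop_pr [simp]: "rop (pr N) x = ell2_pr N x"
proof -
  have "bounded_linear (ell2_pr N)"
    by (rule bounded_linear_intro[of _ 1]) (auto intro!: ell2_eqI simp: ell2_norm_pr_le)
  then show ?thesis by (simp add: pr.rep_eq bounded_linear_Blinfun_apply)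
qed

lemma ell2_pr_sum: "ell2_pr N x = (\<Sum>n<N. ell2_scaleC (ell2_nth x n) (ell2_unit n))"
proof (rule ell2_eqI)
  fix k show "ell2_nth (ell2_pr N x) k = ell2_nth (\<Sum>n<N. ell2_scaleC (ell2_nth x n) (ell2_unit n)) k"
    unfolding linear_sum[OF bounded_linear.linear[OF bounded_linear_ell2_nth]]
    by (simp add: sum_unit_eq)
qed

lemma ell2_pr_tendsto: "(\<lambda>N. ell2_pr N x) \<longlonglongrightarrow> x"
  using ell2_unit_expansion[of x] by (simp add: sums_def ell2_pr_sum)

lemma pr_idem [simp]: "pr N * pr N = pr N"
  by (rule cop_eqI, rule ell2_eqI) simp

lemma norm_pr_le: "norm (pr N) \<le> 1" "norm (1 - pr N) \<le> 1"
  by (auto simp: norm_cop.rep_eq ell2_norm_pr_le intro!: norm_blinfun_bound)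

lemma ent_pr_left: "ent (pr N * A) j k = (if j < N then ent A j k else 0)"
  by (simp add: ent_def)

lemma ell2_pr_unit: "ell2_pr N (ell2_unit k) = (if k < N then ell2_unit k else 0)"
  by (rule ell2_eqI) auto

lemma ent_pr_right: "ent (A * pr N) j k = (if k < N then ent A j k else 0)"
  by (simp add: ent_def ell2_pr_unit)

section \<open>Nuclear operators\<close>

text \<open>Domination by \<open>a\<close> makes the double family absolutely summable, so its
  unordered sum exists, may be evaluated row by row, and may be reindexed along the pairing
  bijection. Used to merge countably many nuclear representations into one.\<close>

lemma sums_prod_decode:
  fixes f :: "nat \<Rightarrow> nat \<Rightarrow> 'a::banach"
  assumes a: "\<And>n. summable (a n)" "summable (\<lambda>n. \<Sum>k. a n k)"
    and fa: "\<And>n k. norm (f n k) \<le> a n k"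
    and g: "\<And>n. f n sums g n" and G: "g sums G"
  shows "(\<lambda>i. f (fst (prod_decode i)) (snd (prod_decode i))) sums G"
proof -
  have a0: "0 \<le> a n k" for n k using fa[of n k] norm_ge_zero order_trans by blast
  have "(\<lambda>(n,k). a n k) summable_on (UNIV \<times> UNIV)"
  proof (rule summable_on_SigmaI)
    show "((\<lambda>k. (\<lambda>(n,k). a n k) (n, k)) has_sum (\<Sum>k. a n k)) UNIV" for n
      using norm_summable_imp_has_sum[of "a n"] a(1)[of n] a0 by (simp add: summable_sums)
    show "(\<lambda>n. \<Sum>k. a n k) summable_on UNIV"
      using a by (subst summable_on_UNIV_nonneg_real_iff) (auto intro: suminf_nonneg a0)
  qed (use a0 in auto)
  then have abs: "(\<lambda>p. norm ((\<lambda>(n,k). f n k) p)) summable_on (UNIV \<times> UNIV)"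
    by (rule Infinite_Sum.abs_summable_on_comparison_test') (use fa in auto)
  then have "(\<lambda>(n,k). f n k) summable_on (UNIV \<times> UNIV)"
    by (rule abs_summable_summable)
  moreover have hs: "((\<lambda>k. (\<lambda>(n,k). f n k) (n,k)) has_sum g n) UNIV" for n
  proof -
    have "summable (\<lambda>k. norm (f n k))"
      by (rule summable_comparison_test'[OF a(1)[of n]]) (use fa in auto)
    then show ?thesis using norm_summable_imp_has_sum[OF _ g] by auto
  qed
  moreover have "(g has_sum G) UNIV"
  proof (rule norm_summable_imp_has_sum[OF _ G])
    have "norm (g n) \<le> (\<Sum>k. a n k)" for n
      unfolding sums_unique[OF g]
      by (rule order_trans[OF summable_norm suminf_le])
         (auto intro!: fa a summable_comparison_test'[OF a(1)[of n]])
    then show "summable (\<lambda>n. norm (g n))"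
      by (intro summable_comparison_test'[OF a(2)]) auto
  qed
  ultimately have "((\<lambda>(n,k). f n k) has_sum G) (UNIV \<times> UNIV)"
    by (intro has_sum_SigmaI)
  then have "((\<lambda>i. (\<lambda>(n,k). f n k) (prod_decode i)) has_sum G) UNIV"
    using has_sum_reindex_bij_betw[OF bij_prod_decode] by (metis UNIV_Times_UNIV)
  then show ?thesis by (auto dest!: has_sum_imp_sums simp: case_prod_beta)
qed

text \<open>Functionals of the underlying type are only real-linear; complex linearity is what
  expresses \<open>\<phi> k (u k)\<close> through the values of \<open>\<phi> k\<close> at the unit
  vectors, hence through matrix entries.\<close>

definition clin :: "(ell2 \<Rightarrow>\<^sub>L complex) \<Rightarrow> bool"
  where "clin \<phi> \<longleftrightarrow> (\<forall>c x. \<phi> (ell2_scaleC c x) = c * \<phi> x)"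

text \<open>\<open>Z\<close> is the absolutely convergent sum of the rank one operators \<open>x \<mapsto> \<phi>\<^sub>k(x) u\<^sub>k\<close>, and \<open>r\<close>
  bounds its projective norm.\<close>

definition nuc_rep :: "(nat \<Rightarrow> ell2) \<Rightarrow> (nat \<Rightarrow> ell2 \<Rightarrow>\<^sub>L complex) \<Rightarrow> cop \<Rightarrow> real \<Rightarrow> bool"
  where "nuc_rep u \<phi> Z r \<longleftrightarrow> (\<forall>k. clin (\<phi> k)) \<and> summable (\<lambda>k. norm (\<phi> k) * norm (u k)) \<and>
    (\<Sum>k. norm (\<phi> k) * norm (u k)) \<le> r \<and> (\<forall>x. (\<lambda>k. ell2_scaleC (\<phi> k x) (u k)) sums rop Z x)"

text \<open>A relation rather than a norm, so that an estimate is witnessed by one explicit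
  representation; the infimum over \<open>r\<close> later becomes the norm of
  \<open>nucl\<close>.\<close>

definition nuc :: "cop \<Rightarrow> real \<Rightarrow> bool"
  where "nuc Z r \<longleftrightarrow> (\<exists>u \<phi>. nuc_rep u \<phi> Z r)"

lemma nuc_rep_term_bound: "norm (ell2_scaleC (\<phi> x) u) \<le> norm \<phi> * norm u * norm x"
  for \<phi> :: "ell2 \<Rightarrow>\<^sub>L complex"
  using mult_right_mono[OF norm_blinfun[of \<phi> x] norm_ge_zero[of u]]
  by (simp add: ell2_norm_scaleC mult_ac)

lemma nuc_norm_le:
  assumes "nuc Z r" shows "norm Z \<le> r"
proof -
  obtain u \<phi> where rep: "nuc_rep u \<phi> Z r" using assms nuc_def by blast
  have sm: "summable (\<lambda>k. norm (\<phi> k) * norm (u k))" and r: "(\<Sum>k. norm (\<phi> k) * norm (u k)) \<le> r"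
    and Z: "\<And>x. (\<lambda>k. ell2_scaleC (\<phi> k x) (u k)) sums rop Z x"
    using rep unfolding nuc_rep_def by blast+
  have "0 \<le> (\<Sum>k. norm (\<phi> k) * norm (u k))" by (rule suminf_nonneg[OF sm]) simp
  then have "0 \<le> r" using r by linarith
  have "norm (rop Z x) \<le> r * norm x" for x
  proof -
    have sm': "summable (\<lambda>k. norm (ell2_scaleC (\<phi> k x) (u k)))"
      by (rule summable_comparison_test'[OF summable_mult2[OF sm, of "norm x"]])
         (use nuc_rep_term_bound in auto)
    have "norm (rop Z x) \<le> (\<Sum>k. norm (ell2_scaleC (\<phi> k x) (u k)))"
      unfolding sums_unique[OF Z] by (rule summable_norm[OF sm'])
    also have "\<dots> \<le> (\<Sum>k. norm (\<phi> k) * norm (u k) * norm x)"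
      by (rule suminf_le[OF _ sm' summable_mult2[OF sm]]) (rule nuc_rep_term_bound)
    also have "\<dots> = (\<Sum>k. norm (\<phi> k) * norm (u k)) * norm x"
      by (rule suminf_mult2[OF sm, symmetric])
    also have "\<dots> \<le> r * norm x" by (intro mult_right_mono r) simp
    finally show ?thesis .
  qed
  then show ?thesis using \<open>0 \<le> r\<close> by (simp add: norm_cop.rep_eq norm_blinfun_bound)
qed

lemma nuc_nonneg: "nuc Z r \<Longrightarrow> 0 \<le> r"
  using nuc_norm_le norm_ge_zero order_trans by blast

lemma nuc_mono: "nuc Z r \<Longrightarrow> r \<le> s \<Longrightarrow> nuc Z s"
  unfolding nuc_def nuc_rep_def by (meson order_trans)

lemma nuc_zero: "nuc 0 0"
  unfolding nuc_def nuc_rep_def by (rule exI[of _ "\<lambda>_. 0"], rule exI[of _ "\<lambda>_. 0"]) (simp add: clin_def)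

lemma nuc_rep_mult_left:
  assumes "nuc_rep u \<phi> Z r"
  shows "nuc_rep (\<lambda>k. rop X (u k)) \<phi> (X * Z) (norm X * r)"
proof -
  have sm: "summable (\<lambda>k. norm (\<phi> k) * norm (u k))" and r: "(\<Sum>k. norm (\<phi> k) * norm (u k)) \<le> r"
    and Z: "\<And>x. (\<lambda>k. ell2_scaleC (\<phi> k x) (u k)) sums rop Z x" and c: "\<And>k. clin (\<phi> k)"
    using assms unfolding nuc_rep_def by blast+
  have b: "norm (\<phi> k) * norm (rop X (u k)) \<le> norm X * (norm (\<phi> k) * norm (u k))" for k
    using mult_left_mono[OF rop_bound[of X "u k"], of "norm (\<phi> k)"] by (simp add: mult_ac)
  have sm': "summable (\<lambda>k. norm (\<phi> k) * norm (rop X (u k)))"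
    by (rule summable_comparison_test'[OF summable_mult[OF sm, of "norm X"]]) (use b in auto)
  have "(\<Sum>k. norm (\<phi> k) * norm (rop X (u k))) \<le> (\<Sum>k. norm X * (norm (\<phi> k) * norm (u k)))"
    by (rule suminf_le[OF b sm' summable_mult[OF sm]])
  also have "\<dots> = norm X * (\<Sum>k. norm (\<phi> k) * norm (u k))" by (rule suminf_mult[OF sm])
  also have "\<dots> \<le> norm X * r" by (intro mult_left_mono r) simp
  finally have r': "(\<Sum>k. norm (\<phi> k) * norm (rop X (u k))) \<le> norm X * r" .
  have "(\<lambda>k. ell2_scaleC (\<phi> k x) (rop X (u k))) sums rop (X * Z) x" for x
    using bounded_linear.sums[OF bounded_linear_rop_right[of X] Z[of x]] by (simp add: rop_scaleC)
  with sm' r' c show ?thesis unfolding nuc_rep_def by blast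
qed

lemma nuc_rep_mult_right:
  assumes "nuc_rep u \<phi> Z r"
  shows "nuc_rep u (\<lambda>k. \<phi> k o\<^sub>L rop X) (Z * X) (r * norm X)"
proof -
  have sm: "summable (\<lambda>k. norm (\<phi> k) * norm (u k))" and r: "(\<Sum>k. norm (\<phi> k) * norm (u k)) \<le> r"
    and Z: "\<And>x. (\<lambda>k. ell2_scaleC (\<phi> k x) (u k)) sums rop Z x" and c: "\<And>k. clin (\<phi> k)"
    using assms unfolding nuc_rep_def by blast+
  have b: "norm (\<phi> k o\<^sub>L rop X) * norm (u k) \<le> norm (\<phi> k) * norm (u k) * norm X" for k
    using mult_right_mono[OF norm_blinfun_compose[of "\<phi> k" "rop X"], of "norm (u k)"]
    by (simp add: mult_ac norm_cop.rep_eq)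
  have sm': "summable (\<lambda>k. norm (\<phi> k o\<^sub>L rop X) * norm (u k))"
    by (rule summable_comparison_test'[OF summable_mult2[OF sm, of "norm X"]]) (use b in auto)
  have "(\<Sum>k. norm (\<phi> k o\<^sub>L rop X) * norm (u k)) \<le> (\<Sum>k. norm (\<phi> k) * norm (u k) * norm X)"
    by (rule suminf_le[OF b sm' summable_mult2[OF sm]])
  also have "\<dots> = (\<Sum>k. norm (\<phi> k) * norm (u k)) * norm X" by (rule suminf_mult2[OF sm, symmetric])
  also have "\<dots> \<le> r * norm X" by (intro mult_right_mono r) simp
  finally have r': "(\<Sum>k. norm (\<phi> k o\<^sub>L rop X) * norm (u k)) \<le> r * norm X" .
  have "clin (\<phi> k o\<^sub>L rop X)" for k using c[of k] by (simp add: clin_def rop_scaleC)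
  with sm' r' Z show ?thesis unfolding nuc_rep_def by simp
qed

lemma nuc_mult_left: "nuc Z r \<Longrightarrow> nuc (X * Z) (norm X * r)"
  unfolding nuc_def using nuc_rep_mult_left by blast

lemma nuc_mult_right: "nuc Z r \<Longrightarrow> nuc (Z * X) (r * norm X)"
  unfolding nuc_def using nuc_rep_mult_right by blast

lemma nuc_scaleR: "nuc Z r \<Longrightarrow> nuc (c *\<^sub>R Z) (\<bar>c\<bar> * r)"
  using nuc_mult_left[of Z r "c *\<^sub>R 1"] by simp

text \<open>The representations of all \<open>D n\<close> are concatenated along the pairing of
  indices. Both the triangle inequality and the completeness of the nuclear norm rest on
  this.\<close>

lemma nuc_suminf:
  assumes D: "\<And>n. nuc (D n) (r n)" and r: "summable r"
  shows "nuc (\<Sum>n. D n) (\<Sum>n. r n)"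
proof -
  obtain u \<phi> where rep: "\<And>n. nuc_rep (u n) (\<phi> n) (D n) (r n)"
    using D unfolding nuc_def by metis
  define a where "a n k = norm (\<phi> n k) * norm (u n k)" for n k
  have a0: "0 \<le> a n k" for n k by (simp add: a_def)
  have sm: "summable (a n)" and ar: "(\<Sum>k. a n k) \<le> r n"
    and Z: "\<And>x. (\<lambda>k. ell2_scaleC (\<phi> n k x) (u n k)) sums rop (D n) x"
    and c: "\<And>k. clin (\<phi> n k)" for n
    using rep[of n] unfolding nuc_rep_def a_def by blast+
  have a1: "summable (\<lambda>n. \<Sum>k. a n k)"
    by (rule summable_comparison_test'[OF r]) (use ar a0 suminf_nonneg[OF sm] in auto)
  have Ds: "D sums (\<Sum>n. D n)"
    by (rule summable_sums, rule summable_comparison_test'[OF r]) (use nuc_norm_le[OF D] in auto)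
  let ?i = "\<lambda>i. fst (prod_decode i)" and ?j = "\<lambda>i. snd (prod_decode i)"
  have s: "(\<lambda>i. a (?i i) (?j i)) sums (\<Sum>n. \<Sum>k. a n k)"
    by (rule sums_prod_decode[where a = a, OF sm a1]) (use a0 sm a1 in \<open>auto simp: summable_sums\<close>)
  moreover have "(\<lambda>i. ell2_scaleC (\<phi> (?i i) (?j i) x) (u (?i i) (?j i))) sums rop (\<Sum>n. D n) x" for x
  proof (rule sums_prod_decode[where a = "\<lambda>n k. a n k * norm x"])
    show "summable (\<lambda>k. a n k * norm x)" for n by (rule summable_mult2[OF sm])
    show "summable (\<lambda>n. \<Sum>k. a n k * norm x)"
      using summable_mult2[OF a1, of "norm x"] by (simp add: suminf_mult2[OF sm])
    show "norm (ell2_scaleC (\<phi> n k x) (u n k)) \<le> a n k * norm x" for n k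
      unfolding a_def by (rule nuc_rep_term_bound)
    show "(\<lambda>k. ell2_scaleC (\<phi> n k x) (u n k)) sums rop (D n) x" for n by (rule Z)
    show "(\<lambda>n. rop (D n) x) sums rop (\<Sum>n. D n) x"
      by (rule bounded_linear.sums[OF bounded_linear_rop_apply Ds])
  qed
  moreover have "(\<Sum>n. \<Sum>k. a n k) \<le> (\<Sum>n. r n)" by (rule suminf_le[OF ar a1 r])
  ultimately have "nuc_rep (\<lambda>i. u (?i i) (?j i)) (\<lambda>i. \<phi> (?i i) (?j i)) (\<Sum>n. D n) (\<Sum>n. r n)"
    unfolding nuc_rep_def using c unfolding a_def by (auto simp: sums_iff)
  then show ?thesis unfolding nuc_def by blast
qed

lemma nuc_add:
  assumes "nuc X r" "nuc Y s" shows "nuc (X + Y) (r + s)"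
proof -
  let ?D = "\<lambda>n::nat. if n = 0 then X else if n = 1 then Y else 0"
  let ?r = "\<lambda>n::nat. if n = 0 then r else if n = 1 then s else 0"
  have "?r sums (\<Sum>n\<in>{0,1}. ?r n)" "?D sums (\<Sum>n\<in>{0,1}. ?D n)"
    by (rule sums_finite; auto)+
  then have "?r sums (r + s)" "?D sums (X + Y)" by simp_all
  moreover have "nuc (?D n) (?r n)" for n using assms nuc_zero by auto
  ultimately show ?thesis using nuc_suminf[of ?D ?r] by (simp add: sums_iff)
qed

text \<open>The first \<open>N\<close> diagonal entries add up to the sum over \<open>k\<close> of
  \<open>\<phi> k\<close> applied to the truncation of \<open>u k\<close>; dominated convergence
  lets \<open>N\<close> grow. So the sum on the right does not depend on the representation.\<close>

lemma nuc_rep_trace: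
  assumes "nuc_rep u \<phi> Z r"
  shows "(\<lambda>n. ent Z n n) sums (\<Sum>k. \<phi> k (u k))"
proof -
  have sm: "summable (\<lambda>k. norm (\<phi> k) * norm (u k))"
    and Z: "\<And>x. (\<lambda>k. ell2_scaleC (\<phi> k x) (u k)) sums rop Z x" and c: "\<And>k. clin (\<phi> k)"
    using assms unfolding nuc_rep_def by blast+
  have part: "(\<Sum>n<N. ent Z n n) = (\<Sum>k. \<phi> k (ell2_pr N (u k)))" for N
  proof -
    have "(\<lambda>k. \<Sum>n<N. \<phi> k (ell2_unit n) * ell2_nth (u k) n) sums (\<Sum>n<N. ent Z n n)"
      by (rule sums_sum)
         (use bounded_linear.sums[OF bounded_linear_ell2_nth Z] in \<open>simp add: ent_def\<close>)
    moreover have "\<phi> k (ell2_pr N (u k)) = (\<Sum>n<N. \<phi> k (ell2_unit n) * ell2_nth (u k) n)" for k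
      using c[of k] by (simp add: ell2_pr_sum blinfun.sum_right clin_def mult.commute)
    ultimately show ?thesis by (simp add: sums_iff)
  qed
  have "(\<lambda>N. \<Sum>k. \<phi> k (ell2_pr N (u k))) \<longlonglongrightarrow> (\<Sum>k. \<phi> k (u k))"
  proof (rule tannerys_theorem[THEN conjunct2, THEN conjunct2])
    show "(\<lambda>N. \<phi> k (ell2_pr N (u k))) \<longlonglongrightarrow> \<phi> k (u k)" for k
      by (intro blinfun.tendsto tendsto_const ell2_pr_tendsto)
    have "norm (\<phi> k (ell2_pr N (u k))) \<le> norm (\<phi> k) * norm (u k)" for k N
      by (rule order_trans[OF norm_blinfun mult_left_mono[OF ell2_norm_pr_le(1)]]) simp
    then show "\<forall>\<^sub>F (k, N) in sequentially \<times>\<^sub>F sequentially.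
        norm (\<phi> k (ell2_pr N (u k))) \<le> norm (\<phi> k) * norm (u k)"
      by (intro always_eventually) auto
  qed (use sm in auto)
  then show ?thesis unfolding sums_def part .
qed

section \<open>The trace of nuclear operators\<close>

definition tr :: "cop \<Rightarrow> complex"
  where "tr Z = (\<Sum>n. ent Z n n)"

lemma op_trace_rop: "op_trace (rop Z) = tr Z"
  by (simp add: op_trace_def tr_def op_entry_rop)

lemma nuc_rep_tr: "nuc_rep u \<phi> Z r \<Longrightarrow> tr Z = (\<Sum>k. \<phi> k (u k))"
  using nuc_rep_trace sums_unique unfolding tr_def by metis

lemma nuc_ent_summable: "nuc Z r \<Longrightarrow> summable (\<lambda>n. ent Z n n)"
  using nuc_rep_trace sums_summable unfolding nuc_def by blast

lemma norm_tr_le: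
  assumes "nuc Z r" shows "norm (tr Z) \<le> r"
proof -
  obtain u \<phi> where rep: "nuc_rep u \<phi> Z r" using assms nuc_def by blast
  then have sm: "summable (\<lambda>k. norm (\<phi> k) * norm (u k))" and r: "(\<Sum>k. norm (\<phi> k) * norm (u k)) \<le> r"
    unfolding nuc_rep_def by blast+
  have sm': "summable (\<lambda>k. norm (\<phi> k (u k)))"
    by (rule summable_comparison_test'[OF sm]) (simp add: norm_blinfun)
  have "norm (tr Z) \<le> (\<Sum>k. norm (\<phi> k (u k)))"
    unfolding nuc_rep_tr[OF rep] by (rule summable_norm[OF sm'])
  also have "\<dots> \<le> r" using suminf_le[OF norm_blinfun sm' sm] r by linarith
  finally show ?thesis .
qed

text \<open>One representation of \<open>Z\<close> induces representations of \<open>X * Z\<close>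
  and of \<open>Z * X\<close> whose traces are the same series, with terms \<open>\<phi> k\<close>
  applied to \<open>X (u k)\<close>.\<close>

lemma tr_mult_commute:
  assumes "nuc Z r" shows "tr (X * Z) = tr (Z * X)"
proof -
  obtain u \<phi> where rep: "nuc_rep u \<phi> Z r" using assms nuc_def by blast
  show ?thesis
    using nuc_rep_tr[OF nuc_rep_mult_left[OF rep, of X]] nuc_rep_tr[OF nuc_rep_mult_right[OF rep, of X]]
    by simp
qed

lemma tr_add: "nuc X r \<Longrightarrow> nuc Y s \<Longrightarrow> tr (X + Y) = tr X + tr Y"
  unfolding tr_def by (simp add: suminf_add nuc_ent_summable)

lemma tr_diff: "nuc X r \<Longrightarrow> nuc Y s \<Longrightarrow> tr (X - Y) = tr X - tr Y"
  unfolding tr_def by (simp add: suminf_diff nuc_ent_summable)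

lemma tr_scaleR: "nuc X r \<Longrightarrow> tr (c *\<^sub>R X) = c *\<^sub>R tr X"
  unfolding tr_def ent_simps scaleR_conv_of_real[of c "_ :: complex"] by (rule suminf_mult[OF nuc_ent_summable])

text \<open>Truncation converges on each vector \<open>u k\<close>, and the weighted sum of the
  errors is dominated by the summable terms of the representation.\<close>

lemma nuc_tail:
  assumes "nuc Z r" "e > 0"
  shows "\<exists>N0. \<forall>N\<ge>N0. nuc ((1 - pr N) * Z) e"
proof -
  obtain u \<phi> where rep: "nuc_rep u \<phi> Z r" using assms nuc_def by blast
  then have sm: "summable (\<lambda>k. norm (\<phi> k) * norm (u k))" unfolding nuc_rep_def by blast
  have "(\<lambda>N. \<Sum>k. norm (\<phi> k) * norm (u k - ell2_pr N (u k))) \<longlonglongrightarrow> (\<Sum>k. norm (\<phi> k) * norm (u k - u k))"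
  proof (rule tannerys_theorem[THEN conjunct2, THEN conjunct2])
    show "(\<lambda>N. norm (\<phi> k) * norm (u k - ell2_pr N (u k))) \<longlonglongrightarrow> norm (\<phi> k) * norm (u k - u k)" for k
      by (intro tendsto_intros ell2_pr_tendsto)
    show "\<forall>\<^sub>F (k, N) in sequentially \<times>\<^sub>F sequentially.
        norm (norm (\<phi> k) * norm (u k - ell2_pr N (u k))) \<le> norm (\<phi> k) * norm (u k)"
      by (intro always_eventually) (auto intro!: mult_left_mono ell2_norm_pr_le)
  qed (use sm in auto)
  then have "\<forall>\<^sub>F N in sequentially. (\<Sum>k. norm (\<phi> k) * norm (u k - ell2_pr N (u k))) < e"
    using assms(2) by (auto intro: order_tendstoD)
  moreover have "nuc ((1 - pr N) * Z) e"
    if "(\<Sum>k. norm (\<phi> k) * norm (u k - ell2_pr N (u k))) < e" for N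
  proof -
    have "nuc_rep (\<lambda>k. u k - ell2_pr N (u k)) \<phi> ((1 - pr N) * Z) e"
      using nuc_rep_mult_left[OF rep, of "1 - pr N"] that
      unfolding nuc_rep_def by simp
    then show ?thesis unfolding nuc_def by blast
  qed
  ultimately show ?thesis by (auto simp: eventually_sequentially)
qed

text \<open>A separate Banach space of nuclear operators, because paths of them are integrated in
  the nuclear norm, which dominates the operator norm and makes the trace continuous.\<close>

typedef nucl = "{Z. \<exists>r. nuc Z r}"
  morphisms cop_of Abs_nucl
  by (rule exI[of _ 0]) (use nuc_zero in blast)

setup_lifting type_definition_nucl

lemma nuc_cop_of: "\<exists>r. nuc (cop_of Z) r"
  using cop_of by auto

instantiation nucl :: real_normed_vector
begin
lift_definition zero_nucl :: nucl is 0 using nuc_zero by blast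
lift_definition plus_nucl :: "nucl \<Rightarrow> nucl \<Rightarrow> nucl" is "(+)" using nuc_add by blast
lift_definition uminus_nucl :: "nucl \<Rightarrow> nucl" is uminus
  subgoal for Z using nuc_scaleR[of Z _ "-1"] by auto
  done
lift_definition minus_nucl :: "nucl \<Rightarrow> nucl \<Rightarrow> nucl" is "(-)"
  subgoal for Y Z using nuc_scaleR[of Z _ "-1"] nuc_add[of Y _ "- Z"] by fastforce
  done
lift_definition scaleR_nucl :: "real \<Rightarrow> nucl \<Rightarrow> nucl" is scaleR using nuc_scaleR by blast
lift_definition norm_nucl :: "nucl \<Rightarrow> real" is "\<lambda>Z. Inf {r. nuc Z r}" .
definition sgn_nucl :: "nucl \<Rightarrow> nucl" where "sgn_nucl x = scaleR (inverse (norm x)) x"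
definition dist_nucl :: "nucl \<Rightarrow> nucl \<Rightarrow> real" where "dist_nucl x y = norm (x - y)"
definition uniformity_nucl :: "(nucl \<times> nucl) filter"
  where "uniformity_nucl = (INF e\<in>{0<..}. principal {(x, y). dist x y < e})"
definition open_nucl :: "nucl set \<Rightarrow> bool"
  where "open_nucl U \<longleftrightarrow> (\<forall>x\<in>U. eventually (\<lambda>(x', y). x' = x \<longrightarrow> y \<in> U) uniformity)"

lemma norm_nucl_le: "nuc (cop_of Z) r \<Longrightarrow> norm Z \<le> r"
  unfolding norm_nucl.rep_eq by (rule cInf_lower) (auto intro!: bdd_belowI[of _ 0] nuc_nonneg)

lemma norm_nucl_less: "norm Z < r \<Longrightarrow> nuc (cop_of Z) r"
  unfolding norm_nucl.rep_eq
  using nuc_cop_of[of Z] cInf_lessD[of "{r. nuc (cop_of Z) r}" r] nuc_mono by fastforce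

lemma norm_nucl_geI: "(\<And>r. nuc (cop_of Z) r \<Longrightarrow> c \<le> r) \<Longrightarrow> c \<le> norm Z"
  unfolding norm_nucl.rep_eq using nuc_cop_of[of Z] by (intro cInf_greatest) auto

instance
proof
  fix x y z :: nucl and r s :: real
  show "x + y + z = x + (y + z)" by transfer (rule add.assoc)
  show "x + y = y + x" by transfer (rule add.commute)
  show "0 + x = x" by transfer simp
  show "- x + x = 0" by transfer simp
  show "x - y = x + - y" by transfer simp
  show "r *\<^sub>R (x + y) = r *\<^sub>R x + r *\<^sub>R y" by transfer (rule scaleR_add_right)
  show "(r + s) *\<^sub>R x = r *\<^sub>R x + s *\<^sub>R x" by transfer (rule scaleR_add_left)
  show "r *\<^sub>R s *\<^sub>R x = (r * s) *\<^sub>R x" by transfer simp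
  show "1 *\<^sub>R x = x" by transfer simp
  show "norm x = 0 \<longleftrightarrow> x = 0"
  proof
    assume "norm x = 0"
    have "norm (cop_of x) \<le> norm x" by (rule norm_nucl_geI) (rule nuc_norm_le)
    then show "x = 0" using \<open>norm x = 0\<close> by (simp add: zero_nucl.rep_eq flip: cop_of_inject)
  next
    assume "x = 0"
    then have "norm x \<le> 0" using norm_nucl_le[of x 0] nuc_zero by (simp add: zero_nucl.rep_eq)
    moreover have "0 \<le> norm x" by (rule norm_nucl_geI) (rule nuc_nonneg)
    ultimately show "norm x = 0" by linarith
  qed
  show "norm (x + y) \<le> norm x + norm y"
  proof (rule field_le_epsilon)
    fix e :: real assume "e > 0"
    then have "nuc (cop_of x) (norm x + e/2)" "nuc (cop_of y) (norm y + e/2)"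
      by (intro norm_nucl_less; simp)+
    then have "nuc (cop_of (x + y)) (norm x + e/2 + (norm y + e/2))"
      unfolding plus_nucl.rep_eq by (rule nuc_add)
    then have "norm (x + y) \<le> norm x + e/2 + (norm y + e/2)" by (rule norm_nucl_le)
    then show "norm (x + y) \<le> norm x + norm y + e" by (simp add: field_simps)
  qed
  have le: "norm (r *\<^sub>R x) \<le> \<bar>r\<bar> * norm x" for r and x :: nucl
  proof (rule field_le_epsilon)
    fix e :: real assume "e > 0"
    define d where "d = e / (\<bar>r\<bar> + 1)"
    have d: "d > 0" "\<bar>r\<bar> * d \<le> e"
      using \<open>e > 0\<close> by (auto simp: d_def field_simps)
    then have "nuc (cop_of x) (norm x + d)" by (intro norm_nucl_less) simp
    then have "nuc (cop_of (r *\<^sub>R x)) (\<bar>r\<bar> * (norm x + d))"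
      unfolding scaleR_nucl.rep_eq by (rule nuc_scaleR)
    then have "norm (r *\<^sub>R x) \<le> \<bar>r\<bar> * (norm x + d)" by (rule norm_nucl_le)
    then show "norm (r *\<^sub>R x) \<le> \<bar>r\<bar> * norm x + e" using d by (simp add: algebra_simps)
  qed
  show "norm (r *\<^sub>R x) = \<bar>r\<bar> * norm x"
  proof (cases "r = 0")
    case True
    then show ?thesis using le[of r x] norm_nucl_geI[of "r *\<^sub>R x" 0] nuc_nonneg by fastforce
  next
    case False
    have "inverse r *\<^sub>R r *\<^sub>R x = x" using False by transfer simp
    then have "norm x \<le> \<bar>inverse r\<bar> * norm (r *\<^sub>R x)" using le[of "inverse r" "r *\<^sub>R x"] by simp
    then have "\<bar>r\<bar> * norm x \<le> norm (r *\<^sub>R x)" using False by (simp add: field_simps)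
    then show ?thesis using le[of r x] by simp
  qed
qed (simp_all add: sgn_nucl_def dist_nucl_def uniformity_nucl_def open_nucl_def)

end

lemmas nucl_rep_eqs [simp] = zero_nucl.rep_eq plus_nucl.rep_eq minus_nucl.rep_eq
  uminus_nucl.rep_eq scaleR_nucl.rep_eq

lemma cop_of_norm_le: "norm (cop_of Z) \<le> norm Z"
  by (rule norm_nucl_geI) (rule nuc_norm_le)

lemma bounded_linear_cop_of: "bounded_linear cop_of"
  by (rule bounded_linear_intro[of _ 1]) (auto simp: cop_of_norm_le)

instance nucl :: banach
proof
  fix X :: "nat \<Rightarrow> nucl"
  assume X: "Cauchy X"
  have "\<forall>n. \<exists>M. \<forall>i\<ge>M. \<forall>j\<ge>M. norm (X i - X j) < (1/2) ^ n"
    using X unfolding Cauchy_def dist_norm by simp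
  then obtain m where m: "\<And>n i j. i \<ge> m n \<Longrightarrow> j \<ge> m n \<Longrightarrow> norm (X i - X j) < (1/2) ^ n"
    by metis
  \<comment> \<open>Adding up the thresholds makes \<open>s\<close> increasing, so that
    \<open>s n\<close> and \<open>s (Suc n)\<close> both lie beyond \<open>m n\<close>.\<close>
  define s where "s n = (\<Sum>i\<le>n. m i)" for n
  have s_ge: "m n \<le> s n" and s_mono: "s n \<le> s (Suc n)" for n
    unfolding s_def by (auto intro: member_le_sum)
  define D where "D n = cop_of (X (s (Suc n))) - cop_of (X (s n))" for n
  have D: "nuc (D n) ((1/2) ^ n)" for n
    using norm_nucl_less[OF m[of n "s (Suc n)" "s n"]] s_ge[of n] s_mono[of n]
    by (simp add: D_def)
  have geo: "summable (\<lambda>n. (1/2 :: real) ^ n)" by simp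
  have Dsm: "summable D"
    by (rule summable_comparison_test'[OF geo]) (use nuc_norm_le[OF D] in auto)
  \<comment> \<open>The telescoping series converges in operator norm; since its terms have
    geometric nuclear bounds, \<open>nuc_suminf\<close> bounds the tails in the nuclear norm as
    well.\<close>
  define L where "L = cop_of (X (s 0)) + (\<Sum>n. D n)"
  have tail: "nuc (L - cop_of (X (s k))) (2 * (1/2) ^ k)" for k
  proof -
    have "cop_of (X (s 0)) + (\<Sum>n<k. D n) = cop_of (X (s k))"
      unfolding D_def by (subst sum_lessThan_telescope) simp
    then have "L - cop_of (X (s k)) = (\<Sum>n. D (n + k))"
      using suminf_split_initial_segment[OF Dsm, of k] by (simp add: L_def algebra_simps)
    moreover have "nuc (\<Sum>n. D (n + k)) (\<Sum>n. (1/2) ^ (n + k))"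
      by (rule nuc_suminf) (use D geo in \<open>auto simp: summable_iff_shift\<close>)
    moreover have "(\<Sum>n. (1/2 :: real) ^ (n + k)) = 2 * (1/2) ^ k"
      using suminf_mult2[OF geo, of "(1/2) ^ k"] suminf_geometric[of "1/2 :: real"]
      by (simp add: power_add)
    ultimately show ?thesis by simp
  qed
  obtain r where r: "nuc (cop_of (X (s 0))) r" using nuc_cop_of by blast
  have "nuc L (2 + r)" using nuc_add[OF tail[of 0] r] by simp
  then have L: "cop_of (Abs_nucl L) = L" using Abs_nucl_inverse[of L] by blast
  have "X \<longlonglongrightarrow> Abs_nucl L"
  proof (rule LIMSEQ_I)
    fix e :: real assume e: "e > 0"
    then obtain k where k: "(1/2 :: real) ^ k < e / 3"
      using real_arch_pow_inv[of "e/3" "1/2"] by auto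
    have "norm (X i - Abs_nucl L) < e" if "i \<ge> s k" for i
    proof -
      have "norm (Abs_nucl L - X (s k)) \<le> 2 * (1/2) ^ k"
        using tail[of k] by (intro norm_nucl_le) (simp add: L)
      moreover have "norm (X i - X (s k)) < (1/2) ^ k"
        using that s_ge[of k] by (intro m) auto
      moreover have "norm (X i - Abs_nucl L) \<le> norm (X i - X (s k)) + norm (Abs_nucl L - X (s k))"
        using norm_triangle_ineq4[of "X i - X (s k)" "Abs_nucl L - X (s k)"] by simp
      ultimately show ?thesis using k by linarith
    qed
    then show "\<exists>M. \<forall>i\<ge>M. norm (X i - Abs_nucl L) < e" by blast
  qed
  then show "convergent X" by (auto simp: convergent_def)
qed

section \<open>Multiplying nuclear operators by bounded ones\<close>

definition lmul :: "cop \<Rightarrow> nucl \<Rightarrow> nucl" where "lmul X Z = Abs_nucl (X * cop_of Z)"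
definition rmul :: "nucl \<Rightarrow> cop \<Rightarrow> nucl" where "rmul Z X = Abs_nucl (cop_of Z * X)"

lemma mul_rep_eqs [simp]: "cop_of (lmul X Z) = X * cop_of Z" "cop_of (rmul Z X) = cop_of Z * X"
  using nuc_cop_of[of Z]
  by (auto simp: lmul_def rmul_def intro!: Abs_nucl_inverse intro: nuc_mult_left nuc_mult_right)

lemma nucl_eqI: "cop_of X = cop_of Y \<Longrightarrow> X = Y"
  by (simp add: cop_of_inject)

lemma norm_lmul_le: "norm (lmul X Z) \<le> norm X * norm Z"
proof (rule field_le_epsilon)
  fix e :: real assume "e > 0"
  define d where "d = e / (norm X + 1)"
  have n: "norm X + 1 > 0" by (simp add: add_nonneg_pos)
  then have d: "d > 0" "norm X * d \<le> e"
    using \<open>e > 0\<close> by (auto simp: d_def field_simps)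
  then have "nuc (cop_of Z) (norm Z + d)" by (intro norm_nucl_less) simp
  then have "nuc (cop_of (lmul X Z)) (norm X * (norm Z + d))" by (simp add: nuc_mult_left)
  then have "norm (lmul X Z) \<le> norm X * (norm Z + d)" by (rule norm_nucl_le)
  then show "norm (lmul X Z) \<le> norm X * norm Z + e" using d by (simp add: algebra_simps)
qed

lemma norm_rmul_le: "norm (rmul Z X) \<le> norm Z * norm X"
proof (rule field_le_epsilon)
  fix e :: real assume "e > 0"
  define d where "d = e / (norm X + 1)"
  have n: "norm X + 1 > 0" by (simp add: add_nonneg_pos)
  then have d: "d > 0" "d * norm X \<le> e"
    using \<open>e > 0\<close> by (auto simp: d_def field_simps)
  then have "nuc (cop_of Z) (norm Z + d)" by (intro norm_nucl_less) simp
  then have "nuc (cop_of (rmul Z X)) ((norm Z + d) * norm X)" by (simp add: nuc_mult_right)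
  then have "norm (rmul Z X) \<le> (norm Z + d) * norm X" by (rule norm_nucl_le)
  then show "norm (rmul Z X) \<le> norm Z * norm X + e" using d by (simp add: algebra_simps)
qed

lemma bounded_bilinear_lmul: "bounded_bilinear lmul"
  by (rule bounded_bilinear.intro)
     (auto simp: algebra_simps norm_lmul_le intro!: nucl_eqI exI[of _ 1])

lemma bounded_bilinear_rmul: "bounded_bilinear rmul"
  by (rule bounded_bilinear.intro)
     (auto simp: algebra_simps norm_rmul_le[unfolded mult.commute[of "norm (_::nucl)"]] intro!: nucl_eqI exI[of _ 1])

lemma norm_tr_nucl_le: "norm (tr (cop_of Z)) \<le> norm Z"
  by (rule norm_nucl_geI) (rule norm_tr_le)

lemma tr_nucl_add: "tr (cop_of X + cop_of Y) = tr (cop_of X) + tr (cop_of Y)"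
  using nuc_cop_of[of X] nuc_cop_of[of Y] tr_add by blast

lemma tr_nucl_diff: "tr (cop_of X - cop_of Y) = tr (cop_of X) - tr (cop_of Y)"
  using nuc_cop_of[of X] nuc_cop_of[of Y] tr_diff by blast

lemma tr_nucl_commute: "tr (X * cop_of Z) = tr (cop_of Z * X)"
  using nuc_cop_of[of Z] tr_mult_commute by blast

lemma bounded_linear_tr: "bounded_linear (\<lambda>Z. tr (cop_of Z))"
  by (rule bounded_linear_intro[of _ 1])
     (use nuc_cop_of tr_scaleR in \<open>auto simp: tr_nucl_add norm_tr_nucl_le\<close>)

lemma nucl_tail_tendsto: "(\<lambda>N. lmul (1 - pr N) Z) \<longlonglongrightarrow> 0"
proof (rule LIMSEQ_I)
  fix e :: real assume "e > 0"
  obtain r where "nuc (cop_of Z) r" using nuc_cop_of by blast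
  then obtain N0 where "\<forall>N\<ge>N0. nuc ((1 - pr N) * cop_of Z) (e/2)"
    using nuc_tail[of "cop_of Z" r "e/2"] \<open>e > 0\<close> by auto
  then have "norm (lmul (1 - pr N) Z) \<le> e / 2" if "N \<ge> N0" for N
    using that by (intro norm_nucl_le) simp
  then show "\<exists>N0. \<forall>N\<ge>N0. norm (lmul (1 - pr N) Z - 0) < e"
    using \<open>e > 0\<close> by (intro exI[of _ N0]) fastforce
qed

text \<open>Contractions that tend to 0 at each point do so uniformly on a compact set, here the
  image of the path: otherwise bad values would accumulate at some \<open>z\<close>, and convergence
  at \<open>z\<close> itself gives a contradiction.\<close>

lemma nucl_tail_uniform:
  fixes \<gamma> :: "real \<Rightarrow> nucl"
  assumes \<gamma>: "continuous_on {0..1} \<gamma>" and e: "e > 0"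
  shows "\<exists>N0. \<forall>N\<ge>N0. \<forall>t\<in>{0..1}. norm (lmul (1 - pr N) (\<gamma> t)) < e"
proof (rule ccontr)
  assume "\<not> ?thesis"
  then have "\<forall>n. \<exists>N t. N \<ge> n \<and> t \<in> {0..1} \<and> norm (lmul (1 - pr N) (\<gamma> t)) \<ge> e"
    by (metis not_less)
  then obtain N t where Nt: "\<And>n. N n \<ge> n" "\<And>n. t n \<in> {0..1}"
    "\<And>n. norm (lmul (1 - pr (N n)) (\<gamma> (t n))) \<ge> e" by metis
  have "seq_compact (\<gamma> ` {0..1})"
    by (intro compact_imp_seq_compact compact_continuous_image \<gamma>) auto
  then obtain z r where r: "strict_mono r" and z: "(\<lambda>n. \<gamma> (t (r n))) \<longlonglongrightarrow> z"
    using Nt(2) seq_compactE[of "\<gamma> ` {0..1}" "\<lambda>n. \<gamma> (t n)"] unfolding o_def by blast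
  have lim: "filterlim (\<lambda>n. N (r n)) sequentially sequentially"
    by (rule filterlim_at_top_mono[OF filterlim_subseq[OF r]]) (use Nt(1) in auto)
  have "(\<lambda>n. norm (\<gamma> (t (r n)) - z) + norm (lmul (1 - pr (N (r n))) z)) \<longlonglongrightarrow> norm (z - z) + norm (0 :: nucl)"
    by (intro tendsto_intros z filterlim_compose[OF nucl_tail_tendsto lim])
  then have "\<forall>\<^sub>F n in sequentially. norm (\<gamma> (t (r n)) - z) + norm (lmul (1 - pr (N (r n))) z) < e"
    using e by (intro order_tendstoD) auto
  then obtain n where n: "norm (\<gamma> (t (r n)) - z) + norm (lmul (1 - pr (N (r n))) z) < e"
    by (auto simp: eventually_sequentially)
  let ?Q = "1 - pr (N (r n))"
  have "lmul ?Q (\<gamma> (t (r n))) = lmul ?Q (\<gamma> (t (r n)) - z) + lmul ?Q z"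
    by (rule nucl_eqI) (simp add: algebra_simps)
  then have "norm (lmul ?Q (\<gamma> (t (r n)))) \<le> norm (lmul ?Q (\<gamma> (t (r n)) - z)) + norm (lmul ?Q z)"
    by (simp add: norm_triangle_ineq)
  moreover have "norm (lmul ?Q (\<gamma> (t (r n)) - z)) \<le> 1 * norm (\<gamma> (t (r n)) - z)"
    by (rule order_trans[OF norm_lmul_le mult_right_mono[OF norm_pr_le(2)]]) simp
  ultimately show False using n Nt(3)[of "r n"] by simp
qed

section \<open>Trace class operators are nuclear\<close>

lemma cinner_add_left: "cinner (x + y) z = cinner x z + cinner y z"
  unfolding cinner_def by (simp add: suminf_add cinner_summable distrib_right)

lemma cinner_commute: "cinner y x = cnj (cinner x y)"
  unfolding cinner_def using bounded_linear.suminf[OF bounded_linear_cnj cinner_summable[of x y]]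
  by (simp add: mult.commute)

lemma cinner_scaleC_left: "cinner (ell2_scaleC c x) y = c * cinner x y"
  unfolding cinner_def using suminf_mult[OF cinner_summable[of x y], of c] by (simp add: mult.assoc)

lemma cinner_add_right: "cinner x (y + z) = cinner x y + cinner x z"
  using cinner_commute[of x "y + z"] cinner_commute[of x y] cinner_commute[of x z]
  by (simp add: cinner_add_left)

lemma cinner_scaleC_right: "cinner x (ell2_scaleC c y) = cnj c * cinner x y"
  using cinner_commute[of x "ell2_scaleC c y"] cinner_commute[of x y] by (simp add: cinner_scaleC_left)

lemma cinner_self: "cinner x x = of_real ((norm x)\<^sup>2)"
proof -
  have "(\<lambda>n. ell2_nth x n * cnj (ell2_nth x n)) = (\<lambda>n. of_real ((cmod (ell2_nth x n))\<^sup>2))"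
    by (simp only: complex_norm_square)
  then show ?thesis unfolding cinner_def ell2_norm_sq
    by (simp add: suminf_of_real[OF ell2_summable_sq])
qed

text \<open>Possibly degenerate positive forms: the locale serves the inner product as well as the
  remainders of a Cholesky decomposition, whose kernels grow with every step.\<close>

locale psd_form =
  fixes h :: "ell2 \<Rightarrow> ell2 \<Rightarrow> complex"
  assumes add_left: "h (x + y) z = h x z + h y z"
    and add_right: "h x (y + z) = h x y + h x z"
    and scale_left: "h (ell2_scaleC c x) y = c * h x y"
    and scale_right: "h x (ell2_scaleC c y) = cnj c * h x y"
    and pos: "h x x \<in> \<real>\<^sub>\<ge>\<^sub>0"
begin

lemma Im_diag: "Im (h x x) = 0" and Re_diag: "0 \<le> Re (h x x)"
  using pos[of x] by (auto simp: complex_nonneg_Reals_iff)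

text \<open>A sesquilinear form that is real on the diagonal is Hermitian; this is seen on x + y and
  x + i y.\<close>

lemma hermitian: "h y x = cnj (h x y)"
proof -
  have "Im (h x y + h y x) = 0"
    using Im_diag[of "x + y"] Im_diag[of x] Im_diag[of y] by (simp add: add_left add_right)
  moreover have "Im (\<i> * h y x - \<i> * h x y) = 0"
    using Im_diag[of "x + ell2_scaleC \<i> y"] Im_diag[of x] Im_diag[of y]
    by (simp add: add_left add_right scale_left scale_right)
  ultimately show ?thesis by (intro complex_eqI) auto
qed

lemma cauchy_schwarz: "(cmod (h x y))\<^sup>2 \<le> Re (h x x) * Re (h y y)"
proof -
  have *: "0 \<le> Re (h x x) - 2 * Re (cnj c * h x y) + (cmod c)\<^sup>2 * Re (h y y)" for c
  proof -
    have "h (x + ell2_scaleC (- c) y) (x + ell2_scaleC (- c) y)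
        = h x x - cnj c * h x y - c * h y x + c * cnj c * h y y"
      by (simp add: add_left add_right scale_left scale_right algebra_simps)
    then have "Re (h (x + ell2_scaleC (- c) y) (x + ell2_scaleC (- c) y))
        = Re (h x x) - Re (cnj c * h x y) - Re (c * h y x) + Re (c * cnj c * h y y)"
      by (simp only: minus_complex.sel plus_complex.sel)
    moreover have "c * h y x = cnj (cnj c * h x y)" using hermitian[of y x] by simp
    then have "Re (c * h y x) = Re (cnj c * h x y)" by (simp only: cnj.sel)
    moreover have "Re (c * cnj c * h y y) = (cmod c)\<^sup>2 * Re (h y y)"
      unfolding complex_norm_square[symmetric] by simp
    ultimately show ?thesis
      using Re_diag[of "x + ell2_scaleC (- c) y"] by linarith
  qed
  show ?thesis
  proof (cases "Re (h y y) = 0")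
    case True
    have "h x y = 0"
    proof (rule ccontr)
      assume nz: "h x y \<noteq> 0"
      \<comment> \<open>As \<open>h y y\<close> has real part 0, the quadratic expression is affine
        in \<open>t\<close>; this choice gives it the value -1.\<close>
      define t where "t = (Re (h x x) + 1) / (2 * (cmod (h x y))\<^sup>2)"
      have "Re (cnj (of_real t * h x y) * h x y) = t * (cmod (h x y))\<^sup>2"
        unfolding cmod_power2 by (simp add: power2_eq_square algebra_simps)
      then show False using *[of "of_real t * h x y"] nz True by (simp add: t_def field_simps)
    qed
    then show ?thesis using True by simp
  next
    case False
    then have p: "Re (h y y) > 0" using Re_diag[of y] by simp
    \<comment> \<open>The minimiser of the quadratic expression in \<open>c\<close>.\<close>
    define c where "c = h x y / of_real (Re (h y y))"
    have "Re (cnj c * h x y) = (cmod (h x y))\<^sup>2 / Re (h y y)"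
      unfolding cmod_power2 using p by (simp add: c_def power2_eq_square field_simps)
    moreover have "(cmod c)\<^sup>2 * Re (h y y) = (cmod (h x y))\<^sup>2 / Re (h y y)"
      using p by (simp add: c_def norm_divide power_divide power2_eq_square)
    ultimately have "(cmod (h x y))\<^sup>2 / Re (h y y) \<le> Re (h x x)"
      using *[of c] by simp
    then show ?thesis using p by (simp add: field_simps)
  qed
qed

end

lemma cinner_norm_le: "cmod (cinner x y) \<le> norm x * norm y"
proof -
  interpret psd_form cinner
    by standard (simp_all add: cinner_add_left cinner_add_right cinner_scaleC_left
        cinner_scaleC_right cinner_self)
  have "(cmod (cinner x y))\<^sup>2 \<le> (norm x * norm y)\<^sup>2"
    using cauchy_schwarz[of x y] by (simp add: cinner_self power_mult_distrib)
  then show ?thesis by (simp add: power2_le_iff_abs_le)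
qed

lemma cinner_diff_left: "cinner (x - y) z = cinner x z - cinner y z"
  using cinner_add_left[of "x - y" y z] by simp

lemma bounded_linear_cinner: "bounded_linear (\<lambda>x. cinner x v)"
proof (rule bounded_linear_intro[of _ "norm v"])
  show "cinner (r *\<^sub>R x) v = r *\<^sub>R cinner x v" for r x
    using cinner_scaleC_left[of "of_real r" x v] by (simp add: ell2_scaleC_of_real scaleR_conv_of_real)
qed (simp_all add: cinner_add_left cinner_norm_le)

text \<open>Cholesky decomposition of a positive operator: the step at \<open>k\<close> subtracts the rank one
  operator that annihilates the \<open>k\<close>-th row and column of the remainder. A zero pivot means a zero
  row, and then division by \<open>0\<close> yields the required vector \<open>0\<close>.\<close>

definition chol_step :: "(ell2 \<Rightarrow> ell2) \<Rightarrow> nat \<Rightarrow> ell2"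
  where "chol_step Q k = (1 / sqrt (Re (ell2_nth (Q (ell2_unit k)) k))) *\<^sub>R Q (ell2_unit k)"

primrec chol_rem :: "(ell2 \<Rightarrow> ell2) \<Rightarrow> nat \<Rightarrow> ell2 \<Rightarrow> ell2" where
  "chol_rem P 0 = P"
| "chol_rem P (Suc k) = (\<lambda>x. chol_rem P k x -
    ell2_scaleC (cinner x (chol_step (chol_rem P k) k)) (chol_step (chol_rem P k) k))"

lemma cinner_scaleR_left: "cinner (r *\<^sub>R x) y = of_real r * cinner x y"
  using cinner_scaleC_left[of "of_real r" x y] by (simp add: ell2_scaleC_of_real)

text \<open>Put p = (Q e_k, e_k). For p > 0 one has (x, v) = (Q x, e_k) / sqrt p, so Cauchy-Schwarz
  for the form of \<open>Q\<close> bounds |(x, v)|^2 by (Q x, x), and this bound is the positivity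
  of the remainder. The last claim ensures that rows eliminated earlier stay eliminated.\<close>

lemma
  fixes Q :: "ell2 \<Rightarrow> ell2" and k :: nat
  defines "v \<equiv> chol_step Q k"
  assumes psd: "psd_form (\<lambda>x y. cinner (Q x) y)"
  shows chol_step_bound: "(cmod (cinner x v))\<^sup>2 \<le> Re (cinner (Q x) x)"
    and chol_step_psd: "psd_form (\<lambda>x y. cinner (Q x - ell2_scaleC (cinner x v) v) y)"
    and chol_step_annihilates: "Q (ell2_unit k) - ell2_scaleC (cinner (ell2_unit k) v) v = 0"
    and chol_step_kernel: "Q (ell2_unit j) = 0 \<Longrightarrow> cinner (ell2_unit j) v = 0"
proof -
  interpret h: psd_form "\<lambda>x y. cinner (Q x) y" by (rule psd)
  let ?e = "ell2_unit k"
  define p where "p = Re (cinner (Q ?e) ?e)"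
  have p0: "0 \<le> p" unfolding p_def by (rule h.Re_diag)
  have v: "v = (1 / sqrt p) *\<^sub>R Q ?e" by (simp add: v_def chol_step_def p_def cinner_unit)
  have cv: "cinner v y = of_real (1 / sqrt p) * cinner (Q ?e) y" for y
    by (simp add: v cinner_scaleR_left)
  have vc: "cinner y v = of_real (1 / sqrt p) * cinner (Q y) ?e" for y
    using cinner_commute[of y v] h.hermitian[of y ?e] by (simp add: cv)
  show bound: "(cmod (cinner x v))\<^sup>2 \<le> Re (cinner (Q x) x)" for x
  proof (cases "p = 0")
    case True then show ?thesis using h.Re_diag[of x] by (simp add: vc)
  next
    case False
    then have "p > 0" using p0 by simp
    have "(cmod (cinner x v))\<^sup>2 = (cmod (cinner (Q x) ?e))\<^sup>2 / p"
      using p0 by (simp add: vc norm_mult power_mult_distrib norm_divide power_divide)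
    also have "\<dots> \<le> Re (cinner (Q x) x)"
      using h.cauchy_schwarz[of x ?e] \<open>p > 0\<close> by (simp add: p_def field_simps)
    finally show ?thesis .
  qed
  have form: "cinner (Q x - ell2_scaleC (cinner x v) v) y = cinner (Q x) y - cinner x v * cnj (cinner y v)" for x y
    using cinner_commute[of v y] by (simp add: cinner_diff_left cinner_scaleC_left)
  show "psd_form (\<lambda>x y. cinner (Q x - ell2_scaleC (cinner x v) v) y)"
    unfolding form
  proof
    show "cinner (Q x) x - cinner x v * cnj (cinner x v) \<in> \<real>\<^sub>\<ge>\<^sub>0" for x
      using bound[of x] h.Im_diag[of x] complex_norm_square[of "cinner x v"]
      by (auto simp: complex_nonneg_Reals_iff simp flip: complex_norm_square)
  qed (simp_all add: h.add_left h.add_right h.scale_left h.scale_right cinner_add_left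
      cinner_scaleC_left algebra_simps)
  have cqe: "cinner (Q ?e) ?e = of_real p"
    using h.Im_diag[of ?e] by (simp add: p_def complex_eq_iff)
  show "Q ?e - ell2_scaleC (cinner ?e v) v = 0"
  proof (cases "p = 0")
    case True
    have "cinner (Q ?e) y = 0" for y
      using h.cauchy_schwarz[of ?e y] True by (simp add: p_def)
    then have "(norm (Q ?e))\<^sup>2 = 0" using cinner_self[of "Q ?e"] by (metis of_real_eq_0_iff)
    then show ?thesis by (simp add: v)
  next
    case False
    have "ell2_scaleC (cinner ?e v) v = (1 / sqrt p * p * (1 / sqrt p)) *\<^sub>R Q ?e"
      unfolding vc cqe unfolding v ell2_scaleC_of_real[symmetric] ell2_scaleC_assoc of_real_mult ..
    also have "1 / sqrt p * p * (1 / sqrt p) = 1"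
      using False p0 by (simp add: field_simps)
    finally show ?thesis by simp
  qed
  show "cinner (ell2_unit j) v = 0" if "Q (ell2_unit j) = 0"
    unfolding vc that by (simp add: cinner_def)
qed

text \<open>The Cholesky vectors v_k of the modulus P satisfy P x = sum of (x, v_k) v_k, and the sum
  of ||v_k||^2 is at most the trace of P. With v_k = P f_k and u_k = A f_k, the equality of ||A x||
  and ||P x|| yields ||u_k|| = ||v_k|| and the representation A x = sum of (x, v_k) u_k.\<close>

lemma trace_class_nuc:
  assumes "trace_class A"
  obtains Z r where "rop Z = A" "nuc Z r"
proof -
  define P where "P = modulus A"
  have clA: "clinear_op A" and "is_modulus A P" and sm: "summable (\<lambda>n. Re (op_entry P n n))"
    using assms by (auto simp: trace_class_def P_def)
  then have clP: "clinear_op P" and posP: "\<And>x. cinner (P x) x \<in> \<real>\<^sub>\<ge>\<^sub>0"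
    and PA: "\<And>x y. cinner (P x) (P y) = cinner (A x) (A y)"
    by (auto simp: is_modulus_def)
  have nPA: "norm (P x) = norm (A x)" for x
    using PA[of x x] by (simp add: cinner_self power2_eq_iff_nonneg flip: of_real_power)
  define Q where "Q = chol_rem (blinfun_apply P)"
  define v where "v k = chol_step (Q k) k" for k
  have Q0: "Q 0 x = P x" for x by (simp add: Q_def)
  have QSuc: "Q (Suc k) x = Q k x - ell2_scaleC (cinner x (v k)) (v k)" for k x
    by (simp add: Q_def v_def)
  have psd: "psd_form (\<lambda>x y. cinner (Q k x) y)" for k
  proof (induction k)
    case 0 show ?case
      by standard (use clP posP in \<open>simp_all add: Q0 cinner_add_left cinner_add_right blinfun.add_right
          cinner_scaleC_left cinner_scaleC_right clinear_op_def\<close>)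
  next
    case (Suc k) show ?case unfolding QSuc v_def by (rule chol_step_psd[OF Suc])
  qed
  have ann: "Q n (ell2_unit j) = 0" if "j < n" for n j
    using that
  proof (induction n)
    case (Suc n)
    show ?case
    proof (cases "j = n")
      case True
      then show ?thesis unfolding QSuc v_def by (simp only: chol_step_annihilates[OF psd])
    next
      case False
      then have "Q n (ell2_unit j) = 0" using Suc by simp
      then show ?thesis using chol_step_kernel[OF psd, of n j n] by (simp add: QSuc v_def)
    qed
  qed simp
  \<comment> \<open>The remainders stay in the range of \<open>P\<close>, hence so do the Cholesky
    vectors; their preimages \<open>f k\<close> carry the decomposition over from \<open>P\<close>
    to \<open>A\<close>.\<close>
  have "\<forall>x. \<exists>g. Q k x = P g" for k
  proof (induction k)
    case (Suc k)
    then obtain g where g: "v k = P g"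
      unfolding v_def chol_step_def by (metis blinfun.scaleR_right)
    show ?case
    proof
      fix x
      obtain f where "Q k x = P f" using Suc by blast
      then have "Q (Suc k) x = P (f - ell2_scaleC (cinner x (v k)) g)"
        using clP by (simp add: QSuc g clinear_op_def blinfun.diff_right)
      then show "\<exists>g. Q (Suc k) x = P g" by blast
    qed
  qed (use Q0 in blast)
  then have "\<exists>g. v k = P g" for k
    unfolding v_def chol_step_def by (metis blinfun.scaleR_right)
  then obtain f where f: "\<And>k. v k = P (f k)" by metis
  have Qsum: "Q n x = P x - (\<Sum>k<n. ell2_scaleC (cinner x (v k)) (v k))" for n x
    by (induction n) (simp_all add: Q0 QSuc)
  define T where "T = (\<Sum>n. Re (op_entry P n n))"
  \<comment> \<open>Positivity of the remainder at the \<open>j\<close>-th unit vector bounds the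
    sum over k of the squared \<open>j\<close>-th coordinates by the diagonal entry of
    \<open>P\<close>; summing over \<open>j\<close> gives the trace.\<close>
  have vT: "(\<Sum>k<n. (norm (v k))\<^sup>2) \<le> T" for n
  proof (rule LIMSEQ_le_const2)
    show "(\<lambda>N. \<Sum>k<n. \<Sum>j<N. (cmod (ell2_nth (v k) j))\<^sup>2) \<longlonglongrightarrow> (\<Sum>k<n. (norm (v k))\<^sup>2)"
      unfolding ell2_norm_sq by (intro tendsto_sum summable_LIMSEQ ell2_summable_sq)
    have "(\<Sum>k<n. (cmod (ell2_nth (v k) j))\<^sup>2) \<le> Re (op_entry P j j)" for j
    proof -
      let ?e = "ell2_unit j"
      have "Re (cinner (Q n ?e) ?e) = Re (op_entry P j j) - (\<Sum>k<n. (cmod (ell2_nth (v k) j))\<^sup>2)"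
      proof -
        have c: "cinner ?e (v k) = cnj (ell2_nth (v k) j)" for k
          using cinner_commute[of ?e "v k"] by (simp add: cinner_unit)
        have "cinner (Q n ?e) ?e = op_entry P j j - (\<Sum>k<n. cnj (ell2_nth (v k) j) * ell2_nth (v k) j)"
          unfolding cinner_unit Qsum op_entry_nth
          by (simp add: linear_sum[OF bounded_linear.linear[OF bounded_linear_ell2_nth]] c)
        also have "(\<Sum>k<n. cnj (ell2_nth (v k) j) * ell2_nth (v k) j) = of_real (\<Sum>k<n. (cmod (ell2_nth (v k) j))\<^sup>2)"
          unfolding of_real_sum complex_norm_square by (simp add: mult.commute)
        finally show ?thesis by simp
      qed
      moreover have "0 \<le> Re (cinner (Q n ?e) ?e)" by (rule psd_form.Re_diag[OF psd])
      ultimately show ?thesis by simp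
    qed
    note le = this
    have "(\<Sum>k<n. \<Sum>j<N. (cmod (ell2_nth (v k) j))\<^sup>2) \<le> T" for N
    proof -
      have "(\<Sum>k<n. \<Sum>j<N. (cmod (ell2_nth (v k) j))\<^sup>2) = (\<Sum>j<N. \<Sum>k<n. (cmod (ell2_nth (v k) j))\<^sup>2)"
        by (rule sum.swap)
      also have "\<dots> \<le> (\<Sum>j<N. Re (op_entry P j j))" by (rule sum_mono[OF le])
      also have "\<dots> \<le> T" unfolding T_def
        by (rule sum_le_suminf[OF sm]) (auto intro: order_trans[OF sum_nonneg le])
      finally show ?thesis .
    qed
    then show "\<exists>N0. \<forall>N\<ge>N0. (\<Sum>k<n. \<Sum>j<N. (cmod (ell2_nth (v k) j))\<^sup>2) \<le> T" by blast
  qed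
  then have vsm: "summable (\<lambda>k. (norm (v k))\<^sup>2)"
    by (intro summableI_nonneg_bounded) auto
  have Qb: "norm (Q n x) \<le> (norm P + T) * norm x" for n x
  proof -
    have "norm (\<Sum>k<n. ell2_scaleC (cinner x (v k)) (v k)) \<le> (\<Sum>k<n. (norm (v k))\<^sup>2 * norm x)"
    proof (rule sum_norm_le)
      fix k
      show "norm (ell2_scaleC (cinner x (v k)) (v k)) \<le> (norm (v k))\<^sup>2 * norm x"
        using mult_right_mono[OF cinner_norm_le[of x "v k"] norm_ge_zero[of "v k"]]
        by (simp add: ell2_norm_scaleC power2_eq_square mult_ac)
    qed
    also have "\<dots> \<le> T * norm x"
      unfolding sum_distrib_right[symmetric] by (intro mult_right_mono vT) simp
    finally show ?thesis
      using norm_triangle_ineq4[of "P x" "\<Sum>k<n. ell2_scaleC (cinner x (v k)) (v k)"] norm_blinfun[of P x]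
      unfolding Qsum by (simp add: algebra_simps)
  qed
  have Qlin: "Q n (x - y) = Q n x - Q n y" "Q n (ell2_scaleC c x) = ell2_scaleC c (Q n x)" for n x y c
    using clP by (simp_all add: Qsum blinfun.diff_right cinner_diff_left cinner_scaleC_left clinear_op_def
      ell2_scaleC_diff_right linear_sum[OF bounded_linear.linear[OF
        bounded_bilinear.bounded_linear_right[OF bounded_bilinear_ell2_scaleC]]] ell2_scaleC_assoc
      algebra_simps sum_subtractf
      bounded_bilinear.diff_left[OF bounded_bilinear_ell2_scaleC])
  \<comment> \<open>\<open>Q n\<close> annihilates the first \<open>n\<close> unit vectors, and all
    \<open>Q n\<close> share one bound, so convergence extends from finitely supported vectors to
    all \<open>x\<close>.\<close>
  have Q_lim: "(\<lambda>n. Q n x) \<longlonglongrightarrow> 0" for x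
  proof (rule LIMSEQ_I)
    fix e :: real assume e: "e > 0"
    define C where "C = norm P + T + 1"
    have T0: "0 \<le> T" using vT[of 0] by simp
    then have "C > 0" by (simp add: C_def add_nonneg_pos)
    have "\<forall>\<^sub>F N in sequentially. dist (ell2_pr N x) x < e / C"
      using ell2_pr_tendsto[of x] e \<open>C > 0\<close> by (intro tendstoD) auto
    then obtain N where N: "norm (x - ell2_pr N x) < e / C"
      by (auto simp: eventually_sequentially dist_norm norm_minus_commute)
    have "norm (Q n x) < e" if n: "n \<ge> N" for n
    proof -
      have "Q n (ell2_pr M x) = 0" if "M \<le> n" for M using that
      proof (induction M)
        case 0
        have "ell2_pr 0 x = ell2_scaleC 0 x" by (rule ell2_eqI) simp
        then show ?case by (simp only: Qlin) simp
      next
        case (Suc M)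
        have "ell2_pr (Suc M) x = ell2_pr M x - ell2_scaleC (- ell2_nth x M) (ell2_unit M)"
          by (rule ell2_eqI) (auto simp: less_Suc_eq)
        then show ?case using Suc ann[of M n] by (simp add: Qlin)
      qed
      from this[OF n] have "Q n x = Q n (x - ell2_pr N x)" by (simp add: Qlin)
      then have "norm (Q n x) \<le> (norm P + T) * norm (x - ell2_pr N x)" using Qb by simp
      also have "\<dots> \<le> C * norm (x - ell2_pr N x)" by (intro mult_right_mono) (simp_all add: C_def)
      also have "\<dots> < e" using N \<open>C > 0\<close> by (simp add: field_simps)
      finally show ?thesis .
    qed
    then show "\<exists>N. \<forall>n\<ge>N. norm (Q n x - 0) < e" by auto
  qed
  define u where "u k = A (f k)" for k
  have nu: "norm (u k) = norm (v k)" for k by (simp add: u_def f nPA)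
  have A_sums: "(\<lambda>k. ell2_scaleC (cinner x (v k)) (u k)) sums A x" for x
  proof -
    \<comment> \<open>\<open>P (y n)\<close> is the Cholesky remainder at \<open>x\<close> and tends
      to 0. Since \<open>A\<close> and \<open>P\<close> have equal norms on every vector,
      \<open>A (y n)\<close>, the remainder of the series for \<open>A x\<close>, tends to 0
      too.\<close>
    define y where "y n = x - (\<Sum>k<n. ell2_scaleC (cinner x (v k)) (f k))" for n
    have "P (y n) = Q n x" for n
      using clP by (simp add: y_def Qsum blinfun.diff_right blinfun.sum_right clinear_op_def f)
    then have "(\<lambda>n. norm (A (y n))) \<longlonglongrightarrow> 0"
      using tendsto_norm_zero[OF Q_lim[of x]] by (simp flip: nPA)
    then have "(\<lambda>n. A (y n)) \<longlonglongrightarrow> 0" by (rule tendsto_norm_zero_cancel)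
    then have "(\<lambda>n. A x - A (y n)) \<longlonglongrightarrow> A x - 0" by (intro tendsto_diff tendsto_const)
    moreover have "A x - A (y n) = (\<Sum>k<n. ell2_scaleC (cinner x (v k)) (u k))" for n
      using clA by (simp add: y_def u_def blinfun.diff_right blinfun.sum_right clinear_op_def)
    ultimately show ?thesis by (simp add: sums_def)
  qed
  define \<phi> where "\<phi> k = Blinfun (\<lambda>x. cinner x (v k))" for k
  have \<phi>: "\<phi> k x = cinner x (v k)" for k x
    by (simp add: \<phi>_def bounded_linear_Blinfun_apply bounded_linear_cinner)
  have n\<phi>: "norm (\<phi> k) \<le> norm (v k)" for k
    by (rule norm_blinfun_bound) (auto simp: \<phi> cinner_norm_le mult.commute)
  have sm': "summable (\<lambda>k. norm (\<phi> k) * norm (u k))"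
    by (rule summable_comparison_test'[OF vsm])
       (use n\<phi> nu in \<open>auto simp: power2_eq_square intro!: mult_mono\<close>)
  have ZA: "rop (Abs_cop A) = A" using clA by (simp add: Abs_cop_inverse)
  have "nuc_rep u \<phi> (Abs_cop A) (\<Sum>k. norm (\<phi> k) * norm (u k))"
    unfolding nuc_rep_def using sm' A_sums
    by (auto simp: clin_def \<phi> cinner_scaleC_left ZA)
  then show thesis using that[OF ZA] unfolding nuc_def by blast
qed

section \<open>Determinants of finite sections\<close>

definition sec :: "nat \<Rightarrow> cop \<Rightarrow> complex mat"
  where "sec N X = Matrix.mat N N (\<lambda>(j, k). ent X j k)"

lemma sec_carrier [simp]: "sec N X \<in> carrier_mat N N"
  by (simp add: sec_def)

lemma section_det_rop: "section_det N (rop X) = Determinant.det (sec N X)"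
  by (simp add: section_det_def sec_def op_entry_rop)

lemma sec_eqI: "(\<And>j k. j < N \<Longrightarrow> k < N \<Longrightarrow> ent X j k = ent Y j k) \<Longrightarrow> sec N X = sec N Y"
  unfolding sec_def by (rule eq_matI) auto

text \<open>The hypothesis says that no path from \<open>j\<close> to \<open>k\<close> leaves the
  corner. It holds when the left factor is lower triangular, when the right factor is upper
  triangular, or when a projection stands in between.\<close>

lemma sec_mult:
  assumes "\<And>j k l. j < N \<Longrightarrow> k < N \<Longrightarrow> l \<ge> N \<Longrightarrow> ent X j l * ent Y l k = 0"
  shows "sec N (X * Y) = sec N X * sec N Y"
proof (rule eq_matI)
  fix j k assume "j < dim_row (sec N X * sec N Y)" "k < dim_col (sec N X * sec N Y)"
  then have jk: "j < N" "k < N" by (simp_all add: sec_def)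
  have "(\<lambda>l. ent X j l * ent Y l k) sums (\<Sum>l<N. ent X j l * ent Y l k)"
    by (rule sums_finite) (use assms jk in \<open>auto simp: not_less\<close>)
  then have "ent (X * Y) j k = (\<Sum>l<N. ent X j l * ent Y l k)"
    using ent_mult_sums[of X j Y k] sums_unique2 by blast
  then show "sec N (X * Y) $$ (j, k) = (sec N X * sec N Y) $$ (j, k)"
    using jk by (simp add: sec_def scalar_prod_def lessThan_atLeast0)
qed (simp_all add: sec_def)

lemma sec_mult_pr: "sec N (X * (pr N * Y)) = sec N X * sec N Y"
proof -
  have "sec N (X * (pr N * Y)) = sec N X * sec N (pr N * Y)"
    by (rule sec_mult) (simp add: ent_pr_left)
  also have "sec N (pr N * Y) = sec N Y" by (rule sec_eqI) (simp add: ent_pr_left)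
  finally show ?thesis .
qed

lemma det_sec_mult:
  assumes "\<And>j k l. j < N \<Longrightarrow> k < N \<Longrightarrow> l \<ge> N \<Longrightarrow> ent X j l * ent Y l k = 0"
  shows "Determinant.det (sec N (X * Y)) = Determinant.det (sec N X) * Determinant.det (sec N Y)"
  using sec_mult[OF assms] by (simp add: det_mult[of _ N])

text \<open>Only the identity permutation contributes to the derivative of the determinant at the
  identity: any other one moves at least two points.\<close>

lemma det_deriv_id:
  fixes m :: "nat \<Rightarrow> nat \<Rightarrow> real \<Rightarrow> complex"
  assumes d: "\<And>i j. i < N \<Longrightarrow> j < N \<Longrightarrow> (m i j has_vector_derivative m' i j) (at t within T)"
    and id: "\<And>i j. i < N \<Longrightarrow> j < N \<Longrightarrow> m i j t = (if i = j then 1 else 0)"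
  shows "((\<lambda>s. Determinant.det (Matrix.mat N N (\<lambda>(i, j). m i j s))) has_vector_derivative
    (\<Sum>i<N. m' i i)) (at t within T)"
proof -
  let ?U = "{0..<N}"
  let ?PU = "{p. p permutes ?U}"
  have fin: "finite ?PU" by (rule finite_permutations) simp
  have det: "Determinant.det (Matrix.mat N N (\<lambda>(i, j). m i j s))
      = (\<Sum>p\<in>?PU. signof p * (\<Prod>i\<in>?U. m i (p i) s))" for s
    by (subst det_def'[of _ N])
       (auto intro!: sum.cong prod.cong dest: permutes_in_image)
  have p_lt: "p i < N" if "p \<in> ?PU" "i < N" for p i
    using that permutes_in_image[of p ?U i] by auto
  have dp: "((\<lambda>s. \<Prod>i\<in>?U. m i (p i) s) has_vector_derivative
      (\<Sum>i\<in>?U. m' i (p i) * (\<Prod>j\<in>?U - {i}. m j (p j) t))) (at t within T)" if "p \<in> ?PU" for p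
  proof -
    have "((\<lambda>s. \<Prod>i\<in>?U. m i (p i) s) has_derivative
      (\<lambda>y. \<Sum>i\<in>?U. (y *\<^sub>R m' i (p i)) * (\<Prod>j\<in>?U - {i}. m j (p j) t))) (at t within T)"
      using d p_lt[OF that] by (intro has_derivative_prod) (auto simp: has_vector_derivative_def)
    then show ?thesis by (simp add: has_vector_derivative_def scaleR_sum_right)
  qed
  have val: "(\<Sum>i\<in>?U. m' i (p i) * (\<Prod>j\<in>?U - {i}. m j (p j) t)) = (if p = id then \<Sum>i<N. m' i i else 0)"
    if p: "p \<in> ?PU" for p
  proof (cases "p = id")
    case True
    have "(\<Prod>j\<in>?U - {i}. m j j t) = 1" for i by (rule prod.neutral) (use id in auto)
    then show ?thesis using True by (simp add: lessThan_atLeast0)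
  next
    case False
    then obtain a where a: "p a \<noteq> a" by (auto simp: fun_eq_iff)
    have inj: "inj p" and pU: "\<And>x. x \<notin> ?U \<Longrightarrow> p x = x"
      using p permutes_inj by (auto simp: permutes_def)
    have aU: "a \<in> ?U" "p a \<in> ?U" using a pU p_lt[OF p, of a] by auto
    have pa: "p (p a) \<noteq> p a" using a inj by (auto dest: injD)
    have z: "(\<Prod>j\<in>?U - {i}. m j (p j) t) = 0" for i
    proof -
      obtain j where j: "j \<in> ?U - {i}" "p j \<noteq> j"
      proof (cases "i = a")
        case True then show thesis using that[of "p a"] aU a pa by auto
      next
        case False then show thesis using that[of a] aU a by auto
      qed
      then have "m j (p j) t = 0" using id[of j "p j"] p_lt[OF p, of j] by auto
      then show ?thesis using j by (intro prod_zero) auto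
    qed
    show ?thesis unfolding z using False by simp
  qed
  have "((\<lambda>s. \<Sum>p\<in>?PU. signof p * (\<Prod>i\<in>?U. m i (p i) s)) has_vector_derivative
      (\<Sum>p\<in>?PU. signof p * (if p = id then \<Sum>i<N. m' i i else 0))) (at t within T)"
    by (intro has_vector_derivative_sum has_vector_derivative_mult_right) (use dp val in force)
  also have "(\<Sum>p\<in>?PU. signof p * (if p = id then \<Sum>i<N. m' i i else 0))
      = (\<Sum>p\<in>?PU. if p = id then \<Sum>i<N. m' i i else (0::complex))"
    by (rule sum.cong) auto
  also have "\<dots> = (\<Sum>i<N. m' i i)"
    using fin by (simp add: permutes_id)
  finally show ?thesis unfolding det .
qed

lemma neumann_inverse:
  fixes Z :: cop
  assumes "norm Z \<le> 1/2"
  obtains W where "(1 - Z) * W = 1" "W * (1 - Z) = 1" "norm W \<le> 2"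
proof
  define W where "W = (\<Sum>n. Z ^ n)"
  have sm: "summable (\<lambda>n. Z ^ n)" by (rule complete_algebra_summable_geometric) (use assms in simp)
  have s: "(\<Sum>n. Z ^ Suc n) = W - 1" using suminf_split_head[OF sm] by (simp add: W_def)
  have "Z * W = (\<Sum>n. Z ^ Suc n)" unfolding W_def power_Suc by (rule suminf_mult[OF sm, symmetric])
  then have "Z * W = W - 1" by (simp only: s)
  then show "(1 - Z) * W = 1" by (simp add: left_diff_distrib)
  have "W * Z = (\<Sum>n. Z ^ Suc n)" unfolding W_def power_Suc2 by (rule suminf_mult2[OF sm])
  then have "W * Z = W - 1" by (simp only: s)
  then show "W * (1 - Z) = 1" by (simp add: right_diff_distrib)
  have geo: "summable (\<lambda>n. (1/2::real) ^ n)" by simp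
  have le: "norm (Z ^ n) \<le> (1/2) ^ n" for n
    by (rule order_trans[OF norm_power_ineq power_mono]) (use assms in auto)
  have "norm W \<le> (\<Sum>n. (1/2::real) ^ n)" unfolding W_def
    by (rule order_trans[OF summable_norm suminf_le])
       (use le geo in \<open>auto intro: summable_comparison_test'[OF geo]\<close>)
  then show "norm W \<le> 2" using suminf_geometric[of "1/2::real"] by simp
qed

text \<open>A maximum point \<open>s\<close> of |y| does the work of Gronwall's inequality: the mean
  value bound gives |y(s)| <= 1 + \<epsilon> |y(s)|, hence |y| <= 2 as \<epsilon> <= 1/2, and the
  same bound at 1 yields the claim.\<close>

lemma almost_constant:
  fixes y w :: "real \<Rightarrow> complex"
  assumes y: "\<And>t. t \<in> {0..1} \<Longrightarrow> (y has_vector_derivative w t * y t) (at t within {0..1})"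
    and w: "\<And>t. t \<in> {0..1} \<Longrightarrow> cmod (w t) \<le> \<epsilon>" and \<epsilon>: "\<epsilon> \<le> 1/2" and y0: "y 0 = 1"
  shows "cmod (y 1 - 1) \<le> 2 * \<epsilon>"
proof -
  have e0: "0 \<le> \<epsilon>" by (rule order_trans[OF norm_ge_zero w[of 0]]) simp
  have "continuous_on {0..1} y"
    unfolding continuous_on_eq_continuous_within by (blast intro: has_vector_derivative_continuous[OF y])
  then have "continuous_on {0..1} (\<lambda>t. cmod (y t))" by (intro continuous_intros)
  then have "\<exists>s\<in>{0..1}. \<forall>t\<in>{0..1}. cmod (y t) \<le> cmod (y s)"
    by (intro continuous_attains_sup) auto
  then obtain s where s: "s \<in> {0..1}" "\<And>t. t \<in> {0..1} \<Longrightarrow> cmod (y t) \<le> cmod (y s)"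
    by blast
  have est: "cmod (y t - y 0) \<le> \<epsilon> * cmod (y s)" if t: "t \<in> {0..1}" for t
  proof -
    have "cmod (y t - y 0) \<le> \<epsilon> * cmod (y s) * norm (t - 0)"
    proof (rule differentiable_bound[of "{0..1}" y "\<lambda>t h. h *\<^sub>R (w t * y t)"])
      fix x :: real assume x: "x \<in> {0..1}"
      show "(y has_derivative (\<lambda>h. h *\<^sub>R (w x * y x))) (at x within {0..1})"
        using y[OF x] by (simp add: has_vector_derivative_def)
      show "onorm (\<lambda>h. h *\<^sub>R (w x * y x)) \<le> \<epsilon> * cmod (y s)"
      proof (rule onorm_bound)
        fix h :: real
        have "cmod (w x) * cmod (y x) \<le> \<epsilon> * cmod (y s)"
          by (intro mult_mono w x s e0) simp
        then show "norm (h *\<^sub>R (w x * y x)) \<le> \<epsilon> * cmod (y s) * norm h"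
          by (simp add: norm_mult mult_left_mono mult.commute[of "\<epsilon> * _"])
      qed (use e0 in simp)
    qed (use t in auto)
    also have "\<dots> \<le> \<epsilon> * cmod (y s) * 1" using t e0 by (intro mult_left_mono) auto
    finally show ?thesis by simp
  qed
  have "cmod (y s) \<le> 1 + cmod (y s - y 0)"
    using norm_triangle_ineq[of 1 "y s - y 0"] y0 by simp
  then have "cmod (y s) \<le> 1 + \<epsilon> * cmod (y s)" using est[OF s(1)] by linarith
  moreover have "\<epsilon> * cmod (y s) \<le> 1/2 * cmod (y s)" by (intro mult_right_mono \<epsilon>) simp
  ultimately have "cmod (y s) \<le> 2" by linarith
  then have "\<epsilon> * cmod (y s) \<le> \<epsilon> * 2" using e0 by (intro mult_left_mono)
  then show ?thesis using est[of 1] y0 by simp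
qed

lemma tr_cop_of_diff: "tr (cop_of (X - Y)) = tr (cop_of X) - tr (cop_of Y)"
  by (simp add: tr_nucl_diff)

text \<open>The determinant limit along a path \<open>B\<close> with nuclear logarithmic derivative \<open>V\<close>. Since \<open>B - 1\<close>
  is nuclear, \<open>1 + P\<^sub>N (B - 1) = B - (1 - P\<^sub>N) (B - 1)\<close> is invertible for large \<open>N\<close>, uniformly along
  the path; with its inverse \<open>X\<close> the logarithmic derivative of the section determinant is
  \<open>tr (P\<^sub>N X P\<^sub>N B V) = tr (P\<^sub>N V) - tr (P\<^sub>N X (1 - P\<^sub>N) V)\<close>.\<close>

lemma det_sec_path_limit:
  fixes B :: "real \<Rightarrow> cop" and V :: "real \<Rightarrow> nucl" and \<alpha> \<beta> :: complex
  assumes B: "\<And>t. t \<in> {0..1} \<Longrightarrow> (B has_vector_derivative B t * cop_of (V t)) (at t within {0..1})"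
    and B0: "B 0 = 1" and V: "continuous_on {0..1} V"
    and inv: "\<And>t. t \<in> {0..1} \<Longrightarrow> B t * J t = 1 \<and> J t * B t = 1 \<and> norm (J t) \<le> c"
    and trV: "\<And>t. t \<in> {0..1} \<Longrightarrow> tr (cop_of (V t)) = \<alpha> + of_real t * \<beta>"
  shows "(\<lambda>N. Determinant.det (sec N (B 1))) \<longlonglongrightarrow> exp (\<alpha> + \<beta> / 2)"
proof -
  have Bc: "continuous_on {0..1} B"
    unfolding continuous_on_eq_continuous_within by (blast intro: has_vector_derivative_continuous[OF B])
  have BVc: "continuous_on {0..1} (\<lambda>s. lmul (B s) (V s))"
    by (rule bounded_bilinear.continuous_on[OF bounded_bilinear_lmul Bc V])
  \<comment> \<open>This is \<open>B - 1\<close> as an element of the nuclear space: the integral is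
    taken in the nuclear norm, and the fundamental theorem of calculus in operator norm identifies
    it.\<close>
  define \<kappa> where "\<kappa> t = integral {0..t} (\<lambda>s. lmul (B s) (V s))" for t
  have \<kappa>c: "continuous_on {0..1} \<kappa>" unfolding \<kappa>_def
    by (rule indefinite_integral_continuous_1) (rule integrable_continuous_real[OF BVc])
  have \<kappa>: "cop_of (\<kappa> t) = B t - 1" if t: "t \<in> {0..1}" for t
  proof -
    have sub: "{0..t} \<subseteq> {0..1}" using t by auto
    have "((\<lambda>s. B s * cop_of (V s)) has_integral (B t - B 0)) {0..t}"
      by (rule fundamental_theorem_of_calculus)
         (use t sub in \<open>auto intro!: has_vector_derivative_within_subset[OF B]\<close>)
    note 1 = this
    have "((cop_of \<circ> (\<lambda>s. lmul (B s) (V s))) has_integral cop_of (\<kappa> t)) {0..t}"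
      unfolding \<kappa>_def
      by (intro has_integral_linear bounded_linear_cop_of integrable_integral
        integrable_continuous_real continuous_on_subset[OF BVc sub])
    then have "((\<lambda>s. B s * cop_of (V s)) has_integral cop_of (\<kappa> t)) {0..t}" by (simp add: o_def)
    from has_integral_unique[OF this 1] show ?thesis by (simp add: B0)
  qed
  have c: "c > 0"
  proof (rule ccontr)
    assume "\<not> c > 0"
    then have "J 0 = 0" using inv[of 0] by (smt (verit) atLeastAtMost_iff norm_le_zero_iff)
    then show False using inv[of 0] by simp
  qed
  have key: "\<exists>N0. \<forall>N\<ge>N0. cmod (Determinant.det (sec N (B 1)) / exp (\<alpha> + \<beta> / 2) - 1) \<le> 2 * \<epsilon>"
    if \<epsilon>: "0 < \<epsilon>" "\<epsilon> \<le> 1/2" for \<epsilon>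
  proof -
    \<comment> \<open>The first bound keeps the Neumann parameter \<open>Y\<close> within 1/2, since
      \<open>J\<close> has norm at most \<open>c\<close>; the second compensates the factor 1 + 2c
      of the trace error, in which 2c bounds the inverse \<open>X\<close>.\<close>
    have c1: "1 / (2 * c) > 0" and c2: "\<epsilon> / (1 + 2 * c) > 0" using c \<epsilon> by auto
    obtain N1 where N1: "\<And>N t. N \<ge> N1 \<Longrightarrow> t \<in> {0..1} \<Longrightarrow> norm (lmul (1 - pr N) (\<kappa> t)) < 1 / (2 * c)"
      using nucl_tail_uniform[OF \<kappa>c c1] by blast
    obtain N2 where N2: "\<And>N t. N \<ge> N2 \<Longrightarrow> t \<in> {0..1} \<Longrightarrow> norm (lmul (1 - pr N) (V t)) < \<epsilon> / (1 + 2 * c)"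
      using nucl_tail_uniform[OF V c2] by blast
    have "cmod (Determinant.det (sec N (B 1)) / exp (\<alpha> + \<beta> / 2) - 1) \<le> 2 * \<epsilon>"
      if N: "N \<ge> N1" "N \<ge> N2" for N
    proof -
      let ?P = "pr N"
      have "\<exists>X. (?P * B t + (1 - ?P)) * X = 1 \<and> X * (?P * B t + (1 - ?P)) = 1 \<and> norm X \<le> 2 * c"
        if t: "t \<in> {0..1}" for t
      proof -
        \<comment> \<open>Factoring \<open>B t\<close> out of
          \<open>B t - (1 - ?P) * (B t - 1)\<close> leaves \<open>1 - Y\<close>, which a Neumann
          series inverts.\<close>
        define Y where "Y = J t * ((1 - ?P) * cop_of (\<kappa> t))"
        have "norm Y \<le> norm (J t) * norm ((1 - ?P) * cop_of (\<kappa> t))"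
          unfolding Y_def by (rule norm_mult_ineq)
        also have "\<dots> \<le> c * (1 / (2 * c))"
          using inv[OF t] c cop_of_norm_le[of "lmul (1 - ?P) (\<kappa> t)"] N1[OF N(1) t]
          by (intro mult_mono) auto
        finally have "norm Y \<le> 1/2" using c by simp
        then obtain W where W: "(1 - Y) * W = 1" "W * (1 - Y) = 1" "norm W \<le> 2"
          using neumann_inverse by blast
        have eq: "?P * B t + (1 - ?P) = B t * (1 - Y)"
        proof -
          have "B t * Y = (1 - ?P) * (B t - 1)"
            using inv[OF t] unfolding Y_def \<kappa>[OF t] by (simp flip: mult.assoc)
          then show ?thesis by (simp add: algebra_simps)
        qed
        have "B t * (1 - Y) * (W * J t) = B t * ((1 - Y) * W) * J t" by (simp only: mult.assoc)
        then have "B t * (1 - Y) * (W * J t) = 1" using W inv[OF t] by simp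
        moreover have "(W * J t) * (B t * (1 - Y)) = W * (J t * B t) * (1 - Y)" by (simp only: mult.assoc)
        then have "(W * J t) * (B t * (1 - Y)) = 1" using W inv[OF t] by simp
        moreover have "norm (W * J t) \<le> 2 * c"
          using inv[OF t] W(3) by (intro order_trans[OF norm_mult_ineq mult_mono]) auto
        ultimately show ?thesis unfolding eq by blast
      qed
      then obtain X where X: "\<And>t. t \<in> {0..1} \<Longrightarrow> (?P * B t + (1 - ?P)) * X t = 1"
        "\<And>t. t \<in> {0..1} \<Longrightarrow> X t * (?P * B t + (1 - ?P)) = 1"
        "\<And>t. t \<in> {0..1} \<Longrightarrow> norm (X t) \<le> 2 * c" by metis
      define f where "f t = Determinant.det (sec N (B t))" for t
      define g where "g t = tr (?P * (X t * ?P * B t * cop_of (V t)))" for t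
      have XPB: "X t * ?P * B t = 1 - X t * (1 - ?P)" if "t \<in> {0..1}" for t
        using X(2)[OF that] by (simp add: algebra_simps)
      have f': "(f has_vector_derivative g t * f t) (at t within {0..1})" if t: "t \<in> {0..1}" for t
      proof -
        \<comment> \<open>Compressed to the corner, \<open>X t\<close> inverts \<open>B t\<close>.
          This splits \<open>f s\<close> into \<open>f t\<close> and the determinant of a section
          that is the identity at s = t, the point where \<open>det_deriv_id\<close>
          applies.\<close>
        have fac: "f s = f t * Determinant.det (sec N (X t * ?P * B s))" for s
        proof -
          have "(1 - ?P) * X t = 1 - ?P"
          proof -
            have "(1 - ?P) * ((?P * B t + (1 - ?P)) * X t) = (1 - ?P) * X t"
              by (simp add: algebra_simps) (simp add: algebra_simps flip: mult.assoc)
            then show ?thesis using X(1)[OF t] by simp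
          qed
          then have z: "(1 - ?P) * X t * ?P = 0" by (simp only: left_diff_distrib) simp
          have "?P * B t * ?P * X t * ?P = ?P * ((?P * B t + (1 - ?P)) * X t) * ?P - ?P * B t * ((1 - ?P) * X t * ?P)"
            by (simp add: algebra_simps) (simp add: algebra_simps flip: mult.assoc)
          then have e: "?P * B t * ?P * X t * ?P = ?P" using X(1)[OF t] z by simp
          have "f s = Determinant.det (sec N (?P * B s))"
            unfolding f_def by (rule arg_cong[of _ _ Determinant.det], rule sec_eqI) (simp add: ent_pr_left)
          also have "?P * B s = (?P * B t) * (?P * (X t * ?P * B s))"
            unfolding e[symmetric, THEN arg_cong, of "\<lambda>Z. Z * B s"] by (simp only: mult.assoc)
          also have "Determinant.det (sec N \<dots>) = Determinant.det (sec N (?P * B t)) * Determinant.det (sec N (X t * ?P * B s))"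
            unfolding sec_mult_pr by (rule det_mult[OF sec_carrier sec_carrier])
          also have "sec N (?P * B t) = sec N (B t)" by (rule sec_eqI) (simp add: ent_pr_left)
          finally show ?thesis by (simp add: f_def)
        qed
        have "((\<lambda>s. Determinant.det (sec N (X t * ?P * B s))) has_vector_derivative
            (\<Sum>i<N. ent (X t * ?P * (B t * cop_of (V t))) i i)) (at t within {0..1})"
          unfolding sec_def
        proof (rule det_deriv_id[where m' = "ent (X t * ?P * (B t * cop_of (V t)))"])
          fix i j assume "i < N" "j < N"
          show "((\<lambda>s. ent (X t * ?P * B s) i j) has_vector_derivative ent (X t * ?P * (B t * cop_of (V t))) i j) (at t within {0..1})"
            by (rule bounded_linear.has_vector_derivative[OF bounded_linear_ent
                has_vector_derivative_mult_right[OF B[OF t]]])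
          have "ent (X t * (1 - ?P)) i j = 0"
            using \<open>j < N\<close> by (simp add: right_diff_distrib ent_pr_right)
          then show "ent (X t * ?P * B t) i j = (if i = j then 1 else 0)"
            unfolding XPB[OF t] by simp
        qed
        moreover have "(\<Sum>i<N. ent (X t * ?P * (B t * cop_of (V t))) i i) = g t"
        proof -
          have "(\<lambda>i. ent (?P * (X t * ?P * B t * cop_of (V t))) i i) sums
              (\<Sum>i<N. ent (?P * (X t * ?P * B t * cop_of (V t))) i i)"
            by (rule sums_finite) (auto simp: ent_pr_left)
          then show ?thesis unfolding g_def tr_def by (simp add: sums_iff ent_pr_left mult.assoc)
        qed
        ultimately have "((\<lambda>s. f t * Determinant.det (sec N (X t * ?P * B s))) has_vector_derivative f t * g t) (at t within {0..1})"
          by (intro has_vector_derivative_mult_right) simp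
        then show ?thesis by (simp add: fac[symmetric] mult.commute)
      qed
      have g: "cmod (g t - (\<alpha> + of_real t * \<beta>)) \<le> \<epsilon>" if t: "t \<in> {0..1}" for t
      proof -
        let ?V = "cop_of (V t)" and ?QV = "cop_of (lmul (1 - ?P) (V t))"
        have "?P * (X t * ?P * B t * ?V) = ?V - ?QV - ?P * X t * ?QV"
          unfolding XPB[OF t] by (simp add: algebra_simps)
        also have "\<dots> = cop_of (V t - lmul (1 - ?P) (V t) - lmul (?P * X t) (lmul (1 - ?P) (V t)))"
          by simp
        finally have "g t = tr (cop_of (V t)) - tr (cop_of (lmul (1 - ?P) (V t)))
            - tr (cop_of (lmul (?P * X t) (lmul (1 - ?P) (V t))))"
          unfolding g_def by (simp only: tr_cop_of_diff)
        then have "g t - (\<alpha> + of_real t * \<beta>) = - (tr (cop_of (lmul (1 - ?P) (V t)))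
            + tr (cop_of (lmul (?P * X t) (lmul (1 - ?P) (V t)))))"
          using trV[OF t] by simp
        also have "cmod \<dots> \<le> norm (lmul (1 - ?P) (V t)) + norm (lmul (?P * X t) (lmul (1 - ?P) (V t)))"
          unfolding norm_minus_cancel by (intro order_trans[OF norm_triangle_ineq add_mono] norm_tr_nucl_le)
        also have "norm (lmul (?P * X t) (lmul (1 - ?P) (V t))) \<le> (1 * (2 * c)) * norm (lmul (1 - ?P) (V t))"
          by (intro order_trans[OF norm_lmul_le mult_right_mono] order_trans[OF norm_mult_ineq mult_mono]
            norm_pr_le X t) auto
        finally have "cmod (g t - (\<alpha> + of_real t * \<beta>)) \<le> (1 + 2 * c) * norm (lmul (1 - ?P) (V t))"
          by (simp add: algebra_simps)
        also have "\<dots> \<le> (1 + 2 * c) * (\<epsilon> / (1 + 2 * c))"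
          using N2[OF N(2) t] c by (intro mult_left_mono) auto
        finally show ?thesis using c by simp
      qed
      \<comment> \<open>An integrating factor that removes the expected trace; the antiderivative of
        \<alpha> + t \<beta> is the source of \<beta> / 2 at t = 1.\<close>
      define y where "y t = f t * exp (- (of_real t * \<alpha> + of_real (t\<^sup>2) * (\<beta> / 2)))" for t
      have "cmod (y 1 - 1) \<le> 2 * \<epsilon>"
      proof (rule almost_constant[where w = "\<lambda>t. g t - (\<alpha> + of_real t * \<beta>)"])
        fix t :: real assume t: "t \<in> {0..1}"
        let ?h = "\<lambda>t::real. - (of_real t * \<alpha> + of_real (t\<^sup>2) * (\<beta> / 2))"
        have h: "(?h has_vector_derivative - (\<alpha> + of_real t * \<beta>)) (at t within {0..1})"
          by (auto intro!: derivative_eq_intros simp: has_vector_derivative_def fun_eq_iff algebra_simps scaleR_conv_of_real power2_eq_square)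
        have "((\<lambda>t. exp (?h t)) has_vector_derivative (- (\<alpha> + of_real t * \<beta>) * exp (?h t))) (at t within {0..1})"
          using field_vector_diff_chain_within[OF h, of exp "exp (?h t)"] DERIV_exp
          by (simp add: o_def mult.commute has_field_derivative_at_within)
        then have "(y has_vector_derivative f t * (- (\<alpha> + of_real t * \<beta>) * exp (?h t)) + g t * f t * exp (?h t)) (at t within {0..1})"
          unfolding y_def by (intro has_vector_derivative_mult f' t)
        then show "(y has_vector_derivative (g t - (\<alpha> + of_real t * \<beta>)) * y t) (at t within {0..1})"
          by (simp add: y_def algebra_simps)
        show "cmod (g t - (\<alpha> + of_real t * \<beta>)) \<le> \<epsilon>" by (rule g[OF t])
      next
        have "sec N 1 = 1\<^sub>m N" by (rule eq_matI) (auto simp: sec_def)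
        then show "y 0 = 1" by (simp add: y_def f_def B0)
      qed (rule \<epsilon>)
      then show ?thesis by (simp add: y_def f_def exp_minus field_simps)
    qed
    then show ?thesis by (intro exI[of _ "max N1 N2"]) auto
  qed
  have "(\<lambda>N. Determinant.det (sec N (B 1)) / exp (\<alpha> + \<beta> / 2)) \<longlonglongrightarrow> 1"
  proof (rule LIMSEQ_I)
    fix r :: real assume "r > 0"
    define \<epsilon> where "\<epsilon> = min (r / 4) (1 / 2)"
    have \<epsilon>: "0 < \<epsilon>" "\<epsilon> \<le> 1/2" "2 * \<epsilon> < r" using \<open>r > 0\<close> by (auto simp: \<epsilon>_def min_def)
    obtain N0 where "\<forall>N\<ge>N0. cmod (Determinant.det (sec N (B 1)) / exp (\<alpha> + \<beta> / 2) - 1) \<le> 2 * \<epsilon>"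
      using key[OF \<epsilon>(1,2)] by blast
    then show "\<exists>N0. \<forall>N\<ge>N0. cmod (Determinant.det (sec N (B 1)) / exp (\<alpha> + \<beta> / 2) - 1) < r"
      using \<epsilon>(3) by (intro exI[of _ N0]) (auto intro: le_less_trans)
  qed
  from tendsto_mult_right[OF this, of "exp (\<alpha> + \<beta> / 2)"] show ?thesis by simp
qed

text \<open>The conjugate \<open>exp (-sY) X exp (sY)\<close> has derivative
  \<open>exp (-sY) C exp (sY)\<close>, which is nuclear even when X is not and has the trace of
  \<open>C\<close> for every s by cyclicity. Integration in the nuclear norm therefore gives a trace
  linear in t.\<close>

lemma conj_path:
  fixes X Y :: cop and C :: nucl
  assumes C: "cop_of C = X * Y - Y * X"
  obtains R :: "real \<Rightarrow> nucl" where "continuous_on {0..1} R"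
    "\<And>t. t \<in> {0..1} \<Longrightarrow> cop_of (R t) = exp (t *\<^sub>R (- Y)) * X * exp (t *\<^sub>R Y) - X"
    "\<And>t. t \<in> {0..1} \<Longrightarrow> tr (cop_of (R t)) = of_real t * tr (cop_of C)"
proof -
  define r where "r s = lmul (exp (s *\<^sub>R (- Y))) (rmul C (exp (s *\<^sub>R Y)))" for s
  define R where "R t = integral {0..t} r" for t
  have ec: "continuous_on S (\<lambda>s. exp (s *\<^sub>R Z))" for S and Z :: cop
    unfolding continuous_on_eq_continuous_within
    by (blast intro: has_vector_derivative_continuous[OF exp_scaleR_has_vector_derivative_right])
  have rc: "continuous_on {0..1} r" unfolding r_def
    by (intro bounded_bilinear.continuous_on[OF bounded_bilinear_lmul]
      bounded_bilinear.continuous_on[OF bounded_bilinear_rmul] ec continuous_on_const)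
  have "continuous_on {0..1} R" unfolding R_def
    by (rule indefinite_integral_continuous_1) (rule integrable_continuous_real[OF rc])
  moreover have "cop_of (R t) = exp (t *\<^sub>R (- Y)) * X * exp (t *\<^sub>R Y) - X"
    and "tr (cop_of (R t)) = of_real t * tr (cop_of C)" if t: "t \<in> {0..1}" for t
  proof -
    have Rt: "(r has_integral R t) {0..t}" unfolding R_def
      using t by (intro integrable_integral integrable_continuous_real continuous_on_subset[OF rc]) auto
    let ?y = "\<lambda>s. exp (s *\<^sub>R (- Y)) * X * exp (s *\<^sub>R Y)"
    have "(?y has_vector_derivative cop_of (r s)) (at s within {0..t})" for s
    proof -
      have "(?y has_vector_derivative (exp (s *\<^sub>R (- Y)) * X * (Y * exp (s *\<^sub>R Y))
          + exp (s *\<^sub>R (- Y)) * (- Y) * X * exp (s *\<^sub>R Y))) (at s)"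
        by (intro has_vector_derivative_mult has_vector_derivative_mult_left
          exp_scaleR_has_vector_derivative_left exp_scaleR_has_vector_derivative_right)
      then have "(?y has_vector_derivative cop_of (r s)) (at s)"
        by (simp add: r_def C algebra_simps)
      then show ?thesis by (rule has_vector_derivative_at_within)
    qed
    then have "((\<lambda>s. cop_of (r s)) has_integral (?y t - ?y 0)) {0..t}"
      using t by (intro fundamental_theorem_of_calculus) auto
    moreover have "((\<lambda>s. cop_of (r s)) has_integral cop_of (R t)) {0..t}"
      using has_integral_linear[OF Rt bounded_linear_cop_of] by (simp add: o_def)
    ultimately have "cop_of (R t) = ?y t - ?y 0" by (rule has_integral_unique[rotated])
    then show "cop_of (R t) = ?y t - X" by simp
    have "tr (cop_of (r s)) = tr (cop_of C)" for s
    proof -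
      have "tr (cop_of (r s)) = tr (cop_of (rmul C (exp (s *\<^sub>R Y))) * exp (- (s *\<^sub>R Y)))"
        unfolding r_def mul_rep_eqs(1) scaleR_minus_right by (rule tr_nucl_commute)
      also have "cop_of (rmul C (exp (s *\<^sub>R Y))) * exp (- (s *\<^sub>R Y)) = cop_of C"
        using exp_minus_inverse[of "s *\<^sub>R Y"] by (simp add: mult.assoc)
      finally show ?thesis .
    qed
    then have "((\<lambda>s. tr (cop_of C)) has_integral tr (cop_of (R t))) {0..t}"
      using has_integral_linear[OF Rt bounded_linear_tr] by (simp add: o_def)
    moreover have "((\<lambda>s. tr (cop_of C)) has_integral of_real t * tr (cop_of C)) {0..t}"
      using has_integral_const_real[of "tr (cop_of C)" 0 t] t by (simp add: scaleR_conv_of_real)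
    ultimately show "tr (cop_of (R t)) = of_real t * tr (cop_of C)"
      by (rule has_integral_unique)
  qed
  ultimately show thesis using that by blast
qed

text \<open>Since D - A = K + F - E, the logarithmic derivative of the path is the conjugate by
  exp(tF) of exp(-tE) (K - R1) exp(tE) + R2. Here R1 and R2 are the changes of A and F under
  conjugation by exp(tD) and exp(tE), both nuclear with trace linear in t.\<close>

lemma det_sec_exp_limit:
  fixes A D F :: cop and K Cda Caf :: nucl
  assumes Cda: "cop_of Cda = D * A - A * D" and Caf: "cop_of Caf = A * F - F * A" and DF: "D * F = F * D"
  defines "E \<equiv> cop_of K + A + F - D"
  shows "(\<lambda>N. Determinant.det (sec N (exp (- A) * exp D * exp E * exp (- F)))) \<longlonglongrightarrow>
    exp (tr (cop_of K) + (tr (cop_of Cda) - tr (cop_of Caf)) / 2)"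
proof -
  define e where "e X t = exp (t *\<^sub>R X)" for X :: cop and t :: real
  have inv1: "e X t * e (- X) t = 1" and inv2: "e (- X) t * e X t = 1" for X t
    using exp_minus_inverse[of "t *\<^sub>R X"] exp_minus_inverse[of "- (t *\<^sub>R X)"] by (simp_all add: e_def)
  have dl: "(e X has_vector_derivative X * e X t) (at t within T)"
    and dr: "(e X has_vector_derivative e X t * X) (at t within T)" for X t T
    unfolding e_def by (rule has_vector_derivative_at_within[OF exp_scaleR_has_vector_derivative_left]
      exp_scaleR_has_vector_derivative_right)+
  have comm: "X * e X t = e X t * X" for X t
    unfolding e_def by (rule exp_times_scaleR_commute[symmetric])
  have ec: "continuous_on T (e X)" for X T
    unfolding continuous_on_eq_continuous_within
    by (blast intro: has_vector_derivative_continuous[OF dr])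
  obtain R1 where R1: "continuous_on {0..1} R1"
    "\<And>t. t \<in> {0..1} \<Longrightarrow> cop_of (R1 t) = e (- D) t * A * e D t - A"
    "\<And>t. t \<in> {0..1} \<Longrightarrow> tr (cop_of (R1 t)) = of_real t * tr (cop_of (- Cda))"
    using conj_path[of "- Cda" A D] Cda unfolding e_def by auto
  \<comment> \<open>As F commutes with D, only K and A contribute to the commutator of F with E; the
    K part is traceless.\<close>
  define C2 where "C2 = lmul F K - rmul K F - Caf"
  have "cop_of C2 = F * E - E * F"
    by (simp add: C2_def E_def Caf algebra_simps DF)
  then obtain R2 where R2: "continuous_on {0..1} R2"
    "\<And>t. t \<in> {0..1} \<Longrightarrow> cop_of (R2 t) = e (- E) t * F * e E t - F"
    "\<And>t. t \<in> {0..1} \<Longrightarrow> tr (cop_of (R2 t)) = of_real t * tr (cop_of C2)"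
    using conj_path[of C2 F E] unfolding e_def by auto
  have trC2: "tr (cop_of C2) = - tr (cop_of Caf)"
  proof -
    have "tr (cop_of C2) = tr (cop_of (lmul F K)) - tr (cop_of (rmul K F)) - tr (cop_of Caf)"
      by (simp only: C2_def tr_cop_of_diff)
    then show ?thesis using tr_nucl_commute[of F K] by simp
  qed
  define Z where "Z t = lmul (e (- E) t) (rmul (K - R1 t) (e E t)) + R2 t" for t
  define V where "V t = lmul (e F t) (rmul (Z t) (e (- F) t))" for t
  define B where "B t = e (- A) t * e D t * e E t * e (- F) t" for t
  define J where "J t = e F t * e (- E) t * e (- D) t * e A t" for t
  have Vc: "continuous_on {0..1} V" unfolding V_def Z_def
    by (intro bounded_bilinear.continuous_on[OF bounded_bilinear_lmul]
      bounded_bilinear.continuous_on[OF bounded_bilinear_rmul] continuous_on_add continuous_on_diff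
      ec continuous_on_const R1 R2)
  have "continuous_on {0..1} J" unfolding J_def
    by (intro continuous_on_mult ec)
  then have "bounded (J ` {0..1})" by (intro compact_imp_bounded compact_continuous_image) auto
  then obtain c where c: "\<And>t. t \<in> {0..1} \<Longrightarrow> norm (J t) \<le> c" unfolding bounded_iff by blast
  have "(\<lambda>N. Determinant.det (sec N (B 1))) \<longlonglongrightarrow>
      exp (tr (cop_of K) + (tr (cop_of Cda) - tr (cop_of Caf)) / 2)"
  proof (rule det_sec_path_limit[where V = V and J = J and c = c])
    show "B 0 = 1" by (simp add: B_def e_def)
    show "continuous_on {0..1} V" by (rule Vc)
    fix t :: real assume t: "t \<in> {0..1}"
    let ?a = "e (- A) t" and ?d = "e D t" and ?e = "e E t" and ?f = "e (- F) t"
    have BJ: "B t * J t = ?a * ?d * (?e * (?f * e F t) * e (- E) t) * e (- D) t * e A t"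
      "J t * B t = e F t * e (- E) t * (e (- D) t * (e A t * ?a) * ?d) * ?e * ?f"
      by (simp_all add: B_def J_def mult.assoc)
    have "B t * J t = 1"
      unfolding BJ inv1 inv2 mult_1_right
      using inv1[of D t] inv2[of A t] by (simp add: mult.assoc[of ?a])
    moreover have "J t * B t = 1"
      unfolding BJ inv1 inv2 mult_1_right
      using inv1[of F t] inv2[of E t] by (simp add: mult.assoc[of "e F t"])
    ultimately show "B t * J t = 1 \<and> J t * B t = 1 \<and> norm (J t) \<le> c" using c[OF t] by blast
    \<comment> \<open>Multiplying the conjugation formula by the exponential from the left turns it
      into a commutator, so that \<open>B t * cop_of (V t)\<close> can be matched with the product
      rule by ring identities.\<close>
    have k1: "?d * cop_of (R1 t) = A * ?d - ?d * A"
      using inv1[of D t] unfolding R1(2)[OF t] right_diff_distrib by (simp flip: mult.assoc)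
    have k2: "?e * cop_of (R2 t) = F * ?e - ?e * F"
      using inv1[of E t] unfolding R2(2)[OF t] right_diff_distrib by (simp flip: mult.assoc)
    have "?e * cop_of (Z t) = (?e * e (- E) t) * cop_of (K - R1 t) * ?e + ?e * cop_of (R2 t)"
      by (simp add: Z_def distrib_left mult.assoc)
    then have k3: "?e * cop_of (Z t) = cop_of (K - R1 t) * ?e + (F * ?e - ?e * F)"
      by (simp only: inv1 k2 mult_1_left)
    have "B t * cop_of (V t) = ?a * ?d * ?e * (?f * e F t) * cop_of (Z t) * ?f"
      by (simp add: B_def V_def mult.assoc)
    also have "\<dots> = ?a * (?d * (?e * cop_of (Z t))) * ?f" by (simp only: inv2 mult_1_right mult.assoc)
    also have "\<dots> = ?a * ((?d * cop_of K - ?d * cop_of (R1 t)) * ?e + ?d * (F * ?e - ?e * F)) * ?f"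
      unfolding k3 by (simp add: algebra_simps)
    finally have BV: "B t * cop_of (V t) = ?a * ((?d * cop_of K - (A * ?d - ?d * A)) * ?e + ?d * (F * ?e - ?e * F)) * ?f"
      unfolding k1 .
    have fF: "?f * F = F * ?f" using comm[of "- F" t] by simp
    have "(B has_vector_derivative (?a * ?d * ?e * (?f * (- F))
        + (?a * ?d * (E * ?e) + (?a * (?d * D) + ?a * (- A) * ?d) * ?e) * ?f)) (at t within {0..1})"
      unfolding B_def by (intro has_vector_derivative_mult dl dr)
    also have "?a * ?d * ?e * (?f * (- F))
        + (?a * ?d * (E * ?e) + (?a * (?d * D) + ?a * (- A) * ?d) * ?e) * ?f = B t * cop_of (V t)"
    proof -
      have Ef: "E * (?e * ?f) = cop_of K * (?e * ?f) + A * (?e * ?f) + F * (?e * ?f) - D * (?e * ?f)"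
        by (simp add: E_def algebra_simps)
      show ?thesis unfolding BV by (simp add: algebra_simps fF Ef)
    qed
    finally show "(B has_vector_derivative B t * cop_of (V t)) (at t within {0..1})" .
    have conj: "tr (cop_of (lmul (e X t) (rmul Y (e (- X) t)))) = tr (cop_of Y)" for X Y
    proof -
      have "tr (cop_of (lmul (e X t) (rmul Y (e (- X) t)))) = tr (cop_of (rmul Y (e (- X) t)) * e X t)"
        unfolding mul_rep_eqs(1) by (rule tr_nucl_commute)
      then show ?thesis using inv2[of X t] by (simp add: mult.assoc)
    qed
    have "tr (cop_of (V t)) = tr (cop_of (Z t))" unfolding V_def by (rule conj)
    also have "\<dots> = tr (cop_of (K - R1 t)) + tr (cop_of (R2 t))"
      using conj[of "- E" "K - R1 t"] unfolding Z_def plus_nucl.rep_eq tr_nucl_add by simp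
    also have "tr (cop_of (K - R1 t)) = tr (cop_of K) - tr (cop_of (R1 t))"
      unfolding minus_nucl.rep_eq by (rule tr_nucl_diff)
    also have "tr (cop_of (R1 t)) = - (of_real t * tr (cop_of Cda))"
      using R1(3)[OF t] tr_nucl_diff[of 0 Cda] by (simp add: tr_def)
    finally show "tr (cop_of (V t)) = tr (cop_of K) + of_real t * (tr (cop_of Cda) - tr (cop_of Caf))"
      by (simp add: R2(3)[OF t] trC2 algebra_simps)
  qed
  then show ?thesis by (simp add: B_def e_def)
qed

text \<open>The relation marks the positions forced to be zero: \<open>(<)\<close> stands for lower
  and \<open>(>)\<close> for upper triangular matrices, which are treated together.\<close>

definition tri :: "(nat \<Rightarrow> nat \<Rightarrow> bool) \<Rightarrow> cop \<Rightarrow> bool"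
  where "tri r X \<longleftrightarrow> (\<forall>j k. r j k \<longrightarrow> ent X j k = 0)"

lemma
  assumes r: "r = (<) \<or> r = (>)" and X: "tri r X" and Y: "tri r Y"
  shows tri_mult: "tri r (X * Y)" and tri_mult_diag: "ent (X * Y) j j = ent X j j * ent Y j j"
proof -
  have *: "ent X j l * ent Y l k = 0" if "r j l \<or> r l k" for j l k
    using X Y that by (auto simp: tri_def)
  show "tri r (X * Y)" unfolding tri_def
  proof (intro allI impI)
    fix j k assume "r j k"
    then have "r j l \<or> r l k" for l using r by auto
    then show "ent (X * Y) j k = 0"
      using ent_mult_sums[of X j Y k] * by (simp add: sums_iff)
  qed
  have "(\<lambda>l. ent X j l * ent Y l j) sums (\<Sum>l\<in>{j}. ent X j l * ent Y l j)"
  proof (rule sums_finite)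
    fix l assume "l \<notin> {j}"
    then have "r j l \<or> r l j" using r by auto
    then show "ent X j l * ent Y l j = 0" by (rule *)
  qed simp
  then show "ent (X * Y) j j = ent X j j * ent Y j j"
    using ent_mult_sums[of X j Y j] by (simp add: sums_iff)
qed

text \<open>Powers of a triangular matrix are triangular and their diagonals are powers of the
  diagonal, so the exponential series can be read off entry by entry.\<close>

lemma
  assumes r: "r = (<) \<or> r = (>)" and X: "tri r X"
  shows tri_exp: "tri r (exp X)" and tri_exp_diag: "ent (exp X) j j = exp (ent X j j)"
proof -
  have pow: "tri r (X ^ n) \<and> (\<forall>j. ent (X ^ n) j j = ent X j j ^ n)" for n
  proof (induction n)
    case 0 show ?case using r by (auto simp: tri_def)
  next
    case (Suc n) then show ?case
      using tri_mult[OF r X] tri_mult_diag[OF r X] by simp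
  qed
  have s: "(\<lambda>n. ent (X ^ n /\<^sub>R fact n) j k) sums ent (exp X) j k" for j k
    unfolding exp_def
    by (rule bounded_linear.sums[OF bounded_linear_ent summable_sums[OF summable_exp_generic]])
  show "tri r (exp X)" unfolding tri_def
  proof (intro allI impI)
    fix j k assume "r j k"
    then show "ent (exp X) j k = 0" using s[of j k] pow by (simp add: tri_def sums_iff)
  qed
  have "(\<lambda>n. ent X j j ^ n /\<^sub>R fact n) sums ent (exp X) j j"
    using s[of j j] pow by (simp add: scaleR_conv_of_real[where 'a = complex])
  then show "ent (exp X) j j = exp (ent X j j)"
    unfolding exp_def by (simp add: sums_iff)
qed

lemma det_sec_tri:
  assumes r: "r = (<) \<or> r = (>)" and X: "tri r X" and d: "\<And>j. ent X j j = z"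
  shows "Determinant.det (sec N X) = z ^ N"
proof -
  have "Determinant.det (sec N X) = prod_list (diag_mat (sec N X))"
    using r
  proof
    assume "r = (<)" then show ?thesis
      using X by (intro det_lower_triangular[of N]) (auto simp: sec_def tri_def)
  next
    assume "r = (>)" then show ?thesis
      using X by (intro det_upper_triangular[of _ N]) (auto simp: sec_def tri_def)
  qed
  also have "\<dots> = z ^ N" by (simp add: prod_list_diag_prod sec_def d)
  finally show ?thesis .
qed

text \<open>The zero diagonal of \<open>A\<close> and the constant diagonal of \<open>F\<close> put
  the whole exponential growth into \<open>exp z ^ N\<close>; what remains is the section
  determinant of the path at its end point.\<close>

lemma det_sec_exp_exp_limit:
  fixes A D F :: cop and K Cda Caf :: nucl
  assumes Cda: "cop_of Cda = D * A - A * D" and Caf: "cop_of Caf = A * F - F * A" and DF: "D * F = F * D"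
    and A: "tri (<) A" "\<And>j. ent A j j = 0" and F: "tri (>) F" "\<And>j. ent F j j = z"
  shows "(\<lambda>N. Determinant.det (sec N (exp D * exp (cop_of K + A + F - D))) / exp z ^ N) \<longlonglongrightarrow>
    exp (tr (cop_of K) + (tr (cop_of Cda) - tr (cop_of Caf)) / 2)"
proof -
  let ?E = "cop_of K + A + F - D"
  let ?B = "exp (- A) * exp D * exp ?E * exp (- F)"
  have eq: "exp D * exp ?E = exp A * (?B * exp F)"
  proof -
    have "exp A * (?B * exp F) = (exp A * exp (- A)) * exp D * exp ?E * (exp (- F) * exp F)"
      by (simp only: mult.assoc)
    then show ?thesis using exp_minus_inverse[of A] exp_minus_inverse[of "- F"] by simp
  qed
  have tA: "tri (<) (exp A)" "ent (exp A) j j = 1" for j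
    using tri_exp[OF _ A(1)] tri_exp_diag[OF _ A(1)] A(2) by auto
  have tF: "tri (>) (exp F)" "ent (exp F) j j = exp z" for j
    using tri_exp[OF _ F(1)] tri_exp_diag[OF _ F(1)] F(2) by auto
  have "Determinant.det (sec N (exp D * exp ?E)) / exp z ^ N = Determinant.det (sec N ?B)" for N
  proof -
    have "Determinant.det (sec N (exp D * exp ?E))
        = Determinant.det (sec N (exp A)) * Determinant.det (sec N (?B * exp F))"
      unfolding eq by (rule det_sec_mult) (use tA in \<open>auto simp: tri_def\<close>)
    also have "Determinant.det (sec N (?B * exp F)) = Determinant.det (sec N ?B) * Determinant.det (sec N (exp F))"
      by (rule det_sec_mult) (use tF in \<open>auto simp: tri_def\<close>)
    also have "Determinant.det (sec N (exp A)) = 1" using det_sec_tri[OF _ tA] by simp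
    also have "Determinant.det (sec N (exp F)) = exp z ^ N" using det_sec_tri[OF _ tF] by simp
    finally show ?thesis by simp
  qed
  then show ?thesis using det_sec_exp_limit[OF Cda Caf DF] by simp
qed

section \<open>Toeplitz and Hankel operators\<close>

lemma linf_rel_refl: "linf_rel f f \<longleftrightarrow> ess_bounded f"
  by (auto simp: linf_rel_def)

lemma abs_linf_eqI: "linf_rel f g \<Longrightarrow> abs_linf f = abs_linf g"
  by (rule Quotient_rel_abs[OF Quotient_linf])

lemma linf_cases:
  obtains f where "ess_bounded f" "a = abs_linf f"
proof -
  have "linf_rel (rep_linf a) (rep_linf a)" by (rule Quotient_rep_reflp[OF Quotient_linf])
  moreover have "a = abs_linf (rep_linf a)" by (rule Quotient_abs_rep[OF Quotient_linf, symmetric])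
  ultimately show thesis using that unfolding linf_rel_refl by blast
qed

lemma fourier_abs:
  "ess_bounded f \<Longrightarrow> fourier (abs_linf f) n = 1 / (2 * pi) * integral\<^sup>L arc (\<lambda>t. f (cis t) * cis (- (n * t)))"
  by (simp add: fourier.abs_eq linf_rel_refl)

text \<open>The infimum of the essential bounds is itself one: outside a countable union of null
  sets all the bounds \<open>Inf ?A + 1 / real (Suc n)\<close> hold at once. Nonnegativity holds
  because the arc is not a null set.\<close>

lemma linf_norm_AE:
  assumes "ess_bounded f"
  shows "0 \<le> linf_norm (abs_linf f)" "AE t in arc. cmod (f (cis t)) \<le> linf_norm (abs_linf f)"
proof -
  let ?A = "{B. AE t in arc. cmod (f (cis t)) \<le> B}"
  have N: "linf_norm (abs_linf f) = Inf ?A" using assms by (simp add: linf_norm.abs_eq linf_rel_refl)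
  have ne: "?A \<noteq> {}" using assms by (auto simp: ess_bounded_def)
  have pos: "0 \<le> B" if "B \<in> ?A" for B
  proof (rule ccontr)
    assume "\<not> 0 \<le> B"
    have "AE t in arc. cmod (f (cis t)) \<le> B" using that by simp
    then have "AE t in arc. False"
    proof eventually_elim
      case (elim t)
      then show ?case using norm_ge_zero[of "f (cis t)"] \<open>\<not> 0 \<le> B\<close> by linarith
    qed
    then show False using not_AE_arc_False by blast
  qed
  show "0 \<le> linf_norm (abs_linf f)" unfolding N by (rule cInf_greatest[OF ne pos])
  have "AE t in arc. \<forall>n. cmod (f (cis t)) < Inf ?A + 1 / real (Suc n)"
    unfolding AE_all_countable
  proof
    fix n
    have "Inf ?A < Inf ?A + 1 / real (Suc n)" by simp
    then obtain B where B: "B \<in> ?A" "B < Inf ?A + 1 / real (Suc n)"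
      using cInf_lessD[OF ne] by blast
    have "AE t in arc. cmod (f (cis t)) \<le> B" using B(1) by simp
    then show "AE t in arc. cmod (f (cis t)) < Inf ?A + 1 / real (Suc n)"
      by eventually_elim (use B(2) in linarith)
  qed
  then show "AE t in arc. cmod (f (cis t)) \<le> linf_norm (abs_linf f)"
    unfolding N
  proof eventually_elim
    case (elim t)
    have "(\<lambda>n. Inf ?A + 1 / real (Suc n)) \<longlonglongrightarrow> Inf ?A + 0"
      by (intro tendsto_intros LIMSEQ_Suc[OF lim_1_over_n])
    then have "cmod (f (cis t)) \<le> Inf ?A + 0"
      by (rule LIMSEQ_le_const) (use elim in \<open>auto intro: less_imp_le\<close>)
    then show ?case by simp
  qed
qed

section \<open>Integration over the circle and bounded Fourier matrices\<close>

lemma integrable_arc_continuous: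
  fixes g :: "real \<Rightarrow> 'b::euclidean_space"
  assumes "continuous_on UNIV g" shows "integrable arc g"
  by (rule continuous_imp_integrable_real) (rule continuous_on_subset[OF assms], simp)

lemma integrable_arc_ess_bounded:
  assumes f: "ess_bounded f" and g: "continuous_on UNIV (g :: real \<Rightarrow> complex)"
  shows "integrable arc (\<lambda>t. f (cis t) * g t)"
proof -
  obtain B where B: "AE t in arc. cmod (f (cis t)) \<le> B" using f unfolding ess_bounded_def by blast
  show ?thesis
  proof (rule Bochner_Integration.integrable_bound)
    show "integrable arc (\<lambda>t. B * cmod (g t))"
      by (intro integrable_arc_continuous continuous_intros g)
    have "g \<in> borel_measurable arc" using integrable_arc_continuous[OF g] by auto
    then show "(\<lambda>t. f (cis t) * g t) \<in> borel_measurable arc"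
      using f unfolding ess_bounded_def by (auto intro: borel_measurable_times)
    show "AE t in arc. norm (f (cis t) * g t) \<le> norm (B * cmod (g t))"
      using B
    proof eventually_elim
      case (elim t)
      have "0 \<le> B" by (rule order_trans[OF norm_ge_zero elim])
      then show ?case using elim by (simp add: norm_mult mult_right_mono)
    qed
  qed
qed

lemma continuous_cis_mult: "continuous_on S (\<lambda>t. cis (c * t))" for c :: real
  by (intro continuous_intros)

lemma integral_cis: "integral\<^sup>L arc (\<lambda>t. cis (real_of_int n * t)) = (if n = 0 then 2 * pi else 0)"
proof (cases "n = 0")
  case True
  then have "integral\<^sup>L arc (\<lambda>t. cis (real_of_int n * t)) = integral\<^sup>L arc (\<lambda>t. complex_of_real 1)" by simp
  also have "\<dots> = complex_of_real (integral\<^sup>L arc (\<lambda>t. 1))" by (rule integral_complex_of_real)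
  also have "integral\<^sup>L arc (\<lambda>t. 1 :: real) = 2 * pi"
    by (simp add: measure_restrict_space)
  finally show ?thesis using True by simp
next
  case False
  let ?F = "\<lambda>t. cis (real_of_int n * t) / (\<i> * of_int n)"
  have "((\<lambda>t. cis (real_of_int n * t)) has_integral (?F pi - ?F (- pi))) {-pi..pi}"
  proof (rule fundamental_theorem_of_calculus)
    fix t
    have "((\<lambda>t. exp (t *\<^sub>R (\<i> * of_int n))) has_vector_derivative exp (t *\<^sub>R (\<i> * of_int n)) * (\<i> * of_int n)) (at t within {-pi..pi})"
      by (rule exp_scaleR_has_vector_derivative_right)
    moreover have "exp (t *\<^sub>R (\<i> * of_int n)) = cis (real_of_int n * t)" for t
      by (simp add: cis_conv_exp scaleR_conv_of_real mult_ac)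
    ultimately have "((\<lambda>t. cis (real_of_int n * t)) has_vector_derivative cis (real_of_int n * t) * (\<i> * of_int n)) (at t within {-pi..pi})"
      by simp
    from has_vector_derivative_mult_left[OF this, of "1 / (\<i> * of_int n)"]
    show "(?F has_vector_derivative cis (real_of_int n * t)) (at t within {-pi..pi})"
      using False by simp
  qed simp
  moreover have "cis (real_of_int n * pi) = cis (real_of_int n * (- pi))"
  proof -
    have "cis (real_of_int n * pi) = cis (real_of_int n * (- pi) + 2 * pi * real_of_int n)"
      by (simp add: algebra_simps)
    also have "\<dots> = cis (real_of_int n * (- pi)) * cis (2 * pi * real_of_int n)"
      by (rule cis_mult[symmetric])
    also have "cis (2 * pi * real_of_int n) = 1" by (rule cis_multiple_2pi) simp
    finally show ?thesis by simp
  qed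
  ultimately have "integral {-pi..pi} (\<lambda>t. cis (real_of_int n * t)) = 0" by (simp add: integral_unique)
  then show ?thesis
    using False lebesgue_integral_eq_integral[OF integrable_arc_continuous[OF continuous_cis_mult[of UNIV "real_of_int n"]]]
    by simp
qed

definition trig :: "(nat \<Rightarrow> int) \<Rightarrow> nat \<Rightarrow> (nat \<Rightarrow> complex) \<Rightarrow> real \<Rightarrow> complex"
  where "trig \<tau> N x t = (\<Sum>k<N. x k * cis (real_of_int (\<tau> k) * t))"

lemma continuous_trig: "continuous_on S (trig \<tau> N x)"
  unfolding trig_def by (intro continuous_intros)

text \<open>Parseval for finite sums: injectivity of the frequencies leaves only the diagonal of the
  double sum.\<close>

lemma integral_trig_norm:
  assumes "inj \<tau>"
  shows "integral\<^sup>L arc (\<lambda>t. (cmod (trig \<tau> N x t))\<^sup>2) = 2 * pi * (\<Sum>k<N. (cmod (x k))\<^sup>2)"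
proof -
  have sq: "complex_of_real ((cmod (trig \<tau> N x t))\<^sup>2)
      = (\<Sum>k<N. \<Sum>l<N. x k * cnj (x l) * cis (real_of_int (\<tau> k - \<tau> l) * t))" for t
    unfolding complex_norm_square trig_def cnj_sum sum_product
    by (intro sum.cong refl) (simp add: cis_cnj cis_mult algebra_simps)
  have int: "integrable arc (\<lambda>t. x k * cnj (x l) * cis (real_of_int (\<tau> k - \<tau> l) * t))" for k l
    by (intro integrable_arc_continuous continuous_intros)
  have "complex_of_real (integral\<^sup>L arc (\<lambda>t. (cmod (trig \<tau> N x t))\<^sup>2))
      = integral\<^sup>L arc (\<lambda>t. \<Sum>k<N. \<Sum>l<N. x k * cnj (x l) * cis (real_of_int (\<tau> k - \<tau> l) * t))"
    unfolding sq[symmetric] by (rule integral_complex_of_real[symmetric])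
  also have "\<dots> = (\<Sum>k<N. \<Sum>l<N. integral\<^sup>L arc (\<lambda>t. x k * cnj (x l) * cis (real_of_int (\<tau> k - \<tau> l) * t)))"
    by (simp only: Bochner_Integration.integral_sum Bochner_Integration.integrable_sum int)
  also have "\<dots> = (\<Sum>k<N. \<Sum>l<N. if l = k then 2 * pi * (x k * cnj (x k)) else 0)"
    using assms by (intro sum.cong refl) (auto simp: integral_cis simp del: of_int_diff dest: injD)
  also have "\<dots> = (\<Sum>k<N. 2 * pi * (x k * cnj (x k)))" by simp
  also have "\<dots> = complex_of_real (2 * pi * (\<Sum>k<N. (cmod (x k))\<^sup>2))"
    unfolding of_real_mult of_real_sum complex_norm_square by (simp add: sum_distrib_left)
  finally show ?thesis unfolding of_real_eq_iff .
qed

text \<open>Covers Toeplitz (\<open>\<sigma> j = j\<close>, \<open>\<tau> k = k\<close>) and Hankel (\<open>\<tau> k = - k - 1\<close>) matrices at once.\<close>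

lemma fourier_matrix_bound:
  fixes \<sigma> \<tau> :: "nat \<Rightarrow> int"
  assumes \<sigma>: "inj \<sigma>" and \<tau>: "inj \<tau>"
  shows "(\<Sum>j<J. (cmod (\<Sum>k<N. fourier a (\<sigma> j - \<tau> k) * x k))\<^sup>2) \<le> (linf_norm a)\<^sup>2 * (\<Sum>k<N. (cmod (x k))\<^sup>2)"
proof -
  obtain f where f: "ess_bounded f" and a: "a = abs_linf f" by (rule linf_cases)
  define B where "B = linf_norm a"
  have B0: "0 \<le> B" and B: "AE t in arc. cmod (f (cis t)) \<le> B"
    using linf_norm_AE[OF f] by (simp_all add: a B_def)
  define z where "z j = (\<Sum>k<N. fourier a (\<sigma> j - \<tau> k) * x k)" for j
  define S where "S = (\<Sum>j<J. (cmod (z j))\<^sup>2)"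
  \<comment> \<open>Duality: \<open>?Y\<close> has the conjugated image \<open>z\<close> as
    coefficients, so integrating f times \<open>?X\<close> times \<open>?Y\<close> reproduces 2
    \<pi> \<open>S\<close>.\<close>
  let ?X = "trig \<tau> N x" and ?Y = "trig (\<lambda>j. - \<sigma> j) J (\<lambda>j. cnj (z j))"
  have \<sigma>': "inj (\<lambda>j. - \<sigma> j)" using \<sigma> by (auto simp: inj_on_def)
  have int: "integrable arc (\<lambda>t. f (cis t) * (?X t * ?Y t))"
    by (intro integrable_arc_ess_bounded f continuous_intros continuous_trig)
  have intjk: "integrable arc (\<lambda>t. f (cis t) * cis (- (real_of_int (\<sigma> j - \<tau> k) * t)) * c)" for j k c
    by (rule integrable_mult_left[OF integrable_arc_ess_bounded[OF f]]) (intro continuous_intros)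
  have "complex_of_real (2 * pi * S) = integral\<^sup>L arc (\<lambda>t. f (cis t) * (?X t * ?Y t))"
  proof -
    have "f (cis t) * (?X t * ?Y t)
        = (\<Sum>j<J. \<Sum>k<N. f (cis t) * cis (- (real_of_int (\<sigma> j - \<tau> k) * t)) * (x k * cnj (z j)))" for t
      unfolding trig_def mult.commute[of "sum _ {..<N}"] sum_product sum_distrib_left
      by (intro sum.cong refl) (simp add: cis_mult algebra_simps)
    then have "integral\<^sup>L arc (\<lambda>t. f (cis t) * (?X t * ?Y t))
        = (\<Sum>j<J. \<Sum>k<N. integral\<^sup>L arc (\<lambda>t. f (cis t) * cis (- (real_of_int (\<sigma> j - \<tau> k) * t)) * (x k * cnj (z j))))"
      by (simp only: Bochner_Integration.integral_sum Bochner_Integration.integrable_sum intjk)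
    also have "\<dots> = (\<Sum>j<J. \<Sum>k<N. 2 * pi * fourier a (\<sigma> j - \<tau> k) * (x k * cnj (z j)))"
      by (intro sum.cong refl) (simp add: a fourier_abs[OF f])
    also have "\<dots> = (\<Sum>j<J. 2 * pi * (z j * cnj (z j)))"
    proof (intro sum.cong refl)
      fix j
      have "(\<Sum>k<N. 2 * pi * fourier a (\<sigma> j - \<tau> k) * (x k * cnj (z j)))
          = (\<Sum>k<N. fourier a (\<sigma> j - \<tau> k) * x k) * (2 * pi * cnj (z j))"
        unfolding sum_distrib_right by (simp add: mult_ac)
      also have "\<dots> = 2 * pi * (z j * cnj (z j))"
        unfolding z_def[symmetric] by simp
      finally show "(\<Sum>k<N. 2 * pi * fourier a (\<sigma> j - \<tau> k) * (x k * cnj (z j))) = 2 * pi * (z j * cnj (z j))" .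
    qed
    also have "\<dots> = complex_of_real (2 * pi * S)"
      unfolding S_def of_real_mult of_real_sum complex_norm_square by (simp add: sum_distrib_left)
    finally show ?thesis ..
  qed
  then have "2 * pi * S \<le> cmod (integral\<^sup>L arc (\<lambda>t. f (cis t) * (?X t * ?Y t)))"
    by (metis norm_of_real abs_ge_self)
  also have "\<dots> \<le> integral\<^sup>L arc (\<lambda>t. cmod (f (cis t) * (?X t * ?Y t)))"
    by (rule integral_norm_bound)
  \<comment> \<open>The product is split by 2uv <= u^2 + v^2 with the weight on \<open>?X\<close>,
    so that the term from \<open>?Y\<close> equals \<pi> \<open>S\<close> and is absorbed on the
    left.\<close>
  also have "\<dots> \<le> integral\<^sup>L arc (\<lambda>t. B\<^sup>2 / 2 * (cmod (?X t))\<^sup>2 + 1 / 2 * (cmod (?Y t))\<^sup>2)"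
  proof (rule integral_mono_AE)
    show "integrable arc (\<lambda>t. cmod (f (cis t) * (?X t * ?Y t)))" using int by (rule integrable_norm)
    show "integrable arc (\<lambda>t. B\<^sup>2 / 2 * (cmod (?X t))\<^sup>2 + 1 / 2 * (cmod (?Y t))\<^sup>2)"
      by (intro integrable_arc_continuous continuous_intros continuous_trig)
    show "AE t in arc. cmod (f (cis t) * (?X t * ?Y t)) \<le> B\<^sup>2 / 2 * (cmod (?X t))\<^sup>2 + 1 / 2 * (cmod (?Y t))\<^sup>2"
      using B
    proof eventually_elim
      case (elim t)
      have "cmod (f (cis t) * (?X t * ?Y t)) \<le> B * (cmod (?X t) * cmod (?Y t))"
        unfolding norm_mult by (intro mult_right_mono elim) simp
      also have "\<dots> \<le> B\<^sup>2 / 2 * (cmod (?X t))\<^sup>2 + 1 / 2 * (cmod (?Y t))\<^sup>2"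
        using sum_squares_bound[of "B * cmod (?X t)" "cmod (?Y t)"] by (simp add: power_mult_distrib mult_ac)
      finally show ?case .
    qed
  qed
  also have "\<dots> = B\<^sup>2 / 2 * integral\<^sup>L arc (\<lambda>t. (cmod (?X t))\<^sup>2) + 1 / 2 * integral\<^sup>L arc (\<lambda>t. (cmod (?Y t))\<^sup>2)"
  proof -
    have "integrable arc (\<lambda>t. B\<^sup>2 / 2 * (cmod (?X t))\<^sup>2)" "integrable arc (\<lambda>t. 1 / 2 * (cmod (?Y t))\<^sup>2)"
      by (intro integrable_arc_continuous continuous_intros continuous_trig)+
    then show ?thesis by (simp only: Bochner_Integration.integral_add integral_mult_right_zero)
  qed
  also have "\<dots> = B\<^sup>2 / 2 * (2 * pi * (\<Sum>k<N. (cmod (x k))\<^sup>2)) + 1 / 2 * (2 * pi * S)"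
    by (simp add: integral_trig_norm[OF \<tau>] integral_trig_norm[OF \<sigma>'] S_def)
  finally have "pi * S \<le> pi * (B\<^sup>2 * (\<Sum>k<N. (cmod (x k))\<^sup>2))" by (simp add: algebra_simps)
  then show ?thesis by (simp add: S_def z_def B_def)
qed

text \<open>Uniform bounds on finite corners suffice: every row is square-summable and acts as an
  inner product, and the image coordinates inherit the bound when the truncation of the argument is
  lifted.\<close>

lemma bounded_matrix_cop:
  fixes m :: "nat \<Rightarrow> nat \<Rightarrow> complex"
  assumes C: "0 \<le> C"
    and m: "\<And>J N x. (\<Sum>j<J. (cmod (\<Sum>k<N. m j k * x k))\<^sup>2) \<le> C\<^sup>2 * (\<Sum>k<N. (cmod (x k))\<^sup>2)"
  obtains A where "\<And>j k. ent A j k = m j k"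
proof -
  \<comment> \<open>Testing with the conjugated row itself gives s^2 <= C^2 s for its partial sum s
    of squares; row \<open>j\<close> is one of the first \<open>j + 1\<close> rows.\<close>
  have row: "(\<Sum>k<N. (cmod (cnj (m j k)))\<^sup>2) \<le> C\<^sup>2" for j N
  proof -
    let ?s = "\<Sum>k<N. (cmod (m j k))\<^sup>2"
    have s0: "0 \<le> ?s" by (intro sum_nonneg) simp
    have "(\<Sum>k<N. m j k * cnj (m j k)) = complex_of_real ?s"
      unfolding of_real_sum complex_norm_square ..
    then have "(cmod (\<Sum>k<N. m j k * cnj (m j k)))\<^sup>2 = ?s\<^sup>2" by (simp only: norm_of_real power2_abs)
    moreover have "(cmod (\<Sum>k<N. m j k * cnj (m j k)))\<^sup>2 \<le> (\<Sum>j'<Suc j. (cmod (\<Sum>k<N. m j' k * cnj (m j k)))\<^sup>2)"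
      by (intro member_le_sum) auto
    ultimately have "?s * ?s \<le> C\<^sup>2 * ?s"
      using m[where J = "Suc j" and N = N and x = "\<lambda>k. cnj (m j k)"] by (simp add: power2_eq_square)
    then show ?thesis using s0 by (cases "?s = 0") auto
  qed
  have "\<exists>r. ell2_nth r = (\<lambda>k. cnj (m j k))" for j
    using ell2_exists[OF C row] by metis
  then obtain r where r: "\<And>j. ell2_nth (r j) = (\<lambda>k. cnj (m j k))" by metis
  have lim: "(\<lambda>N. \<Sum>k<N. m j k * ell2_nth x k) \<longlonglongrightarrow> cinner x (r j)" for x j
    using summable_LIMSEQ[OF cinner_summable[of x "r j"]] by (simp add: r mult.commute cinner_def)
  have bd: "(\<Sum>j<J. (cmod (cinner x (r j)))\<^sup>2) \<le> (C * norm x)\<^sup>2" for x J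
  proof (rule LIMSEQ_le_const2)
    show "(\<lambda>N. \<Sum>j<J. (cmod (\<Sum>k<N. m j k * ell2_nth x k))\<^sup>2) \<longlonglongrightarrow> (\<Sum>j<J. (cmod (cinner x (r j)))\<^sup>2)"
      by (intro tendsto_intros lim)
    have "(\<Sum>j<J. (cmod (\<Sum>k<N. m j k * ell2_nth x k))\<^sup>2) \<le> (C * norm x)\<^sup>2" for N
      using m[where J = J and N = N and x = "ell2_nth x"] mult_left_mono[OF ell2_sum_le_norm_sq[of "{..<N}" x], of "C\<^sup>2"]
      by (simp add: power_mult_distrib)
    then show "\<exists>n. \<forall>N\<ge>n. (\<Sum>j<J. (cmod (\<Sum>k<N. m j k * ell2_nth x k))\<^sup>2) \<le> (C * norm x)\<^sup>2" by blast
  qed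
  have "\<exists>y. ell2_nth y = (\<lambda>j. cinner x (r j)) \<and> norm y \<le> C * norm x" for x
    using ell2_exists[OF _ bd] C by (metis mult_nonneg_nonneg norm_ge_zero)
  then obtain g where g: "\<And>x. ell2_nth (g x) = (\<lambda>j. cinner x (r j))" "\<And>x. norm (g x) \<le> C * norm x" by metis
  have bl: "bounded_linear g"
    by (rule bounded_linear_intro[of _ C])
       (auto intro!: ell2_eqI simp: g cinner_add_left cinner_scaleR_left mult.commute)
  then have "clinear_op (Blinfun g)"
    by (auto simp: clinear_op_def bounded_linear_Blinfun_apply intro!: ell2_eqI) (simp add: g cinner_scaleC_left)
  then have "rop (Abs_cop (Blinfun g)) = Blinfun g" by (simp add: Abs_cop_inverse)
  moreover have "cinner (ell2_unit k) (r j) = m j k" for j k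
    using cinner_commute[of "ell2_unit k" "r j"] by (simp add: cinner_unit r)
  ultimately have "ent (Abs_cop (Blinfun g)) j k = m j k" for j k
    using bl by (simp add: ent_def bounded_linear_Blinfun_apply g)
  with that show thesis .
qed

lemma op_of_matrix_rop:
  assumes "\<And>j k. ent A j k = m j k"
  shows "op_of_matrix m = rop A"
  unfolding op_of_matrix_def
proof (rule the_equality)
  show "clinear_op (rop A) \<and> (\<forall>j k. op_entry (rop A) j k = m j k)"
    using rop[of A] assms by (simp add: op_entry_rop)
  fix X assume X: "clinear_op X \<and> (\<forall>j k. op_entry X j k = m j k)"
  then have XA: "rop (Abs_cop X) = X" by (simp add: Abs_cop_inverse)
  then have "ent (Abs_cop X) j k = m j k" for j k using X op_entry_rop[of "Abs_cop X"] by simp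
  then have "Abs_cop X = A" using assms by (intro ent_eqI) simp
  then show "X = rop A" using XA by simp
qed

lemma
  assumes "inj \<sigma>" "inj \<tau>" and m: "\<And>j k. m j k = fourier a (\<sigma> j - \<tau> k)"
  shows rop_op_of_matrix: "rop (Abs_cop (op_of_matrix m)) = op_of_matrix m"
    and ent_op_of_matrix: "ent (Abs_cop (op_of_matrix m)) j k = m j k"
proof -
  have "0 \<le> linf_norm a" by (rule linf_cases[of a]) (use linf_norm_AE in blast)
  then obtain A where A: "\<And>j k. ent A j k = m j k"
    using bounded_matrix_cop[of "linf_norm a" m] fourier_matrix_bound[OF assms(1,2), where a = a]
    unfolding m by metis
  show "rop (Abs_cop (op_of_matrix m)) = op_of_matrix m" "ent (Abs_cop (op_of_matrix m)) j k = m j k"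
    unfolding op_of_matrix_rop[of A m, OF A] by (simp_all add: rop_inverse A)
qed

section \<open>Toeplitz and Hankel operators in the operator algebra\<close>

definition T :: "linf \<Rightarrow> cop" where "T a = Abs_cop (toeplitz a)"
definition H :: "linf \<Rightarrow> cop" where "H a = Abs_cop (hankel a)"

lemma rop_T: "rop (T a) = toeplitz a" and ent_T: "ent (T a) j k = fourier a (int j - int k)"
  unfolding T_def toeplitz_def
  by (rule rop_op_of_matrix[where a = a] ent_op_of_matrix[where a = a]; simp add: inj_on_def; fail)+

lemma rop_H: "rop (H a) = hankel a" and ent_H: "ent (H a) j k = fourier a (int j + int k + 1)"
  unfolding H_def hankel_def
  by (rule rop_op_of_matrix[where a = a and \<sigma> = int and \<tau> = "\<lambda>k. - int k - 1"]
      ent_op_of_matrix[where a = a and \<sigma> = int and \<tau> = "\<lambda>k. - int k - 1"];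
      simp add: inj_on_def algebra_simps; fail)+

section \<open>Rules for Fourier coefficients and reflection\<close>

lemma fourier_add: "fourier (a + b) n = fourier a n + fourier b n"
proof -
  obtain f where f: "ess_bounded f" "a = abs_linf f" by (rule linf_cases)
  obtain g where g: "ess_bounded g" "b = abs_linf g" by (rule linf_cases)
  have int: "integrable arc (\<lambda>t. h (cis t) * cis (- (real_of_int n * t)))" if "ess_bounded h" for h
    by (rule integrable_arc_ess_bounded[OF that]) (intro continuous_intros)
  have "a + b = abs_linf (\<lambda>z. f z + g z)"
    using f g by (simp add: plus_linf.abs_eq linf_rel_refl)
  then show ?thesis using f g
    by (simp add: fourier_abs ess_bounded_add distrib_right int add_divide_distrib)
qed

lemma fourier_scale: "fourier (linf_const z * a) n = z * fourier a n"
proof -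
  obtain f where f: "ess_bounded f" "a = abs_linf f" by (rule linf_cases)
  have "linf_const z * a = abs_linf (\<lambda>w. z * f w)"
    using f by (simp add: linf_const.abs_eq times_linf.abs_eq linf_rel_refl ess_bounded_const)
  then show ?thesis using f
    by (simp add: fourier_abs ess_bounded_mult ess_bounded_const mult.assoc)
qed

lemma linf_uminus_eq: "- a = linf_const (- 1) * a" for a :: linf
proof -
  obtain f where f: "ess_bounded f" "a = abs_linf f" by (rule linf_cases)
  then show ?thesis
    by (simp add: uminus_linf.abs_eq linf_const.abs_eq times_linf.abs_eq linf_rel_refl ess_bounded_const)
qed

lemma fourier_diff: "fourier (a - b) n = fourier a n - fourier b n"
proof -
  have "fourier (- b) n = - fourier b n" by (subst linf_uminus_eq) (simp add: fourier_scale)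
  then show ?thesis using fourier_add[of a "- b" n] by simp
qed

lemma fourier_one: "fourier 1 n = (if n = 0 then 1 else 0)"
  using integral_cis[of "- n"]
  by (simp add: one_linf.abs_eq fourier_abs ess_bounded_const)

lemma integral_arc_reflect:
  fixes g :: "real \<Rightarrow> complex"
  assumes g: "g \<in> borel_measurable arc"
  shows "integral\<^sup>L arc (\<lambda>t. g (- t)) = integral\<^sup>L arc g"
proof -
  let ?h = "\<lambda>t. indicator {-pi..pi} t *\<^sub>R g t"
  have h: "?h \<in> borel_measurable lebesgue"
    using g by (subst (asm) borel_measurable_restrict_space_iff) auto
  have u: "uminus \<in> measurable lebesgue (lebesgue :: real measure)"
    using lebesgue_affine_measurable[where c = "\<lambda>_::real. -1" and t = 0] by simp
  have "integral\<^sup>L arc (\<lambda>t. g (- t)) = integral\<^sup>L lebesgue (\<lambda>t. indicator {-pi..pi} t *\<^sub>R g (- t))"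
    by (rule integral_restrict_space) simp
  also have "(\<lambda>t. indicator {-pi..pi} t *\<^sub>R g (- t)) = (\<lambda>t. ?h (- t))"
    by (auto simp: indicator_def fun_eq_iff)
  also have "integral\<^sup>L lebesgue (\<lambda>t. ?h (- t)) = integral\<^sup>L (distr lebesgue lebesgue uminus) ?h"
    by (rule integral_distr[OF u h, symmetric])
  also have "\<dots> = integral\<^sup>L arc g"
    unfolding lebesgue_reflect by (rule integral_restrict_space[symmetric]) simp
  finally show ?thesis .
qed

lemma fourier_tilde: "fourier (linf_tilde a) n = fourier a (- n)"
proof -
  obtain f where f: "ess_bounded f" "a = abs_linf f" by (rule linf_cases)
  let ?g = "\<lambda>t. f (cis t) * cis (- (real_of_int (- n) * t))"
  have "integrable arc ?g"
    by (rule integrable_arc_ess_bounded[OF f(1)]) (intro continuous_intros)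
  then have "integral\<^sup>L arc (\<lambda>t. ?g (- t)) = integral\<^sup>L arc ?g"
    by (intro integral_arc_reflect) auto
  then show ?thesis using f
    by (simp add: linf_tilde.abs_eq linf_rel_refl fourier_abs ess_bounded_reflect cis_inverse)
qed

lemma linf_tilde_tilde: "linf_tilde (linf_tilde a) = a"
proof -
  obtain f where f: "ess_bounded f" "a = abs_linf f" by (rule linf_cases)
  then show ?thesis by (simp add: linf_tilde.abs_eq linf_rel_refl ess_bounded_reflect)
qed

lemma linf_tilde_add: "linf_tilde (a + b) = linf_tilde a + linf_tilde b"
proof -
  obtain f where f: "ess_bounded f" "a = abs_linf f" by (rule linf_cases)
  obtain g where g: "ess_bounded g" "b = abs_linf g" by (rule linf_cases)
  show ?thesis using f g
    by (simp add: linf_tilde.abs_eq plus_linf.abs_eq linf_rel_refl ess_bounded_reflect ess_bounded_add)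
qed

lemma linf_exp_add: "linf_exp (a + b) = linf_exp a * linf_exp b"
proof -
  obtain f where f: "ess_bounded f" "a = abs_linf f" by (rule linf_cases)
  obtain g where g: "ess_bounded g" "b = abs_linf g" by (rule linf_cases)
  show ?thesis using f g
    by (simp add: linf_exp.abs_eq plus_linf.abs_eq times_linf.abs_eq linf_rel_refl ess_bounded_exp
        ess_bounded_add exp_add)
qed

section \<open>The exponential series in the function algebra\<close>

definition linf_exp_sum :: "linf \<Rightarrow> nat \<Rightarrow> linf"
  where "linf_exp_sum a n = (\<Sum>i<n. linf_const (1 / fact i) * a ^ i)"

lemma linf_power_abs: "ess_bounded f \<Longrightarrow> ess_bounded (\<lambda>z. f z ^ n) \<and> abs_linf f ^ n = abs_linf (\<lambda>z. f z ^ n)"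
proof (induction n)
  case 0 then show ?case by (simp add: one_linf.abs_eq ess_bounded_const)
next
  case (Suc n) then show ?case by (simp add: times_linf.abs_eq linf_rel_refl ess_bounded_mult)
qed

lemma linf_exp_sum_abs:
  assumes "ess_bounded f"
  shows "ess_bounded (\<lambda>z. \<Sum>i<n. 1 / fact i * f z ^ i) \<and>
    linf_exp_sum (abs_linf f) n = abs_linf (\<lambda>z. \<Sum>i<n. 1 / fact i * f z ^ i)"
proof (induction n)
  case 0 then show ?case by (simp add: linf_exp_sum_def zero_linf.abs_eq ess_bounded_const)
next
  case (Suc n)
  have "linf_const (1 / fact n) * abs_linf f ^ n = abs_linf (\<lambda>z. 1 / fact n * f z ^ n)"
    and e: "ess_bounded (\<lambda>z. 1 / fact n * f z ^ n)"
    using linf_power_abs[OF assms, of n]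
      ess_bounded_mult[OF ess_bounded_const, of "\<lambda>z. f z ^ n" "1 / fact n"]
    by (simp_all add: linf_const.abs_eq times_linf.abs_eq linf_rel_refl ess_bounded_const)
  then show ?case using Suc ess_bounded_add[OF conjunct1[OF Suc] e]
    by (simp add: linf_exp_sum_def plus_linf.abs_eq linf_rel_refl)
qed

text \<open>\<open>linf_exp\<close> is defined pointwise, whereas membership in the algebra comes
  from the power series. Convergence in the essential supremum norm implies convergence almost
  everywhere, where the partial sums tend to the pointwise exponential.\<close>

lemma linf_exp_limit:
  assumes "(\<lambda>n. linf_norm (linf_exp_sum a n - e)) \<longlonglongrightarrow> 0"
  shows "e = linf_exp a"
proof -
  obtain f where f: "ess_bounded f" "a = abs_linf f" by (rule linf_cases)
  obtain g where g: "ess_bounded g" "e = abs_linf g" by (rule linf_cases)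
  define s where "s n z = (\<Sum>i<n. 1 / fact i * f z ^ i)" for n z
  have s: "ess_bounded (s n)" "linf_exp_sum a n = abs_linf (s n)" for n
    using linf_exp_sum_abs[OF f(1), of n] unfolding s_def[abs_def] f(2) by auto
  have d: "linf_exp_sum a n - e = abs_linf (\<lambda>z. s n z - g z)" "ess_bounded (\<lambda>z. s n z - g z)" for n
    using s g by (simp_all add: minus_linf.abs_eq linf_rel_refl ess_bounded_diff)
  have "AE t in arc. \<forall>n. cmod (s n (cis t) - g (cis t)) \<le> linf_norm (linf_exp_sum a n - e)"
    unfolding AE_all_countable using linf_norm_AE(2)[OF d(2)] unfolding d(1) by blast
  then have "AE t in arc. g (cis t) = exp (f (cis t))"
  proof eventually_elim
    case (elim t)
    have "(\<lambda>n. s n (cis t) - g (cis t)) \<longlonglongrightarrow> 0"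
      by (rule Lim_null_comparison[OF always_eventually assms]) (use elim in auto)
    then have "(\<lambda>n. s n (cis t) - g (cis t) + g (cis t)) \<longlonglongrightarrow> 0 + g (cis t)"
      by (intro tendsto_add tendsto_const)
    moreover have "(\<lambda>n. s n (cis t)) \<longlonglongrightarrow> exp (f (cis t))"
      using exp_converges[of "f (cis t)"]
      unfolding sums_def s_def by (simp add: scaleR_conv_of_real field_simps)
    ultimately show ?case by (simp add: LIMSEQ_unique)
  qed
  then have "linf_rel g (\<lambda>z. exp (f z))"
    using f g by (simp add: linf_rel_def ess_bounded_exp)
  then show ?thesis using f g by (simp add: linf_exp.abs_eq linf_rel_refl abs_linf_eqI)
qed

context circle_algebra
begin

lemma uminus_mem: "a \<in> S \<Longrightarrow> - a \<in> S"
  by (subst linf_uminus_eq) (rule scale_mem)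

lemma diff_mem: "a \<in> S \<Longrightarrow> b \<in> S \<Longrightarrow> a - b \<in> S"
  using add_mem[of a "- b"] uminus_mem by simp

lemma zero_mem: "0 \<in> S"
  using diff_mem[OF one_mem one_mem] by simp

lemma power_mem: "a \<in> S \<Longrightarrow> a ^ n \<in> S"
  by (induction n) (auto intro: one_mem mult_mem)

lemma exp_sum_mem: "a \<in> S \<Longrightarrow> linf_exp_sum a n \<in> S"
  unfolding linf_exp_sum_def
  by (induction n) (auto intro: zero_mem add_mem scale_mem power_mem)

lemma tilde_mem: "a \<in> S \<Longrightarrow> linf_tilde a \<in> S"
  using reflection by blast

lemma nrm_uminus: "a \<in> S \<Longrightarrow> nrm (- a) = nrm a"
  using nrm_scale[of a "- 1"] by (simp add: linf_uminus_eq[of a])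

text \<open>The factor \<open>nrm 1\<close> accounts for the power zero, as the unit may have a norm
  other than 1.\<close>

lemma nrm_power: "a \<in> S \<Longrightarrow> nrm (a ^ n) \<le> nrm 1 * nrm a ^ n"
proof (induction n)
  case (Suc n)
  have "nrm (a ^ n * a) \<le> nrm (a ^ n) * nrm a" using Suc.prems by (intro nrm_mult power_mem)
  also have "\<dots> \<le> nrm 1 * nrm a ^ n * nrm a"
    using Suc by (intro mult_right_mono nrm_nonneg)
  finally show ?case by (simp add: mult_ac)
qed simp

lemma exp_sum_diff:
  assumes a: "a \<in> S"
  shows "nrm (linf_exp_sum a (n + k) - linf_exp_sum a n) \<le> nrm 1 * (\<Sum>i\<in>{n..<n + k}. nrm a ^ i / fact i)"
proof (induction k)
  case 0 then show ?case using nrm_eq_0[OF zero_mem] by simp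
next
  case (Suc k)
  let ?t = "linf_const (1 / fact (n + k)) * a ^ (n + k)"
  have t: "?t \<in> S" by (intro scale_mem power_mem a)
  have "linf_exp_sum a (n + Suc k) - linf_exp_sum a n = (linf_exp_sum a (n + k) - linf_exp_sum a n) + ?t"
    by (simp add: linf_exp_sum_def)
  then have "nrm (linf_exp_sum a (n + Suc k) - linf_exp_sum a n) \<le> nrm (linf_exp_sum a (n + k) - linf_exp_sum a n) + nrm ?t"
    by (simp only:) (intro nrm_add diff_mem exp_sum_mem t a)
  also have "nrm ?t = 1 / fact (n + k) * nrm (a ^ (n + k))"
    using nrm_scale[OF power_mem[OF a], of "1 / fact (n + k)"] by (simp add: norm_divide)
  also have "\<dots> \<le> 1 / fact (n + k) * (nrm 1 * nrm a ^ (n + k))"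
    by (intro mult_left_mono nrm_power a) simp
  also have "1 / fact (n + k) * (nrm 1 * nrm a ^ (n + k)) = nrm 1 * (nrm a ^ (n + k) / fact (n + k))" by simp
  finally show ?case using Suc by (simp add: distrib_left)
qed

text \<open>Completeness supplies a limit of the partial sums within the algebra; through the
  continuous embedding it is also a limit in the essential supremum norm and thus the pointwise
  exponential.\<close>

lemma exp_mem_limit:
  assumes a: "a \<in> S"
  shows "linf_exp a \<in> S" "(\<lambda>n. nrm (linf_exp_sum a n - linf_exp a)) \<longlonglongrightarrow> 0"
proof -
  have sm: "summable (\<lambda>i. nrm a ^ i / fact i)"
    using summable_exp[of "nrm a"] by (simp add: field_simps)
  have ge: "nrm (linf_exp_sum a m - linf_exp_sum a n) \<le> nrm 1 * norm (\<Sum>i\<in>{n..<m}. nrm a ^ i / fact i)"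
    if "n \<le> m" for m n
    using exp_sum_diff[OF a, of n "m - n"] that nrm_nonneg[OF a]
    by (simp add: sum_nonneg abs_of_nonneg)
  have "\<forall>e>0. \<exists>N. \<forall>m\<ge>N. \<forall>n\<ge>N. nrm (linf_exp_sum a m - linf_exp_sum a n) < e"
  proof (intro allI impI)
    fix e :: real assume e: "e > 0"
    define d where "d = e / (nrm 1 + 1)"
    have n1: "nrm 1 \<ge> 0" by (rule nrm_nonneg[OF one_mem])
    have d: "d > 0" "nrm 1 * d < e" using e n1 by (auto simp: d_def field_simps)
    obtain N where N: "\<And>m n. m \<ge> N \<Longrightarrow> norm (\<Sum>i\<in>{m..<n}. nrm a ^ i / fact i) < d"
      using sm d(1) unfolding summable_Cauchy by blast
    have *: "nrm (linf_exp_sum a m - linf_exp_sum a n) < e" if "n \<ge> N" "n \<le> m" for m n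
    proof -
      have "nrm (linf_exp_sum a m - linf_exp_sum a n) \<le> nrm 1 * d"
        using ge[OF that(2)] mult_left_mono[OF less_imp_le[OF N[OF that(1), of m]] n1] by linarith
      then show ?thesis using d by simp
    qed
    have "nrm (linf_exp_sum a m - linf_exp_sum a n) < e" if "m \<ge> N" "n \<ge> N" for m n
    proof (cases "n \<le> m")
      case False
      then have "nrm (linf_exp_sum a n - linf_exp_sum a m) < e" using * that by simp
      then show ?thesis
        using nrm_uminus[OF diff_mem[OF exp_sum_mem exp_sum_mem], OF a a, of n m] by simp
    qed (use * that in simp)
    then show "\<exists>N. \<forall>m\<ge>N. \<forall>n\<ge>N. nrm (linf_exp_sum a m - linf_exp_sum a n) < e" by blast
  qed
  from complete[OF exp_sum_mem[OF a] this]
  obtain e where e: "e \<in> S" "(\<lambda>n. nrm (linf_exp_sum a n - e)) \<longlonglongrightarrow> 0" by blast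
  obtain K where K: "\<And>x. x \<in> S \<Longrightarrow> linf_norm x \<le> K * nrm x" using embedding by blast
  have "(\<lambda>n. linf_norm (linf_exp_sum a n - e)) \<longlonglongrightarrow> 0"
  proof (rule tendsto_sandwich[OF always_eventually always_eventually tendsto_const])
    show "(\<lambda>n. K * nrm (linf_exp_sum a n - e)) \<longlonglongrightarrow> 0"
      using tendsto_mult_left[OF e(2), of K] by simp
    show "\<forall>n. 0 \<le> linf_norm (linf_exp_sum a n - e)"
    proof
      fix n obtain g where "ess_bounded g" "linf_exp_sum a n - e = abs_linf g" by (rule linf_cases)
      then show "0 \<le> linf_norm (linf_exp_sum a n - e)" using linf_norm_AE(1) by simp
    qed
  qed (use K diff_mem exp_sum_mem a e in blast)
  then have "e = linf_exp a" by (rule linf_exp_limit)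
  then show "linf_exp a \<in> S" "(\<lambda>n. nrm (linf_exp_sum a n - linf_exp a)) \<longlonglongrightarrow> 0" using e by simp_all
qed

lemma positive_part:
  assumes a: "a \<in> S"
  obtains p where "p \<in> S" "\<And>n. fourier p n = (if n > 0 then fourier a n else 0)"
proof -
  obtain q where q: "q \<in> S" "\<And>n. fourier q n = (if n \<ge> 0 then fourier a n else 0)"
    using riesz a by blast
  \<comment> \<open>The Riesz projection keeps the zeroth coefficient, which is removed by
    subtracting a constant.\<close>
  let ?p = "q - linf_const (fourier a 0) * 1"
  have "?p \<in> S" by (intro diff_mem scale_mem q one_mem)
  moreover have "fourier ?p n = (if n > 0 then fourier a n else 0)" for n
    unfolding fourier_diff fourier_scale fourier_one q(2) by auto
  ultimately show thesis using that by blast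
qed

end

section \<open>Commutators and products of Toeplitz operators\<close>

lemma nuc_diff: "nuc X r \<Longrightarrow> nuc Y s \<Longrightarrow> nuc (X - Y) (r + s)"
  using nuc_add[of X r "- Y" s] nuc_scaleR[of Y s "- 1"] by simp

lemma T_one: "T 1 = 1"
  by (rule ent_eqI) (simp add: ent_T fourier_one)

text \<open>The entry (j, k) of T(q) T(p) is the sum of p_m q_{j-k-m} over all m >= 0. In T(p) T(q),
  where T(p) is lower triangular, the same sum stops at m = j. The tail m > j is the Hankel
  product.\<close>

lemma T_commutator:
  assumes p: "\<And>n. n \<le> 0 \<Longrightarrow> fourier p n = 0"
  shows "T q * T p - T p * T q = H p * H (linf_tilde q)"
proof (rule ent_eqI)
  fix j k
  define s where "s m = fourier p (int m) * fourier q (int j - int k - int m)" for m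
  have 1: "(\<lambda>l. ent (T q) j l * ent (T p) l k) sums ent (T q * T p) j k"
    and 2: "(\<lambda>l. ent (T p) j l * ent (T q) l k) sums ent (T p * T q) j k"
    and 3: "(\<lambda>l. ent (H p) j l * ent (H (linf_tilde q)) l k) sums ent (H p * H (linf_tilde q)) j k"
    by (rule ent_mult_sums)+
  have s1: "s sums (ent (T q * T p) j k)"
  proof -
    have "(\<lambda>l. ent (T q) j (l + k) * ent (T p) (l + k) k) = s"
      by (simp add: fun_eq_iff ent_T s_def algebra_simps)
    moreover have "(\<Sum>l<k. ent (T q) j l * ent (T p) l k) = 0"
      by (rule sum.neutral) (simp add: ent_T p)
    ultimately show ?thesis using sums_split_initial_segment[OF 1, of k] by simp
  qed
  have s2: "(\<Sum>m<Suc j. s m) = ent (T p * T q) j k"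
  proof -
    have "(\<lambda>l. ent (T p) j l * ent (T q) l k) sums (\<Sum>l<Suc j. ent (T p) j l * ent (T q) l k)"
      by (rule sums_finite) (auto simp: ent_T p)
    then have "ent (T p * T q) j k = (\<Sum>l<Suc j. ent (T p) j l * ent (T q) l k)"
      using 2 sums_unique2 by blast
    also have "\<dots> = (\<Sum>l<Suc j. ent (T p) j (Suc j - Suc l) * ent (T q) (Suc j - Suc l) k)"
      by (rule sum.nat_diff_reindex[symmetric])
    also have "\<dots> = (\<Sum>l<Suc j. s l)"
      by (rule sum.cong) (auto simp: ent_T s_def of_nat_diff algebra_simps)
    finally show ?thesis ..
  qed
  have "(\<lambda>m. s (m + Suc j)) sums ent (H p * H (linf_tilde q)) j k"
    using 3 by (simp add: ent_H s_def fourier_tilde algebra_simps)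
  from sums_unique2[OF this sums_split_initial_segment[OF s1, of "Suc j"]]
  show "ent (T q * T p - T p * T q) j k = ent (H p * H (linf_tilde q)) j k"
    unfolding s2 by simp
qed

text \<open>Both matrices are upper triangular, so an entry of the product is a finite convolution
  over l from j to k, symmetric under l -> j + k - l.\<close>

lemma T_commute_lower:
  assumes p: "\<And>n. n > 0 \<Longrightarrow> fourier p n = 0" and q: "\<And>n. n > 0 \<Longrightarrow> fourier q n = 0"
  shows "T p * T q = T q * T p"
proof (rule ent_eqI)
  fix j k
  have *: "ent (T a * T b) j k = (\<Sum>l\<in>{j..k}. fourier a (int j - int l) * fourier b (int l - int k))"
    if "\<And>n. n > 0 \<Longrightarrow> fourier a n = 0" "\<And>n. n > 0 \<Longrightarrow> fourier b n = 0" for a b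
  proof -
    have "(\<lambda>l. ent (T a) j l * ent (T b) l k) sums (\<Sum>l\<in>{j..k}. ent (T a) j l * ent (T b) l k)"
      by (rule sums_finite) (auto simp: ent_T that not_le)
    from sums_unique2[OF this ent_mult_sums] show ?thesis by (simp add: ent_T)
  qed
  have "(\<Sum>l\<in>{j..k}. fourier p (int j - int l) * fourier q (int l - int k))
      = (\<Sum>l\<in>{j..k}. fourier p (int j - int (k + j - l)) * fourier q (int (k + j - l) - int k))"
    by (rule sum.atLeastAtMost_rev)
  also have "\<dots> = (\<Sum>l\<in>{j..k}. fourier q (int j - int l) * fourier p (int l - int k))"
    by (rule sum.cong) (auto simp: of_nat_diff mult.commute)
  finally show "ent (T p * T q) j k = ent (T q * T p) j k" by (simp only: *[OF p q] *[OF q p])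
qed

text \<open>\<open>T(f) T(c) + H(f) H(c)\<close> is a Toeplitz matrix. If it differs from \<open>T(g)\<close> by a nuclear operator
  plus \<open>H(f) H(c)\<close>, both of which have entries vanishing along diagonals, then it equals \<open>T(g)\<close>.
  This replaces the convolution theorem for Fourier coefficients.\<close>

lemma hankel_product_nuclear:
  assumes N: "nuc (T g - T f * T c) r" and c: "linf_tilde c = c"
  shows "nuc (H f * H c) r"
proof -
  define W where "W = T g - T f * T c - H f * H c"
  have shift: "ent W (Suc j) (Suc k) = ent W j k" for j k
  proof -
    let ?h = "\<lambda>j k l. ent (H f) j l * ent (H c) l k" and ?t = "\<lambda>j k l. ent (T f) j l * ent (T c) l k"
    have h: "?h j k sums ent (H f * H c) j k" and t: "?t j k sums ent (T f * T c) j k" for j k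
      by (rule ent_mult_sums)+
    have cs: "fourier c n = fourier c (- n)" for n using fourier_tilde[of c n] c by simp
    \<comment> \<open>One step down a diagonal, the Toeplitz product gains the term l = 0 and the
      Hankel product loses its term l = 0; evenness of \<open>c\<close> makes the two agree.\<close>
    have e: "?t (Suc j) (Suc k) 0 = ?h j k 0" 
      using cs[of "1 + int k"] by (simp add: ent_T ent_H algebra_simps)
    have "(\<lambda>l. ?t (Suc j) (Suc k) (Suc l)) = ?t j k" by (simp add: fun_eq_iff ent_T)
    then have "?t j k sums (ent (T f * T c) (Suc j) (Suc k) - ?t (Suc j) (Suc k) 0)"
      using sums_split_initial_segment[OF t[of "Suc j" "Suc k"], of 1] by simp
    then have T: "ent (T f * T c) (Suc j) (Suc k) = ent (T f * T c) j k + ?h j k 0"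
      using sums_unique2[OF t[of j k]] e by (simp add: algebra_simps)
    have "(\<lambda>l. ?h j k (Suc l)) = ?h (Suc j) (Suc k)" by (simp add: fun_eq_iff ent_H algebra_simps)
    then have "?h (Suc j) (Suc k) sums (ent (H f * H c) j k - ?h j k 0)"
      using sums_split_initial_segment[OF h[of j k], of 1] by simp
    then have "ent (H f * H c) (Suc j) (Suc k) = ent (H f * H c) j k - ?h j k 0"
      using sums_unique2[OF h[of "Suc j" "Suc k"]] by blast
    then show ?thesis using T by (simp add: W_def ent_T)
  qed
  have const: "ent W (j + n) (k + n) = ent W j k" for j k n
    by (induction n) (simp_all add: shift)
  have ent_le: "cmod (ent X j k) \<le> norm (rop X (ell2_unit k))" for X j k
    unfolding ent_def by (rule ell2_nth_le_norm)
  have limN: "(\<lambda>n. ent (T g - T f * T c) (j + n) (k + n)) \<longlonglongrightarrow> 0" for j k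
  proof (rule LIMSEQ_I)
    fix e :: real assume e: "e > 0"
    \<comment> \<open>Rows from \<open>N0\<close> on are unaffected by the factor
      \<open>1 - pr N0\<close>, so their entries are bounded by the small norm.\<close>
    then obtain N0 where N0: "nuc ((1 - pr N0) * (T g - T f * T c)) (e / 2)"
      using nuc_tail[OF N, of "e / 2"] by auto
    have "norm (ent (T g - T f * T c) (j + n) (k + n) - 0) < e" if "n \<ge> N0" for n
    proof -
      let ?X = "(1 - pr N0) * (T g - T f * T c)"
      have "ent (T g - T f * T c) (j + n) (k + n) = ent ?X (j + n) (k + n)"
        using that by (simp only: left_diff_distrib ent_simps ent_pr_left mult_1_left) simp
      also have "cmod \<dots> \<le> norm ?X"
        using order_trans[OF ent_le rop_bound, of ?X "j + n" "k + n"] by simp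
      also have "\<dots> \<le> e / 2" by (rule nuc_norm_le[OF N0])
      finally show ?thesis using e by simp
    qed
    then show "\<exists>n0. \<forall>n\<ge>n0. norm (ent (T g - T f * T c) (j + n) (k + n) - 0) < e" by blast
  qed
  have limH: "(\<lambda>n. ent (H f * H c) (j + n) (k + n)) \<longlonglongrightarrow> 0" for j k
  proof -
    \<comment> \<open>Column k + n of a Hankel matrix is column k shifted up by n, so its squared
      norm is a tail of a convergent series.\<close>
    let ?v = "\<lambda>i. (cmod (ell2_nth (rop (H c) (ell2_unit k)) i))\<^sup>2"
    have "(norm (rop (H c) (ell2_unit (k + n))))\<^sup>2 = (\<Sum>i. ?v (i + n))" for n
      unfolding ell2_norm_sq using ent_H[of c] by (simp add: ent_def algebra_simps)
    then have "(\<lambda>n. sqrt ((norm (rop (H c) (ell2_unit (k + n))))\<^sup>2)) \<longlonglongrightarrow> sqrt 0"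
      using suminf_exist_split2[OF ell2_summable_sq[of "rop (H c) (ell2_unit k)"]]
      by (intro tendsto_real_sqrt) simp
    then have "(\<lambda>n. norm (rop (H c) (ell2_unit (k + n)))) \<longlonglongrightarrow> 0" by simp
    from tendsto_mult_left[OF this, of "norm (H f)"]
    have lim: "(\<lambda>n. norm (H f) * norm (rop (H c) (ell2_unit (k + n)))) \<longlonglongrightarrow> 0" by simp
    have "cmod (ent (H f * H c) (j + n) (k + n)) \<le> norm (H f) * norm (rop (H c) (ell2_unit (k + n)))" for n
      using order_trans[OF ent_le[of "H f * H c" "j + n" "k + n"]] rop_bound[of "H f" "rop (H c) (ell2_unit (k + n))"]
      by simp
    then show ?thesis by (intro Lim_null_comparison[OF always_eventually[OF allI] lim])
  qed
  have "W = 0"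
  proof (rule ent_eqI)
    fix j k
    have "(\<lambda>n. ent W (j + n) (k + n)) \<longlonglongrightarrow> 0 - 0"
      using tendsto_diff[OF limN limH] by (simp add: W_def)
    then show "ent W j k = ent 0 j k" by (simp add: const LIMSEQ_const_iff)
  qed
  then have "H f * H c = T g - T f * T c" by (simp add: W_def)
  then show ?thesis using N by simp
qed

section \<open>Compatible pairs\<close>

lemma linf_tilde_one: "linf_tilde 1 = 1"
  by (simp add: one_linf.abs_eq linf_tilde.abs_eq linf_rel_refl ess_bounded_const)

context compatible_pair
begin

definition Mc :: "linf \<Rightarrow> cop" where "Mc a = Abs_cop (M a)"

lemma rop_Mc: "a \<in> S \<Longrightarrow> rop (Mc a) = M a"
  using M_clinear_op by (simp add: Mc_def Abs_cop_inverse)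

lemma Mc_add: "a \<in> S \<Longrightarrow> b \<in> S \<Longrightarrow> Mc (a + b) = Mc a + Mc b"
  by (rule cop_eqI) (simp add: rop_Mc add_mem M_add blinfun.add_left)

lemma Mc_scale: "a \<in> S \<Longrightarrow> Mc (linf_const (of_real r) * a) = r *\<^sub>R Mc a"
  by (rule cop_eqI) (simp add: rop_Mc scale_mem M_scale ell2_scaleC_of_real)

lemma Mc_diff:
  assumes "a \<in> S" "b \<in> S" shows "Mc (a - b) = Mc a - Mc b"
  using Mc_add[OF assms(1) uminus_mem[OF assms(2)]] Mc_scale[OF assms(2), of "- 1"]
  by (simp add: linf_uminus_eq[of b, symmetric])

lemma Mc_one: "Mc 1 = 1"
  by (rule cop_eqI) (simp add: rop_Mc one_mem M_one)

lemma Mc_mult: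
  assumes "a \<in> S" "\<And>n. n > 0 \<Longrightarrow> fourier a n = 0" "b \<in> S" "c \<in> S" "linf_tilde c = c"
  shows "Mc (a * b * c) = T a * Mc b * Mc c"
  using M_mult[of a b c] assms
  by (intro cop_eqI) (simp add: rop_Mc mult_mem rop_T)

lemma Mc_mult_lower:
  assumes "a \<in> S" "\<And>n. n > 0 \<Longrightarrow> fourier a n = 0" "b \<in> S"
  shows "Mc (a * b) = T a * Mc b"
  using Mc_mult[OF assms one_mem linf_tilde_one] by (simp add: Mc_one)

lemma Mc_mult_even:
  assumes "b \<in> S" "c \<in> S" "linf_tilde c = c"
  shows "Mc (b * c) = Mc b * Mc c"
  using Mc_mult[OF one_mem _ assms] by (simp add: fourier_one T_one)

lemma Mc_nuclear:
  assumes "a \<in> S" obtains r where "nuc (Mc a - T a) r"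
proof -
  have "trace_class (M a - toeplitz a)" using M_trace_class assms by blast
  then obtain Z r where Z: "rop Z = M a - toeplitz a" "nuc Z r" using trace_class_nuc by blast
  then have "Z = Mc a - T a" using assms by (intro cop_eqI) (simp add: rop_Mc rop_T blinfun.diff_left)
  with Z that show thesis by blast
qed

text \<open>Continuity of \<open>M\<close> carries the identity for powers over to the exponential
  series. The right factor \<open>x\<close> holds what has been exponentiated before;
  \<open>pow\<close> at i = 0 makes \<open>Y\<close> equal to \<open>Mc x\<close>.\<close>

lemma Mc_exp:
  assumes a: "a \<in> S" and x: "x \<in> S" and pow: "\<And>i. Mc (a ^ i * x) = Z ^ i * Y"
  shows "Mc (linf_exp a * x) = exp Z * Y"
proof -
  have part: "Mc (linf_exp_sum a n * x) = (\<Sum>i<n. Z ^ i /\<^sub>R fact i) * Y" for n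
  proof (induction n)
    case 0
    have "Mc 0 = 0" using Mc_diff[OF one_mem one_mem] by simp
    then show ?case by (simp add: linf_exp_sum_def)
  next
    case (Suc n)
    have "linf_const (1 / fact n) * a ^ n * x = linf_const (of_real (inverse (fact n))) * (a ^ n * x)"
      by (simp add: mult.assoc field_simps)
    then have "Mc (linf_const (1 / fact n) * a ^ n * x) = (Z ^ n * Y) /\<^sub>R fact n"
      using Mc_scale[of "a ^ n * x" "inverse (fact n)"] a x
      by (simp add: pow mult_mem power_mem)
    moreover have "linf_exp_sum a (Suc n) * x = linf_exp_sum a n * x + linf_const (1 / fact n) * a ^ n * x"
      by (simp add: linf_exp_sum_def distrib_right)
    ultimately show ?case
      using Mc_add[of "linf_exp_sum a n * x" "linf_const (1 / fact n) * a ^ n * x"] Suc a x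
      by (simp add: mult_mem exp_sum_mem scale_mem power_mem distrib_right)
  qed
  have e: "linf_exp a \<in> S" by (rule exp_mem_limit(1)[OF a])
  obtain K where K: "\<And>y. y \<in> S \<Longrightarrow> norm (M y) \<le> K * nrm y" using M_bounded by blast
  have bound: "norm (Mc (linf_exp_sum a n * x) - Mc (linf_exp a * x)) \<le> \<bar>K\<bar> * nrm x * nrm (linf_exp_sum a n - linf_exp a)" for n
  proof -
    let ?d = "linf_exp_sum a n - linf_exp a"
    have d: "?d \<in> S" by (intro diff_mem exp_sum_mem a e)
    have "Mc (linf_exp_sum a n * x) - Mc (linf_exp a * x) = Mc (?d * x)"
      using Mc_diff[of "linf_exp_sum a n * x" "linf_exp a * x"] a x e
      by (simp add: mult_mem exp_sum_mem left_diff_distrib)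
    also have "norm \<dots> \<le> K * nrm (?d * x)"
      using K[OF mult_mem[OF d x]] by (simp add: norm_cop.rep_eq rop_Mc mult_mem d x)
    also have "\<dots> \<le> \<bar>K\<bar> * nrm (?d * x)" by (intro mult_right_mono nrm_nonneg mult_mem d x) simp
    also have "\<dots> \<le> \<bar>K\<bar> * (nrm ?d * nrm x)" by (intro mult_left_mono nrm_mult d x) simp
    finally show ?thesis by (simp add: mult_ac)
  qed
  have "(\<lambda>n. \<bar>K\<bar> * nrm x * nrm (linf_exp_sum a n - linf_exp a)) \<longlonglongrightarrow> 0"
    using tendsto_mult_left[OF exp_mem_limit(2)[OF a], of "\<bar>K\<bar> * nrm x"] by simp
  then have "(\<lambda>n. Mc (linf_exp_sum a n * x) - Mc (linf_exp a * x)) \<longlonglongrightarrow> 0"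
    by (rule Lim_null_comparison[OF always_eventually[OF allI[OF bound]]])
  then have "(\<lambda>n. Mc (linf_exp_sum a n * x)) \<longlonglongrightarrow> Mc (linf_exp a * x)"
    by (rule LIM_zero_cancel)
  moreover have "(\<lambda>n. Mc (linf_exp_sum a n * x)) \<longlonglongrightarrow> exp Z * Y"
  proof -
    have "(\<lambda>n. \<Sum>i<n. Z ^ i /\<^sub>R fact i) \<longlonglongrightarrow> exp Z"
      using exp_converges[of Z] by (simp add: sums_def)
    then show ?thesis unfolding part by (intro tendsto_mult tendsto_const)
  qed
  ultimately show ?thesis by (rule LIMSEQ_unique)
qed

text \<open>Adding its reflection to the positive part keeps the positive coefficients. Hankel
  matrices see only these, so a Hankel symbol may be taken even, which is where \<open>M\<close> is
  multiplicative from the right.\<close>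

lemma even_extension:
  assumes "g \<in> S"
  obtains c where "c \<in> S" "linf_tilde c = c" "\<And>n. n > 0 \<Longrightarrow> fourier c n = fourier g n"
proof -
  obtain p where p: "p \<in> S" "\<And>n. fourier p n = (if n > 0 then fourier g n else 0)"
    using positive_part assms by blast
  let ?c = "p + linf_tilde p"
  have "linf_tilde ?c = ?c" by (simp add: linf_tilde_add linf_tilde_tilde add.commute)
  moreover have "fourier ?c n = fourier g n" if "n > 0" for n
    using that by (simp add: fourier_add fourier_tilde p(2))
  ultimately show thesis using that add_mem p(1) tilde_mem by blast
qed

lemma H_cong: "(\<And>n. n > 0 \<Longrightarrow> fourier a n = fourier b n) \<Longrightarrow> H a = H b"
  by (rule ent_eqI) (simp add: ent_H)

text \<open>With an even \<open>c\<close> in place of \<open>g\<close>, M(fc) = M(f) M(c). As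
  \<open>M\<close> differs from \<open>T\<close> by nuclear operators, T(fc) - T(f) T(c) is nuclear,
  and \<open>hankel_product_nuclear\<close> passes this on to the Hankel product.\<close>

lemma H_mult_nuclear:
  assumes f: "f \<in> S" and g: "g \<in> S"
  obtains r where "nuc (H f * H g) r"
proof -
  obtain c where c: "c \<in> S" "linf_tilde c = c" "\<And>n. n > 0 \<Longrightarrow> fourier c n = fourier g n"
    using even_extension g by blast
  obtain r1 r2 r3 where r: "nuc (Mc f - T f) r1" "nuc (Mc c - T c) r2" "nuc (Mc (f * c) - T (f * c)) r3"
    using Mc_nuclear[OF f] Mc_nuclear[OF c(1)] Mc_nuclear[OF mult_mem[OF f c(1)]] by metis
  have "T (f * c) - T f * T c = (Mc f - T f) * Mc c + T f * (Mc c - T c) - (Mc (f * c) - T (f * c))"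
    unfolding Mc_mult_even[OF f c(1,2)] by (simp add: algebra_simps)
  then have "\<exists>r. nuc (T (f * c) - T f * T c) r"
    using nuc_diff[OF nuc_add[OF nuc_mult_right[OF r(1)] nuc_mult_left[OF r(2)]] r(3)] by metis
  then obtain r where "nuc (H f * H c) r" using hankel_product_nuclear[OF _ c(2)] by blast
  moreover have "H c = H g" by (rule H_cong) (rule c(3))
  ultimately show thesis using that by simp
qed

lemma section_asymptotics:
  assumes b: "b \<in> S"
  shows "(\<lambda>N. section_det N (M (linf_exp b)) / (G_const b ^ N * E_hat M b)) \<longlonglongrightarrow> 1"
proof -
  obtain p where p: "p \<in> S" "\<And>n. fourier p n = (if n > 0 then fourier b n else 0)"
    using positive_part b by blast
  define c d f where "c = p + linf_tilde p" and "d = b - c" and "f = b - p"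
  have c: "c \<in> S" "linf_tilde c = c"
    by (simp_all add: c_def add_mem p(1) tilde_mem linf_tilde_add linf_tilde_tilde add.commute)
  have d: "d \<in> S" and f: "f \<in> S" using b c p(1) by (simp_all add: d_def f_def diff_mem)
  have d_low: "fourier d n = 0" and f_low: "fourier f n = 0" if "n > 0" for n
    using that by (simp_all add: d_def f_def c_def fourier_diff fourier_add fourier_tilde p(2))
  obtain r where "nuc (Mc b - T b) r" using Mc_nuclear b by blast
  then have "\<exists>K. cop_of K = Mc b - T b" using Abs_nucl_inverse[of "Mc b - T b"] by blast
  then obtain K where K: "cop_of K = Mc b - T b" by blast
  have Hnuc: "\<exists>Z. cop_of Z = H x * H y" if xy: "x \<in> S" "y \<in> S" for x y
  proof -
    obtain r where "nuc (H x * H y) r" by (rule H_mult_nuclear[OF xy])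
    then show ?thesis using Abs_nucl_inverse[of "H x * H y"] by blast
  qed
  obtain P1 P2 where P: "cop_of P1 = H b * H b" "cop_of P2 = H b * H (linf_tilde b)"
    using Hnuc b tilde_mem by metis
  have Hp: "H p = H b" by (rule H_cong) (simp add: p(2))
  have Hf: "H (linf_tilde f) = H (linf_tilde b)"
    by (rule H_cong) (simp add: fourier_tilde f_def fourier_diff p(2))
  \<comment> \<open>Reflection exposes the negative coefficients; at index -n < 0 the even function
    c has coefficient b_n, hence the difference.\<close>
  have Hd: "H (linf_tilde d) = H (linf_tilde b) - H b"
  proof (rule ent_eqI)
    have "fourier (linf_tilde d) n = fourier (linf_tilde b) n - fourier b n" if "n > 0" for n
      using that by (simp add: fourier_tilde d_def c_def fourier_diff fourier_add p(2))
    then show "ent (H (linf_tilde d)) j k = ent (H (linf_tilde b) - H b) j k" for j k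
      by (simp add: ent_H)
  qed
  have p_up: "fourier p n = 0" if "n \<le> 0" for n using that by (simp add: p(2))
  have Cda: "cop_of (P2 - P1) = T d * T p - T p * T d"
    using T_commutator[of p d] p_up by (simp add: P Hp Hd right_diff_distrib)
  have Caf: "cop_of (- P2) = T p * T f - T f * T p"
    using T_commutator[of p f] p_up by (simp add: P Hp Hf algebra_simps)
  have DF: "T d * T f = T f * T d" by (rule T_commute_lower) (use d_low f_low in auto)
  have triA: "tri (<) (T p)" "ent (T p) j j = 0" for j
    by (simp_all add: tri_def ent_T p(2))
  have triF: "tri (>) (T f)" "ent (T f) j j = fourier b 0" for j
    by (simp_all add: tri_def ent_T f_low) (simp add: f_def fourier_diff p(2))
  have dc: "d + c = b" by (simp add: d_def)
  \<comment> \<open>On S_- the map \<open>M\<close> agrees with \<open>T\<close>, so the correction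
    \<open>Mc b - T b\<close> stems entirely from the even part \<open>c\<close>.\<close>
  have Md: "Mc d = T d" using Mc_mult_lower[OF d d_low one_mem] by (simp add: Mc_one)
  have "T b = T p + T f"
    by (rule ent_eqI) (simp add: ent_T f_def fourier_diff)
  moreover have "Mc b = T d + Mc c"
    using Mc_add[OF d c(1)] dc Md by simp
  ultimately have E: "cop_of K + T p + T f - T d = Mc c" using K by simp
  have e: "linf_exp c \<in> S" "linf_exp b \<in> S" by (rule exp_mem_limit(1); fact)+
  have M_exp: "Mc (linf_exp b) = exp (T d) * exp (Mc c)"
  proof -
    have "Mc (c ^ i * 1) = Mc c ^ i * 1" for i
    proof (induction i)
      case (Suc i)
      have "Mc (c ^ i * c) = Mc (c ^ i) * Mc c" by (rule Mc_mult_even[OF power_mem[OF c(1)] c])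
      then show ?case using Suc by (simp add: mult.commute power_commutes)
    qed (simp add: Mc_one)
    from Mc_exp[OF c(1) one_mem this] have c_exp: "Mc (linf_exp c) = exp (Mc c)" by simp
    \<comment> \<open>Powers of \<open>d\<close> are split off on the left, after those of
      \<open>c\<close> have been split off on the right, as the two multiplication rules for
      \<open>M\<close> permit.\<close>
    have "Mc (d ^ i * linf_exp c) = T d ^ i * Mc (linf_exp c)" for i
    proof (induction i)
      case (Suc i)
      have "Mc (d * (d ^ i * linf_exp c)) = T d * Mc (d ^ i * linf_exp c)"
        by (rule Mc_mult_lower[OF d]) (use d_low in \<open>auto intro!: mult_mem power_mem d e\<close>)
      then show ?case using Suc by (simp add: mult.assoc)
    qed simp
    from Mc_exp[OF d e(1) this] have "Mc (linf_exp d * linf_exp c) = exp (T d) * exp (Mc c)"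
      by (simp only: c_exp)
    then show ?thesis by (simp add: linf_exp_add[symmetric] dc)
  qed
  have det: "section_det N (M (linf_exp b)) = Determinant.det (sec N (exp (T d) * exp (Mc c)))" for N
    unfolding M_exp[symmetric] section_det_rop[symmetric] rop_Mc[OF e(2)] ..
  have trP2: "tr (cop_of (- P2)) = - tr (cop_of P2)"
    using tr_cop_of_diff[of 0 P2] by (simp add: tr_def)
  have "tr (cop_of K) + (tr (cop_of (P2 - P1)) - tr (cop_of (- P2))) / 2
      = tr (cop_of K) - 1 / 2 * tr (cop_of P1) + tr (cop_of P2)"
    unfolding tr_cop_of_diff trP2 by (simp add: field_simps)
  also have "\<dots> = op_trace (M b - toeplitz b) - 1 / 2 * op_trace (hankel b o\<^sub>L hankel b)
      + op_trace (hankel b o\<^sub>L hankel (linf_tilde b))"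
    unfolding K P op_trace_rop[symmetric] by (simp add: rop_Mc[OF b] rop_T rop_H)
  finally have lim: "exp (tr (cop_of K) + (tr (cop_of (P2 - P1)) - tr (cop_of (- P2))) / 2) = E_hat M b"
    unfolding E_hat_def by simp
  have "(\<lambda>N. section_det N (M (linf_exp b)) / G_const b ^ N) \<longlonglongrightarrow> E_hat M b"
    using det_sec_exp_exp_limit[OF Cda Caf DF triA triF, of K] unfolding E det G_const_def lim .
  \<comment> \<open>The limit is an exponential, hence nonzero, which permits the passage to
    quotients.\<close>
  from tendsto_divide[OF this tendsto_const[of "E_hat M b"]] show ?thesis
    by (simp add: E_hat_def)
qed

end

theorem theorem4p3:
  fixes S :: "linf set" and nrm :: "linf \<Rightarrow> real" and M :: "linf \<Rightarrow> (ell2 \<Rightarrow>\<^sub>L ell2)"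
    and a b :: linf
  assumes "compatible_pair S nrm M" and "b \<in> S" and "a = linf_exp b"
  shows "(\<lambda>N. section_det N (M a) / (G_const b ^ N * E_hat M b)) \<longlonglongrightarrow> 1"
  using compatible_pair.section_asymptotics[OF assms(1,2)] assms(3) by simp

end
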